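(* Let $G$ be a locally compact $\sigma$-compact amenable group and let $(X,G)$ be an action of $G$ on a compact metric space $X$. (1) The following statements are equivalent: (i) $(X,G)$ is mean equicontinuous; (ii) $(\mathcal{M}(X),G)$ is mean equicontinuous; (iii) $(\mathcal{M}(X),G)$ is weakly-mean equicontinuous. (2) The following statements are equivalent: (i) $(X,G)$ is diam-mean equicontinuous; (ii) $(\mathcal{M}(X),G)$ is diam-mean equicontinuous. (3) The following statements are equivalent: (i) $(\mathcal{H}(X),G)$ is diam-mean equicontinuous; (ii) $(\mathcal{H}(X),G)$ is mean equicontinuous; (iii) $(\mathcal{H}(X),G)$ is weakly-mean equicontinuous. (4) If $(\mathcal{H}(X),G)$ is diam-mean equicontinuous, then $(X,G)$ is diam-mean equicontinuous. (5) If $(X,G)$ is almost diam-mean equicontinuous, then also $(\mathcal{M}(X),G)$ and $(\mathcal{H}(X),G)$ are almost diam-mean equicontinuous.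
   Context: $G$ carries a (left) Haar measure $|\cdot|=\int(\cdot)\,\mathrm{d}g$. A sequence $\mathcal{F}=(F_n)_{n\in\mathbb{N}}$ of compact subsets of $G$ with $|F_n|>0$ is (left) Følner if $\lim_{n}|KF_n\Delta F_n|/|F_n|=0$ for all non-empty compact $K\subseteq G$; $G$ is amenable if it has a Følner sequence. An action $(X,G)$ is a homomorphism from $G$ into the homeomorphism group of a compact metric space $(X,d)$ such that $G\times X\to X$, $(g,x)\mapsto gx$ is continuous. Induced actions: $\mathcal{M}(X)$ is the set of Borel probability measures on $X$ with the Wasserstein metric $d(\mu_1,\mu_2)=\min_\kappa\int d\,\mathrm{d}\kappa$ (minimum over all couplings $\kappa$ of $\mu_1,\mu_2$), and $g\mu:=g_*\mu$ is the push forward; $\mathcal{H}(X)$ is the set of closed non-empty subsets of $X$ with the Hausdorff metric, and $gA:=g(A)$. For any action $(X,G)$ on a compact metric space $(X,d)$ (in particular the induced ones), with $\delta_x$ the Dirac measure at $x$, $B_\delta(x)=\{x'\in X:d(x,x')\le\delta\}$ and a Følner sequence $\mathcal{F}=(F_n)$: let $(F_n)_*\delta_x:=\frac{1}{|F_n|}\int_{F_n}\delta_{gx}\,\mathrm{d}g\in\mathcal{M}(X)$ and $\mathcal{W}_{\mathcal{F}}(x,y):=\limsup_{n}d((F_n)_*\delta_x,(F_n)_*\delta_y)$ (Wasserstein metric), $D_{\mathcal{F}}(x,y):=\limsup_n\frac{1}{|F_n|}\int_{F_n}d(gx,gy)\,\mathrm{d}g$, $\operatorname{Diam}_{\mathcal{F}}(A):=\limsup_n\frac{1}{|F_n|}\int_{F_n}\operatorname{diam}(gA)\,\mathrm{d}g$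 for $A\in\mathcal{H}(X)$. Set $\mathcal{W}:=\sup_{\mathcal{F}}\mathcal{W}_{\mathcal{F}}$, $D:=\sup_{\mathcal{F}}D_{\mathcal{F}}$, $\operatorname{Diam}:=\sup_{\mathcal{F}}\operatorname{Diam}_{\mathcal{F}}$, suprema over all Følner sequences in $G$. A point $x\in X$ is a weak-mean (resp. mean) equicontinuity point if for all $\epsilon>0$ there is $\delta>0$ such that $\mathcal{W}(x,y)<\epsilon$ (resp. $D(x,y)<\epsilon$) for all $y\in B_\delta(x)$; it is a diam-mean equicontinuity point if for all $\epsilon>0$ there is $\delta>0$ with $\operatorname{Diam}(B_\delta(x))<\epsilon$. The action is weakly-mean / mean / diam-mean equicontinuous if all points are weak-mean / mean / diam-mean equicontinuity points, respectively. It is almost diam-mean equicontinuous if the set of diam-mean equicontinuity points is dense in $X$. *)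

theory Defs
  imports "HOL-Probability.Probability" "HOL-Library.Set_Algebras"
begin

text \<open>
  The acting group is a type of class \<open>topological_group_add\<close>. The class
  \<open>group_add\<close> does not include commutativity, so this is an arbitrary topological group,
  written additively: \<open>g + h\<close> is the product, \<open>0\<close> the neutral element and
  \<open>K + F\<close> the product set.

  Spaces are carrier sets with a distance function, as in the locale \<open>Metric_space\<close>, so
  that the notions below apply verbatim to the induced actions on measures and on closed sets.
\<close>

definition sigma_compact_group :: "'g::topological_space itself \<Rightarrow> bool" where
  "sigma_compact_group _ \<longleftrightarrow>
     (\<exists>K :: nat \<Rightarrow> 'g set. (\<forall>n. compact (K n)) \<and> (\<Union>n. K n) = UNIV)"

definition left_haar_measure :: "'g::topological_group_add measure \<Rightarrow> bool" where
  "left_haar_measure \<mu> \<longleftrightarrow>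
     sets \<mu> = sets borel \<and>
     emeasure \<mu> UNIV \<noteq> 0 \<and>
     (\<forall>K. compact K \<longrightarrow> emeasure \<mu> K < \<infinity>) \<and>
     (\<forall>A \<in> sets borel. emeasure \<mu> A = (INF U \<in> {U. open U \<and> A \<subseteq> U}. emeasure \<mu> U)) \<and>
     (\<forall>U. open U \<longrightarrow> emeasure \<mu> U = (SUP K \<in> {K. compact K \<and> K \<subseteq> U}. emeasure \<mu> K)) \<and>
     (\<forall>g. \<forall>A \<in> sets borel. emeasure \<mu> ((\<lambda>h. g + h) ` A) = emeasure \<mu> A)"

definition folner :: "'g::topological_group_add measure \<Rightarrow> (nat \<Rightarrow> 'g set) \<Rightarrow> bool" where
  "folner \<mu> F \<longleftrightarrow>
     (\<forall>n. compact (F n) \<and> 0 < measure \<mu> (F n)) \<and>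
     (\<forall>K. compact K \<and> K \<noteq> {} \<longrightarrow>
        (\<lambda>n. measure \<mu> (sym_diff (K + F n) (F n)) / measure \<mu> (F n)) \<longlonglongrightarrow> 0)"

definition amenable :: "'g::topological_group_add measure \<Rightarrow> bool" where
  "amenable \<mu> \<longleftrightarrow> (\<exists>F. folner \<mu> F)"

definition compact_metric :: "'a set \<Rightarrow> ('a \<Rightarrow> 'a \<Rightarrow> real) \<Rightarrow> bool" where
  "compact_metric X d \<longleftrightarrow> Metric_space X d \<and> compact_space (Metric_space.mtopology X d)"

text \<open>
  With joint continuity, the two algebraic conditions say that \<open>act\<close> is a homomorphism
  into the homeomorphism group of \<open>X\<close> (the inverse of \<open>act g\<close> is \<open>act (- g)\<close>).
  Values of \<open>act g\<close> outside \<open>X\<close> are irrelevant.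
\<close>

definition continuous_action ::
    "'a set \<Rightarrow> ('a \<Rightarrow> 'a \<Rightarrow> real) \<Rightarrow> ('g::topological_group_add \<Rightarrow> 'a \<Rightarrow> 'a) \<Rightarrow> bool" where
  "continuous_action X d act \<longleftrightarrow>
     (\<forall>x \<in> X. act 0 x = x) \<and>
     (\<forall>g h. \<forall>x \<in> X. act (g + h) x = act g (act h x)) \<and>
     continuous_map (prod_topology euclidean (Metric_space.mtopology X d))
       (Metric_space.mtopology X d) (\<lambda>(g, x). act g x)"

definition mborel :: "'a set \<Rightarrow> ('a \<Rightarrow> 'a \<Rightarrow> real) \<Rightarrow> 'a measure" where
  "mborel X d = sigma X {U. openin (Metric_space.mtopology X d) U}"

definition prob_measures :: "'a set \<Rightarrow> ('a \<Rightarrow> 'a \<Rightarrow> real) \<Rightarrow> 'a measure set" where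
  "prob_measures X d = {\<nu>. sets \<nu> = sets (mborel X d) \<and> prob_space \<nu>}"

text \<open>
  A compact metric space is second countable, so the product of the Borel \<open>\<sigma>\<close>-algebras
  used for couplings is the Borel \<open>\<sigma>\<close>-algebra of the product space.
\<close>

definition couplings ::
    "'a set \<Rightarrow> ('a \<Rightarrow> 'a \<Rightarrow> real) \<Rightarrow> 'a measure \<Rightarrow> 'a measure \<Rightarrow> ('a \<times> 'a) measure set" where
  "couplings X d \<nu>\<^sub>1 \<nu>\<^sub>2 =
     {\<kappa>. sets \<kappa> = sets (mborel X d \<Otimes>\<^sub>M mborel X d) \<and> prob_space \<kappa> \<and>
         distr \<kappa> (mborel X d) fst = \<nu>\<^sub>1 \<and> distr \<kappa> (mborel X d) snd = \<nu>\<^sub>2}"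

text \<open>
  For probability measures on a compact metric space the infimum is attained. The locale
  \<open>Metric_space\<close> requires a distance to be nonnegative and symmetric on the whole type, so
  \<open>wasserstein\<close> and \<open>hausdorff_metric\<close> are set to \<open>0\<close> off their carriers.
\<close>

definition wasserstein ::
    "'a set \<Rightarrow> ('a \<Rightarrow> 'a \<Rightarrow> real) \<Rightarrow> 'a measure \<Rightarrow> 'a measure \<Rightarrow> real" where
  "wasserstein X d \<nu>\<^sub>1 \<nu>\<^sub>2 =
     (if \<nu>\<^sub>1 \<in> prob_measures X d \<and> \<nu>\<^sub>2 \<in> prob_measures X d
      then INF \<kappa> \<in> couplings X d \<nu>\<^sub>1 \<nu>\<^sub>2. LINT p|\<kappa>. d (fst p) (snd p)
      else 0)"

definition measure_action ::
    "'a set \<Rightarrow> ('a \<Rightarrow> 'a \<Rightarrow> real) \<Rightarrow> ('g \<Rightarrow> 'a \<Rightarrow> 'a) \<Rightarrow> 'g \<Rightarrow> 'a measure \<Rightarrow> 'a measure" where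
  "measure_action X d act g \<nu> = distr \<nu> (mborel X d) (act g)"

definition hyperspace :: "'a set \<Rightarrow> ('a \<Rightarrow> 'a \<Rightarrow> real) \<Rightarrow> 'a set set" where
  "hyperspace X d = {A. closedin (Metric_space.mtopology X d) A \<and> A \<noteq> {}}"

definition hausdorff_metric ::
    "'a set \<Rightarrow> ('a \<Rightarrow> 'a \<Rightarrow> real) \<Rightarrow> 'a set \<Rightarrow> 'a set \<Rightarrow> real" where
  "hausdorff_metric X d A B =
     (if A \<in> hyperspace X d \<and> B \<in> hyperspace X d
      then max (SUP a \<in> A. INF b \<in> B. d a b) (SUP b \<in> B. INF a \<in> A. d a b)
      else 0)"

definition set_action :: "('g \<Rightarrow> 'a \<Rightarrow> 'a) \<Rightarrow> 'g \<Rightarrow> 'a set \<Rightarrow> 'a set" where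
  "set_action act g A = act g ` A"

text \<open>
  The monadic bind integrates the Dirac measures \<open>return _ (act g x)\<close> against the
  normalised restriction of the Haar measure to \<open>F\<close>.
\<close>

definition empirical_measure ::
    "'g measure \<Rightarrow> 'a set \<Rightarrow> ('a \<Rightarrow> 'a \<Rightarrow> real) \<Rightarrow> ('g \<Rightarrow> 'a \<Rightarrow> 'a) \<Rightarrow> 'g set \<Rightarrow> 'a \<Rightarrow> 'a measure"
  where
  "empirical_measure \<mu> X d act F x =
     uniform_measure \<mu> F \<bind> (\<lambda>g. return (mborel X d) (act g x))"

definition mset_diam :: "('a \<Rightarrow> 'a \<Rightarrow> real) \<Rightarrow> 'a set \<Rightarrow> real" where
  "mset_diam d A = (SUP (a, b) \<in> A \<times> A. d a b)"

text \<open>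
  Upper limits and suprema are taken in the complete lattice \<open>ereal\<close>; on a compact metric
  space with an amenable group all of them are finite.
\<close>

definition weak_mean_dist_along ::
    "'g measure \<Rightarrow> 'a set \<Rightarrow> ('a \<Rightarrow> 'a \<Rightarrow> real) \<Rightarrow> ('g \<Rightarrow> 'a \<Rightarrow> 'a) \<Rightarrow> (nat \<Rightarrow> 'g set)
      \<Rightarrow> 'a \<Rightarrow> 'a \<Rightarrow> ereal" where
  "weak_mean_dist_along \<mu> X d act F x y =
     limsup (\<lambda>n. ereal (wasserstein X d (empirical_measure \<mu> X d act (F n) x)
                                        (empirical_measure \<mu> X d act (F n) y)))"

definition mean_dist_along ::
    "'g measure \<Rightarrow> ('a \<Rightarrow> 'a \<Rightarrow> real) \<Rightarrow> ('g \<Rightarrow> 'a \<Rightarrow> 'a) \<Rightarrow> (nat \<Rightarrow> 'g set)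
      \<Rightarrow> 'a \<Rightarrow> 'a \<Rightarrow> ereal" where
  "mean_dist_along \<mu> d act F x y =
     limsup (\<lambda>n. ereal (1 / measure \<mu> (F n) * (LINT g:F n|\<mu>. d (act g x) (act g y))))"

definition mean_diam_along ::
    "'g measure \<Rightarrow> ('a \<Rightarrow> 'a \<Rightarrow> real) \<Rightarrow> ('g \<Rightarrow> 'a \<Rightarrow> 'a) \<Rightarrow> (nat \<Rightarrow> 'g set)
      \<Rightarrow> 'a set \<Rightarrow> ereal" where
  "mean_diam_along \<mu> d act F A =
     limsup (\<lambda>n. ereal (1 / measure \<mu> (F n) * (LINT g:F n|\<mu>. mset_diam d (act g ` A))))"

definition weak_mean_dist ::
    "'g::topological_group_add measure \<Rightarrow> 'a set \<Rightarrow> ('a \<Rightarrow> 'a \<Rightarrow> real) \<Rightarrow> ('g \<Rightarrow> 'a \<Rightarrow> 'a)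
      \<Rightarrow> 'a \<Rightarrow> 'a \<Rightarrow> ereal" where
  "weak_mean_dist \<mu> X d act x y = (SUP F \<in> {F. folner \<mu> F}. weak_mean_dist_along \<mu> X d act F x y)"

definition mean_dist ::
    "'g::topological_group_add measure \<Rightarrow> ('a \<Rightarrow> 'a \<Rightarrow> real) \<Rightarrow> ('g \<Rightarrow> 'a \<Rightarrow> 'a)
      \<Rightarrow> 'a \<Rightarrow> 'a \<Rightarrow> ereal" where
  "mean_dist \<mu> d act x y = (SUP F \<in> {F. folner \<mu> F}. mean_dist_along \<mu> d act F x y)"

definition mean_diam ::
    "'g::topological_group_add measure \<Rightarrow> ('a \<Rightarrow> 'a \<Rightarrow> real) \<Rightarrow> ('g \<Rightarrow> 'a \<Rightarrow> 'a)
      \<Rightarrow> 'a set \<Rightarrow> ereal" where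
  "mean_diam \<mu> d act A = (SUP F \<in> {F. folner \<mu> F}. mean_diam_along \<mu> d act F A)"

definition weak_mean_equicontinuity_point ::
    "'g::topological_group_add measure \<Rightarrow> 'a set \<Rightarrow> ('a \<Rightarrow> 'a \<Rightarrow> real) \<Rightarrow> ('g \<Rightarrow> 'a \<Rightarrow> 'a)
      \<Rightarrow> 'a \<Rightarrow> bool" where
  "weak_mean_equicontinuity_point \<mu> X d act x \<longleftrightarrow>
     (\<forall>\<epsilon>>0. \<exists>\<delta>>0. \<forall>y \<in> Metric_space.mcball X d x \<delta>. weak_mean_dist \<mu> X d act x y < ereal \<epsilon>)"

definition mean_equicontinuity_point ::
    "'g::topological_group_add measure \<Rightarrow> 'a set \<Rightarrow> ('a \<Rightarrow> 'a \<Rightarrow> real) \<Rightarrow> ('g \<Rightarrow> 'a \<Rightarrow> 'a)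
      \<Rightarrow> 'a \<Rightarrow> bool" where
  "mean_equicontinuity_point \<mu> X d act x \<longleftrightarrow>
     (\<forall>\<epsilon>>0. \<exists>\<delta>>0. \<forall>y \<in> Metric_space.mcball X d x \<delta>. mean_dist \<mu> d act x y < ereal \<epsilon>)"

definition diam_mean_equicontinuity_point ::
    "'g::topological_group_add measure \<Rightarrow> 'a set \<Rightarrow> ('a \<Rightarrow> 'a \<Rightarrow> real) \<Rightarrow> ('g \<Rightarrow> 'a \<Rightarrow> 'a)
      \<Rightarrow> 'a \<Rightarrow> bool" where
  "diam_mean_equicontinuity_point \<mu> X d act x \<longleftrightarrow>
     (\<forall>\<epsilon>>0. \<exists>\<delta>>0. mean_diam \<mu> d act (Metric_space.mcball X d x \<delta>) < ereal \<epsilon>)"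

definition weakly_mean_equicontinuous ::
    "'g::topological_group_add measure \<Rightarrow> 'a set \<Rightarrow> ('a \<Rightarrow> 'a \<Rightarrow> real) \<Rightarrow> ('g \<Rightarrow> 'a \<Rightarrow> 'a) \<Rightarrow> bool"
  where
  "weakly_mean_equicontinuous \<mu> X d act \<longleftrightarrow> (\<forall>x \<in> X. weak_mean_equicontinuity_point \<mu> X d act x)"

definition mean_equicontinuous ::
    "'g::topological_group_add measure \<Rightarrow> 'a set \<Rightarrow> ('a \<Rightarrow> 'a \<Rightarrow> real) \<Rightarrow> ('g \<Rightarrow> 'a \<Rightarrow> 'a) \<Rightarrow> bool"
  where
  "mean_equicontinuous \<mu> X d act \<longleftrightarrow> (\<forall>x \<in> X. mean_equicontinuity_point \<mu> X d act x)"

definition diam_mean_equicontinuous ::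
    "'g::topological_group_add measure \<Rightarrow> 'a set \<Rightarrow> ('a \<Rightarrow> 'a \<Rightarrow> real) \<Rightarrow> ('g \<Rightarrow> 'a \<Rightarrow> 'a) \<Rightarrow> bool"
  where
  "diam_mean_equicontinuous \<mu> X d act \<longleftrightarrow> (\<forall>x \<in> X. diam_mean_equicontinuity_point \<mu> X d act x)"

definition almost_diam_mean_equicontinuous ::
    "'g::topological_group_add measure \<Rightarrow> 'a set \<Rightarrow> ('a \<Rightarrow> 'a \<Rightarrow> real) \<Rightarrow> ('g \<Rightarrow> 'a \<Rightarrow> 'a) \<Rightarrow> bool"
  where
  "almost_diam_mean_equicontinuous \<mu> X d act \<longleftrightarrow>
     Metric_space.mtopology X d closure_of {x \<in> X. diam_mean_equicontinuity_point \<mu> X d act x} = X"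

end

theory Submission
  imports Defs
begin

text \<open>
  All statements compare averages, over the sets of a Folner sequence, of distances or of
  diameters along orbits. Implications from a strong to a weak notion are estimates of averages:
  a coupling of two empirical measures is obtained by moving both points with the same group
  element, and two points of a ball are no further apart than its diameter. The implications
  from the induced actions back to the space use the isometric embeddings \<open>x \<mapsto> \<delta>_x\<close> and
  \<open>x \<mapsto> {x}\<close>, which commute with the actions.

  The content lies in the implications that start from weak-mean equicontinuity. It only
  bounds a Wasserstein distance between two empirical measures, and hence only compares the
  averages of one Lipschitz function along two orbits
  (\<open>lipschitz_average_le_emp_wasserstein\<close>). The point is to choose the function and the orbits
  so that a difference of two averages controls the average of a distance.

  On measures, the distance of \<open>\<nu>\<close> to the set of Dirac measures is such a function. It vanishes
  along the orbit of \<open>\<delta>_x\<close>, and at the translate of \<open>(\<delta>_x + \<delta>_y) / 2\<close> by \<open>g\<close> it is at least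
  \<open>d (g x) (g y) / 2\<close>. So closeness of the two empirical measures bounds the mean distance of
  \<open>x\<close> and \<open>y\<close> (\<open>avg_dist_le_emp_wasserstein_two_point\<close>).

  On closed sets, for \<open>A \<subseteq> B\<close> the function \<open>A \<mapsto> dist (z, A)\<close> is monotone, and the Hausdorff
  distance of \<open>A\<close> and \<open>B\<close> is at most the sum of the nonnegative differences
  \<open>dist (z, A) - dist (z, B)\<close> over a finite net of points \<open>z\<close>, up to the mesh of the net
  (\<open>hausdorff_nested_le\<close>). So weak-mean equicontinuity controls the mean distance of nested
  sets. Comparing a point with a ball around it shows that \<open>X\<close> is diam-mean equicontinuous. For
  an arbitrary set \<open>A'\<close> near \<open>A\<close>, the part of \<open>A'\<close> that leaves \<open>A\<close> is controlled by a closed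
  neighbourhood of \<open>A\<close>, and the part of \<open>A\<close> that \<open>A'\<close> misses by a finite net \<open>S\<close> of \<open>A\<close> and by the
  diameters of small balls around the finitely many points of \<open>S\<close>
  (\<open>weakly_mean_of_sets_imp_diam_mean_of_sets\<close>).

  From the space to its measures, let \<open>\<kappa>\<close> be a nearly optimal coupling of \<open>\<nu>\<close> and \<open>\<nu>'\<close>. The cost
  of the translated coupling is the integral of \<open>d (g x) (g y)\<close> with respect to \<open>\<kappa>\<close>. Most of the
  mass of \<open>\<kappa>\<close> sits on close pairs, for which the average over \<open>g\<close> is small by mean equicontinuity;
  Fubini and dominated convergence exchange the two integrals and the limit
  (\<open>mean_imp_mean_of_measures\<close>). For diameters, the close pairs lie in balls around a finite net,
  which gives a bound that depends only on the distance of \<open>\<nu>\<close> and \<open>\<nu>'\<close>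
  (\<open>wasserstein_action_le_sum_diam\<close>). The same estimates, applied to finite sets of diam-mean
  equicontinuity points and to measures carried by such sets, show that these are diam-mean
  equicontinuity points, and they are dense.

  The rest makes the induced spaces available: the Wasserstein distance is a metric, where the
  triangle inequality rests on gluing couplings along a finite partition (\<open>finite_gluing\<close>),
  and both induced spaces are separable. Separability makes the distance measurable for the
  product \<open>\<sigma>\<close>-algebra, without which a transport cost would not be a meaningful integral.
\<close>

section \<open>Bounded separable metric spaces and the Wasserstein distance\<close>

text \<open>
  The common ground of the compact space, of its probability measures and of its closed sets. A
  bound \<open>K\<close> and a countable dense set \<open>C\<close> are what integration of the distance takes from
  compactness.
\<close>

locale bounded_separable_metric = Metric_space M d for M :: "'a set" and d :: "'a \<Rightarrow> 'a \<Rightarrow> real" +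
  fixes K :: real and C :: "'a set"
  assumes K_pos: "0 < K" and le_K: "x \<in> M \<Longrightarrow> y \<in> M \<Longrightarrow> d x y \<le> K"
    and countable_C: "countable C" and C_subset: "C \<subseteq> M"
    and C_dense: "x \<in> M \<Longrightarrow> 0 < e \<Longrightarrow> \<exists>c\<in>C. d x c < e"
begin

abbreviation \<B> :: "'a measure" where "\<B> \<equiv> mborel M d"
abbreviation \<P> :: "'a measure set" where "\<P> \<equiv> prob_measures M d"
abbreviation \<W> :: "'a measure \<Rightarrow> 'a measure \<Rightarrow> real" where "\<W> \<equiv> wasserstein M d"
abbreviation \<H> :: "'a set set" where "\<H> \<equiv> hyperspace M d"
abbreviation dH :: "'a set \<Rightarrow> 'a set \<Rightarrow> real" where "dH \<equiv> hausdorff_metric M d"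

lemma openin_sets_Pow: "{U. openin mtopology U} \<subseteq> Pow M"
  using openin_subset[of mtopology] by auto

lemma space_mborel [simp]: "space \<B> = M"
  unfolding mborel_def by (rule space_measure_of[OF openin_sets_Pow])

lemma sets_mborel_openin: "openin mtopology U \<Longrightarrow> U \<in> sets \<B>"
  unfolding mborel_def by (subst sets_measure_of[OF openin_sets_Pow]) auto

lemma sets_mborel_closedin:
  assumes "closedin mtopology A" shows "A \<in> sets \<B>"
proof -
  have "M - A \<in> sets \<B>"
    using assms by (intro sets_mborel_openin) (auto simp: closedin_def)
  then have "M - (M - A) \<in> sets \<B>"
    using sets.compl_sets[of "M - A" \<B>] by simp
  moreover have "M - (M - A) = A" using closedin_subset[OF assms] by auto
  ultimately show ?thesis by simp
qed

lemma sets_mborel_singleton: "x \<in> M \<Longrightarrow> {x} \<in> sets \<B>"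
  by (rule sets_mborel_closedin) (simp add: closedin_Hausdorff_singleton Hausdorff_space_mtopology)

lemma sets_mborel_finite: "finite S \<Longrightarrow> S \<subseteq> M \<Longrightarrow> S \<in> sets \<B>"
  by (rule sets_mborel_closedin)
    (simp add: finite_imp_compactin compactin_imp_closedin Hausdorff_space_mtopology)

lemma measurable_mborelI:
  assumes "\<And>x. x \<in> space N \<Longrightarrow> f x \<in> M"
    and "\<And>U. openin mtopology U \<Longrightarrow> f -` U \<inter> space N \<in> sets N"
  shows "f \<in> measurable N \<B>"
  unfolding mborel_def using assms by (intro measurable_measure_of openin_sets_Pow) auto

lemma borel_measurable_continuous_map:
  fixes f :: "'a \<Rightarrow> 'b::topological_space"
  assumes "continuous_map mtopology euclidean f"
  shows "f \<in> borel_measurable \<B>"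
proof (rule borel_measurableI)
  fix S :: "'b set" assume "open S"
  then have "openin mtopology {x \<in> topspace mtopology. f x \<in> S}"
    using assms by (intro openin_continuous_map_preimage[where Y=euclidean]) auto
  moreover have "{x \<in> topspace mtopology. f x \<in> S} = f -` S \<inter> space \<B>" by auto
  ultimately show "f -` S \<inter> space \<B> \<in> sets \<B>" using sets_mborel_openin by metis
qed

lemma borel_measurable_lipschitz:
  assumes "\<And>x y. x \<in> M \<Longrightarrow> y \<in> M \<Longrightarrow> \<bar>f x - f y\<bar> \<le> L * d x y"
  shows "(f :: 'a \<Rightarrow> real) \<in> borel_measurable \<B>"
proof (rule borel_measurable_continuous_map)
  show "continuous_map mtopology euclidean f"
    unfolding mtopology_is_euclidean[symmetric]
  proof (subst metric_continuous_map, rule Met_TC.Metric_space_axioms, safe)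
    fix a and e :: real assume a: "a \<in> M" "0 < e"
    have *: "dist (f a) (f x) < e" if x: "x \<in> M" "d a x < e / (\<bar>L\<bar> + 1)" for x
    proof -
      have "\<bar>f a - f x\<bar> \<le> L * d a x" using assms a x by auto
      also have "\<dots> \<le> (\<bar>L\<bar> + 1) * d a x" using nonneg[of a x] by (intro mult_right_mono) auto
      also have "\<dots> < e" using x by (simp add: field_simps)
      finally show ?thesis by (simp add: dist_real_def)
    qed
    show "\<exists>\<delta>>0. \<forall>x. x \<in> M \<and> d a x < \<delta> \<longrightarrow> dist (f a) (f x) < e"
      using * a by (intro exI[of _ "e / (\<bar>L\<bar> + 1)"]) auto
  qed auto
qed

lemma borel_measurable_dist_point: "c \<in> M \<Longrightarrow> (\<lambda>x. d x c) \<in> borel_measurable \<B>"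
  by (rule borel_measurable_lipschitz[of _ 1])
    (smt (verit) commute triangle)

lemma C_nonempty: "M \<noteq> {} \<Longrightarrow> C \<noteq> {}"
  using C_dense[of _ 1] by fastforce

text \<open>
  By continuity alone the distance is Borel on the product space. The countable infimum of sums of
  functions of one variable shows that it is measurable for the product of the two
  \<open>\<sigma>\<close>-algebras, on which couplings live.
\<close>

lemma dist_eq_INF:
  assumes "x \<in> M" "y \<in> M" shows "d x y = (INF c\<in>C. d x c + d y c)"
proof (rule antisym)
  show "d x y \<le> (INF c\<in>C. d x c + d y c)"
    using assms C_nonempty C_subset by (intro cINF_greatest) (auto intro: triangle')
  show "(INF c\<in>C. d x c + d y c) \<le> d x y"
  proof (rule field_le_epsilon)
    fix e :: real assume "0 < e"
    then obtain c where c: "c \<in> C" "d y c < e / 2" using C_dense[OF assms(2), of "e/2"] by auto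
    have "(INF c\<in>C. d x c + d y c) \<le> d x c + d y c"
      using c by (intro cINF_lower bdd_belowI[of _ 0]) (auto simp: nonneg)
    also have "\<dots> \<le> d x y + e" using triangle[of x y c] assms c C_subset by force
    finally show "(INF c\<in>C. d x c + d y c) \<le> d x y + e" .
  qed
qed

lemma borel_measurable_dist [measurable]:
  assumes "f \<in> measurable N \<B>" "h \<in> measurable N \<B>"
  shows "(\<lambda>\<omega>. d (f \<omega>) (h \<omega>)) \<in> borel_measurable N"
proof (cases "M = {}")
  case True
  then have "space N = {}" using measurable_space[OF assms(1)] by (metis space_mborel empty_iff equals0I)
  then show ?thesis by (simp add: measurable_def)
next
  case False
  have "(\<lambda>\<omega>. INF c\<in>C. d (f \<omega>) c + d (h \<omega>) c) \<in> borel_measurable N"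
  proof (rule borel_measurable_cINF[OF countable_C])
    fix c assume "c \<in> C"
    with C_subset have c: "c \<in> M" by auto
    show "(\<lambda>\<omega>. d (f \<omega>) c + d (h \<omega>) c) \<in> borel_measurable N"
      using measurable_compose[OF assms(1) borel_measurable_dist_point[OF c]]
        measurable_compose[OF assms(2) borel_measurable_dist_point[OF c]] by measurable
  qed (auto intro!: bdd_belowI[of _ 0] simp: nonneg)
  also have "?this \<longleftrightarrow> ?thesis"
    using assms by (intro measurable_cong dist_eq_INF[symmetric]) (auto dest: measurable_space)
  finally show ?thesis .
qed

lemma borel_measurable_dist_pair [measurable]:
  "(\<lambda>p. d (fst p) (snd p)) \<in> borel_measurable (\<B> \<Otimes>\<^sub>M \<B>)"
  by (intro borel_measurable_dist measurable_fst measurable_snd)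

lemma integrable_dist:
  assumes "prob_space N" "f \<in> measurable N \<B>" "h \<in> measurable N \<B>"
  shows "integrable N (\<lambda>\<omega>. d (f \<omega>) (h \<omega>))"
proof -
  interpret prob_space N by fact
  show ?thesis
    using assms(2,3) by (intro integrable_const_bound[of _ K])
      (auto intro!: AE_I2 le_K borel_measurable_dist dest: measurable_space)
qed

lemma mem_prob_measures:
  "\<nu> \<in> \<P> \<longleftrightarrow> sets \<nu> = sets \<B> \<and> prob_space \<nu>"
  by (simp add: prob_measures_def)

lemma space_prob_measures: "\<nu> \<in> \<P> \<Longrightarrow> space \<nu> = M"
  by (auto simp: prob_measures_def dest: sets_eq_imp_space_eq)

lemma distr_mem_prob_measures:
  "prob_space N \<Longrightarrow> f \<in> measurable N \<B> \<Longrightarrow> distr N \<B> f \<in> \<P>"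
  by (simp add: mem_prob_measures prob_space.prob_space_distr)

lemma return_mem_prob_measures: "x \<in> M \<Longrightarrow> return \<B> x \<in> \<P>"
  by (simp add: mem_prob_measures prob_space_return)

text \<open>
  The infimum that defines the Wasserstein distance is an infimum of real numbers, so it
  says nothing before a coupling is exhibited.
\<close>

lemma couplings_nonempty:
  assumes "\<nu>1 \<in> \<P>" "\<nu>2 \<in> \<P>"
  shows "\<nu>1 \<Otimes>\<^sub>M \<nu>2 \<in> couplings M d \<nu>1 \<nu>2"
proof -
  have s: "sets \<nu>1 = sets \<B>" "sets \<nu>2 = sets \<B>" and p: "prob_space \<nu>1" "prob_space \<nu>2"
    using assms by (auto simp: mem_prob_measures)
  interpret A: prob_space \<nu>1 by fact
  interpret B: prob_space \<nu>2 by fact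
  interpret pair_prob_space \<nu>1 \<nu>2 ..
  have "distr (\<nu>1 \<Otimes>\<^sub>M \<nu>2) \<B> fst = distr (\<nu>1 \<Otimes>\<^sub>M \<nu>2) \<nu>1 fst"
    by (rule distr_cong) (auto simp: s)
  then have f: "distr (\<nu>1 \<Otimes>\<^sub>M \<nu>2) \<B> fst = \<nu>1" by (simp add: B.distr_pair_fst)
  have "emeasure (distr (\<nu>1 \<Otimes>\<^sub>M \<nu>2) \<B> snd) A = emeasure \<nu>2 A" if "A \<in> sets \<B>" for A
  proof -
    have "emeasure (distr (\<nu>1 \<Otimes>\<^sub>M \<nu>2) \<B> snd) A = emeasure (\<nu>1 \<Otimes>\<^sub>M \<nu>2) (space \<nu>1 \<times> A)"
      using that sets.sets_into_space[of A \<nu>2] s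
      by (subst emeasure_distr)
        (auto intro!: arg_cong[where f="emeasure (\<nu>1 \<Otimes>\<^sub>M \<nu>2)"] simp: space_pair_measure measurable_cong_sets[OF refl s(2)[symmetric]])
    also have "\<dots> = emeasure \<nu>2 A"
      using that s by (subst B.emeasure_pair_measure_Times) (auto simp: A.emeasure_space_1)
    finally show ?thesis .
  qed
  then have g: "distr (\<nu>1 \<Otimes>\<^sub>M \<nu>2) \<B> snd = \<nu>2"
    by (intro measure_eqI) (auto simp: s)
  show ?thesis unfolding couplings_def using f g s by (auto intro: prob_space_axioms sets_pair_measure_cong)
qed

lemma coupling_cost_nonneg: "0 \<le> (LINT p|\<kappa>. d (fst p) (snd p))"
  by (rule integral_nonneg_AE) (simp add: nonneg)

lemma wasserstein_le_cost:
  assumes "\<nu>1 \<in> \<P>" "\<nu>2 \<in> \<P>" "\<kappa> \<in> couplings M d \<nu>1 \<nu>2"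
  shows "\<W> \<nu>1 \<nu>2 \<le> (LINT p|\<kappa>. d (fst p) (snd p))"
  unfolding wasserstein_def using assms
  by (auto intro!: cINF_lower bdd_belowI[of _ 0] coupling_cost_nonneg)

text \<open>
  The joint law of two random variables is a coupling of their laws. Upper bounds on Wasserstein
  distances are obtained from this by choosing the two random variables on one probability space.
\<close>

lemma wasserstein_distr_le:
  assumes N: "prob_space N" and f: "f \<in> measurable N \<B>" and h: "h \<in> measurable N \<B>"
  shows "\<W> (distr N \<B> f) (distr N \<B> h) \<le> (LINT \<omega>|N. d (f \<omega>) (h \<omega>))"
proof -
  let ?\<kappa> = "distr N (\<B> \<Otimes>\<^sub>M \<B>) (\<lambda>\<omega>. (f \<omega>, h \<omega>))"
  have fh: "(\<lambda>\<omega>. (f \<omega>, h \<omega>)) \<in> measurable N (\<B> \<Otimes>\<^sub>M \<B>)" using f h by measurable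
  have "?\<kappa> \<in> couplings M d (distr N \<B> f) (distr N \<B> h)"
    unfolding couplings_def using fh
    by (auto intro!: prob_space.prob_space_distr[OF N] simp: distr_distr comp_def)
  then have "\<W> (distr N \<B> f) (distr N \<B> h) \<le> (LINT p|?\<kappa>. d (fst p) (snd p))"
    using N f h by (intro wasserstein_le_cost distr_mem_prob_measures)
  also have "\<dots> = (LINT \<omega>|N. d (f \<omega>) (h \<omega>))"
    using fh by (subst integral_distr) auto
  finally show ?thesis .
qed

lemma wasserstein_nonneg: "0 \<le> \<W> \<nu>1 \<nu>2"
  unfolding wasserstein_def using couplings_nonempty
  by (auto intro!: cINF_greatest coupling_cost_nonneg)

lemma obtain_coupling:
  assumes "\<nu>1 \<in> \<P>" "\<nu>2 \<in> \<P>" "0 < e"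
  obtains \<kappa> where "\<kappa> \<in> couplings M d \<nu>1 \<nu>2"
    "(LINT p|\<kappa>. d (fst p) (snd p)) < \<W> \<nu>1 \<nu>2 + e"
proof -
  have "\<exists>\<kappa>\<in>couplings M d \<nu>1 \<nu>2. (LINT p|\<kappa>. d (fst p) (snd p)) < \<W> \<nu>1 \<nu>2 + e"
    using assms couplings_nonempty[OF assms(1,2)]
    by (subst cINF_less_iff[symmetric])
      (auto simp: wasserstein_def intro!: bdd_belowI[of _ 0] coupling_cost_nonneg)
  then show ?thesis using that by blast
qed

lemma couplingD:
  assumes "\<kappa> \<in> couplings M d \<nu>1 \<nu>2"
  shows "prob_space \<kappa>" "fst \<in> measurable \<kappa> \<B>" "snd \<in> measurable \<kappa> \<B>"
    "distr \<kappa> \<B> fst = \<nu>1" "distr \<kappa> \<B> snd = \<nu>2" "sets \<kappa> = sets (\<B> \<Otimes>\<^sub>M \<B>)"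
  using assms by (auto simp: couplings_def measurable_cong_sets[OF _ refl, of \<kappa> "\<B> \<Otimes>\<^sub>M \<B>"])

lemma wasserstein_commute_le:
  assumes \<nu>: "\<nu>1 \<in> \<P>" "\<nu>2 \<in> \<P>"
  shows "\<W> \<nu>2 \<nu>1 \<le> \<W> \<nu>1 \<nu>2"
proof (rule field_le_epsilon)
  fix e :: real assume "0 < e"
  then obtain \<kappa> where \<kappa>: "\<kappa> \<in> couplings M d \<nu>1 \<nu>2"
    "(LINT p|\<kappa>. d (fst p) (snd p)) < \<W> \<nu>1 \<nu>2 + e"
    using obtain_coupling[OF \<nu>] by blast
  note c = couplingD[OF \<kappa>(1)]
  have "\<W> (distr \<kappa> \<B> snd) (distr \<kappa> \<B> fst) \<le> (LINT p|\<kappa>. d (snd p) (fst p))"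
    using c by (intro wasserstein_distr_le)
  then show "\<W> \<nu>2 \<nu>1 \<le> \<W> \<nu>1 \<nu>2 + e"
    using \<kappa>(2) c by (simp add: commute)
qed

lemma integrable_lipschitz:
  assumes "\<And>x y. x \<in> M \<Longrightarrow> y \<in> M \<Longrightarrow> \<bar>\<phi> x - \<phi> y\<bar> \<le> L * d x y"
    and N: "prob_space N" and f: "f \<in> measurable N \<B>"
  shows "integrable N (\<lambda>\<omega>. \<phi> (f \<omega>) :: real)"
proof -
  interpret prob_space N by fact
  obtain \<omega>0 where "\<omega>0 \<in> space N" using not_empty by auto
  then have x0: "f \<omega>0 \<in> M" using measurable_space[OF f] by simp
  have "\<bar>\<phi> (f \<omega>)\<bar> \<le> \<bar>\<phi> (f \<omega>0)\<bar> + \<bar>L\<bar> * K" if "\<omega> \<in> space N" for \<omega>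
  proof -
    have "f \<omega> \<in> M" using that measurable_space[OF f] by simp
    then have "\<bar>\<phi> (f \<omega>) - \<phi> (f \<omega>0)\<bar> \<le> L * d (f \<omega>) (f \<omega>0)" and k: "d (f \<omega>) (f \<omega>0) \<le> K"
      using assms(1) x0 le_K by auto
    note this(1)
    also have "L * d (f \<omega>) (f \<omega>0) \<le> \<bar>L\<bar> * K"
      using k nonneg[of "f \<omega>" "f \<omega>0"] by (intro mult_mono) auto
    finally show ?thesis by linarith
  qed
  then show ?thesis
    by (intro integrable_const_bound[of _ "\<bar>\<phi> (f \<omega>0)\<bar> + \<bar>L\<bar> * K"]
        measurable_compose[OF f borel_measurable_lipschitz[OF assms(1)]]) auto
qed

text \<open>
  The elementary half of Kantorovich--Rubinstein duality, valid for every coupling separately.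
  Lower bounds on Wasserstein distances are obtained from it by choosing a Lipschitz function.
\<close>

lemma kantorovich_lower_bound:
  assumes lip: "\<And>x y. x \<in> M \<Longrightarrow> y \<in> M \<Longrightarrow> \<bar>\<phi> x - \<phi> y\<bar> \<le> d x y"
    and \<nu>: "\<nu>1 \<in> \<P>" "\<nu>2 \<in> \<P>"
  shows "(LINT x|\<nu>1. \<phi> x) - (LINT x|\<nu>2. \<phi> x) \<le> \<W> \<nu>1 \<nu>2"
proof -
  have lip1: "\<And>x y. x \<in> M \<Longrightarrow> y \<in> M \<Longrightarrow> \<bar>\<phi> x - \<phi> y\<bar> \<le> 1 * d x y" using lip by simp
  have *: "(LINT x|\<nu>1. \<phi> x) - (LINT x|\<nu>2. \<phi> x) \<le> (LINT p|\<kappa>. d (fst p) (snd p))"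
    if \<kappa>: "\<kappa> \<in> couplings M d \<nu>1 \<nu>2" for \<kappa>
  proof -
    note c = couplingD[OF \<kappa>]
    have m: "\<phi> \<in> borel_measurable \<B>" by (rule borel_measurable_lipschitz[OF lip1])
    have "(LINT x|\<nu>1. \<phi> x) = (LINT p|\<kappa>. \<phi> (fst p))" "(LINT x|\<nu>2. \<phi> x) = (LINT p|\<kappa>. \<phi> (snd p))"
      using c m by (auto simp flip: c(4,5) intro!: integral_distr)
    then have "(LINT x|\<nu>1. \<phi> x) - (LINT x|\<nu>2. \<phi> x) = (LINT p|\<kappa>. \<phi> (fst p) - \<phi> (snd p))"
      using integrable_lipschitz[OF lip1 c(1)] c(2,3) by simp
    also have "\<dots> \<le> (LINT p|\<kappa>. d (fst p) (snd p))"
    proof (rule integral_mono)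
      fix p assume "p \<in> space \<kappa>"
      then have "fst p \<in> M" "snd p \<in> M" using measurable_space[OF c(2)] measurable_space[OF c(3)] by auto
      then show "\<phi> (fst p) - \<phi> (snd p) \<le> d (fst p) (snd p)" using lip[of "fst p" "snd p"] by linarith
    qed (use integrable_lipschitz[OF lip1 c(1)] c(2,3) integrable_dist[OF c(1,2,3)] in auto)
    finally show ?thesis .
  qed
  show ?thesis
    using \<nu> couplings_nonempty[OF \<nu>] * by (auto simp: wasserstein_def intro!: cINF_greatest)
qed

lemma mset_diam_upper:
  assumes "A \<subseteq> M" "x \<in> A" "y \<in> A" shows "d x y \<le> mset_diam d A"
  unfolding mset_diam_def using assms le_K
  by (intro cSUP_upper2[where x="(x,y)"] bdd_aboveI[of _ K]) auto

lemma mset_diam_least: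
  assumes "A \<noteq> {}" "\<And>x y. x \<in> A \<Longrightarrow> y \<in> A \<Longrightarrow> d x y \<le> r" shows "mset_diam d A \<le> r"
  unfolding mset_diam_def using assms by (intro cSUP_least) auto

lemma mset_diam_nonneg: "A \<subseteq> M \<Longrightarrow> A \<noteq> {} \<Longrightarrow> 0 \<le> mset_diam d A"
  using mset_diam_upper nonneg by (meson ex_in_conv order_trans)

lemma mset_diam_le_K: "A \<subseteq> M \<Longrightarrow> A \<noteq> {} \<Longrightarrow> mset_diam d A \<le> K"
  by (intro mset_diam_least le_K) auto

lemma mset_diam_le_radius:
  assumes "A \<subseteq> M" "A \<noteq> {}" "z \<in> M" "\<And>x. x \<in> A \<Longrightarrow> d z x \<le> r"
  shows "mset_diam d A \<le> 2 * r"
  using assms triangle''[of _ z] by (intro mset_diam_least) (auto, smt (verit) subsetD)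

definition infd :: "'a \<Rightarrow> 'a set \<Rightarrow> real" where "infd x A = (INF a\<in>A. d x a)"

lemma infd_nonneg: "A \<noteq> {} \<Longrightarrow> 0 \<le> infd x A"
  unfolding infd_def by (intro cINF_greatest) (auto simp: nonneg)

lemma infd_le: "a \<in> A \<Longrightarrow> infd x A \<le> d x a"
  unfolding infd_def by (intro cINF_lower bdd_belowI[of _ 0]) (auto simp: nonneg)

lemma infd_greatest: "A \<noteq> {} \<Longrightarrow> (\<And>a. a \<in> A \<Longrightarrow> r \<le> d x a) \<Longrightarrow> r \<le> infd x A"
  unfolding infd_def by (intro cINF_greatest)

lemma infd_lessD: "A \<noteq> {} \<Longrightarrow> infd x A < r \<Longrightarrow> \<exists>a\<in>A. d x a < r"
  by (metis infd_greatest not_le)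

lemma infd_mem: "x \<in> A \<Longrightarrow> x \<in> M \<Longrightarrow> infd x A \<le> 0"
  using infd_le[of x A x] by simp

lemma infd_antimono: "A \<noteq> {} \<Longrightarrow> A \<subseteq> B \<Longrightarrow> infd x B \<le> infd x A"
  by (rule infd_greatest) (auto intro: infd_le)

lemma infd_singleton [simp]: "infd x {a} = d x a"
  by (simp add: infd_def)

lemma infd_triangle:
  assumes "A \<noteq> {}" "A \<subseteq> M" "x \<in> M" "y \<in> M" shows "infd x A \<le> d x y + infd y A"
proof -
  have "infd x A - d x y \<le> infd y A"
  proof (rule infd_greatest)
    fix a assume "a \<in> A"
    then show "infd x A - d x y \<le> d y a"
      using infd_le[of a A x] triangle[of x y a] assms by force
  qed fact
  then show ?thesis by simp
qed

lemma infd_lipschitz: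
  assumes "A \<noteq> {}" "A \<subseteq> M" "x \<in> M" "y \<in> M" shows "\<bar>infd x A - infd y A\<bar> \<le> d x y"
  using infd_triangle[OF assms] infd_triangle[OF assms(1,2,4,3)] by (simp add: commute)

lemma infd_le_K:
  assumes "A \<subseteq> M" "A \<noteq> {}" "x \<in> M" shows "infd x A \<le> K"
proof -
  obtain a where "a \<in> A" using assms by auto
  then show ?thesis using infd_le[of a A x] le_K[of x a] assms by force
qed

lemma infd_eq_0_imp_mem:
  assumes "closedin mtopology A" "A \<noteq> {}" "x \<in> M" "infd x A \<le> 0" shows "x \<in> A"
proof (rule ccontr)
  assume "x \<notin> A"
  then have "x \<in> M - A" "openin mtopology (M - A)" using assms by (auto simp: closedin_def)
  then obtain r where r: "r > 0" "mball x r \<subseteq> M - A" by (auto simp: openin_mtopology)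
  obtain a where "a \<in> A" "d x a < r" using infd_lessD[OF assms(2), of x r] assms(4) r by auto
  then have "a \<in> mball x r" using assms(3) closedin_subset[OF assms(1)] by auto
  then show False using r(2) \<open>a \<in> A\<close> by blast
qed

end

section \<open>Averages over Folner sequences\<close>

lemma borel_measurable_locally_close:
  fixes f :: "'g::topological_space \<Rightarrow> real"
  assumes "\<And>g e. 0 < e \<Longrightarrow> \<exists>U. open U \<and> g \<in> U \<and> (\<forall>h\<in>U. \<bar>f h - f g\<bar> \<le> e)"
  shows "f \<in> borel_measurable borel"
proof (rule borel_measurable_continuous_onI)
  show "continuous_on UNIV f"
  proof (clarsimp simp: continuous_on_def tendsto_iff eventually_at_topological)
    fix g and e :: real assume "0 < e"
    then obtain U where "open U" "g \<in> U" "\<forall>h\<in>U. \<bar>f h - f g\<bar> \<le> e / 2" using assms[of "e/2" g] by auto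
    with \<open>0 < e\<close> show "\<exists>S. open S \<and> g \<in> S \<and> (\<forall>x\<in>S. x \<noteq> g \<longrightarrow> dist (f x) (f g) < e)"
      by (intro exI[of _ U]) (auto simp: dist_real_def)
  qed
qed

lemma eventually_le_less:
  fixes a b :: "nat \<Rightarrow> real"
  assumes "\<forall>\<^sub>F n in sequentially. b n < e" "\<And>n. a n \<le> b n"
  shows "\<forall>\<^sub>F n in sequentially. a n < e"
  using assms(1) by (rule eventually_mono) (rule le_less_trans[OF assms(2)])

lemma limsup_ereal_lessD:
  "limsup (\<lambda>n. ereal (a n)) < ereal c \<Longrightarrow> \<forall>\<^sub>F n in sequentially. a n < c"
  by (drule Limsup_lessD) simp

lemma limsup_ereal_le:
  "\<forall>\<^sub>F n in sequentially. a n \<le> c \<Longrightarrow> limsup (\<lambda>n. ereal (a n)) \<le> ereal c"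
  by (rule Limsup_bounded) simp

lemma SUP_limsup_lessD:
  assumes "(SUP i\<in>I. limsup (\<lambda>n. ereal (a i n))) < ereal c" "i \<in> I"
  shows "\<forall>\<^sub>F n in sequentially. a i n < c"
  using assms by (intro limsup_ereal_lessD) (rule SUP_lessD)

lemma SUP_limsup_less:
  assumes "\<And>i. i \<in> I \<Longrightarrow> \<forall>\<^sub>F n in sequentially. a i n < c" "c < c'"
  shows "(SUP i\<in>I. limsup (\<lambda>n. ereal (a i n))) < ereal c'"
proof -
  have "(SUP i\<in>I. limsup (\<lambda>n. ereal (a i n))) \<le> ereal c"
    by (intro SUP_least limsup_ereal_le eventually_mono[OF assms(1)]) auto
  also have "\<dots> < ereal c'" using assms(2) by simp
  finally show ?thesis .
qed

text \<open>
  Halving \<open>e\<close> absorbs the difference between eventual bounds and bounds on the upper limit, and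
  between a bound for each index and a bound on the supremum. The smallness conditions in the
  equicontinuity notions thus become statements about eventual smallness of real averages along
  each Folner sequence.
\<close>

lemma SUP_limsup_small_iff:
  fixes a :: "'b \<Rightarrow> 'c \<Rightarrow> nat \<Rightarrow> real" and B :: "real \<Rightarrow> 'b set"
  shows "(\<forall>e>0. \<exists>\<delta>>0. \<forall>y\<in>B \<delta>. (SUP i\<in>I. limsup (\<lambda>n. ereal (a y i n))) < ereal e) \<longleftrightarrow>
    (\<forall>e>0. \<exists>\<delta>>0. \<forall>y\<in>B \<delta>. \<forall>i\<in>I. \<forall>\<^sub>F n in sequentially. a y i n < e)" (is "?L \<longleftrightarrow> ?R")
proof
  assume L: ?L
  show ?R
  proof (intro allI impI)
    fix e :: real assume "0 < e"
    with L obtain \<delta> where \<delta>: "0 < \<delta>" "\<forall>y\<in>B \<delta>. (SUP i\<in>I. limsup (\<lambda>n. ereal (a y i n))) < ereal e" by blast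
    then show "\<exists>\<delta>>0. \<forall>y\<in>B \<delta>. \<forall>i\<in>I. \<forall>\<^sub>F n in sequentially. a y i n < e"
      by (intro exI[of _ \<delta>] conjI ballI) (auto intro!: SUP_limsup_lessD[where I=I and a="a _"])
  qed
next
  assume R: ?R
  show ?L
  proof (intro allI impI)
    fix e :: real assume e: "0 < e"
    then have "0 < e / 2" by simp
    with R obtain \<delta> where "0 < \<delta>" "\<And>y i. y \<in> B \<delta> \<Longrightarrow> i \<in> I \<Longrightarrow> \<forall>\<^sub>F n in sequentially. a y i n < e / 2"
      by meson
    with e show "\<exists>\<delta>>0. \<forall>y\<in>B \<delta>. (SUP i\<in>I. limsup (\<lambda>n. ereal (a y i n))) < ereal e"
      by (intro exI[of _ \<delta>] conjI ballI SUP_limsup_less[where c="e / 2"]) auto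
  qed
qed

text \<open>
  On a compact space, joint continuity makes \<open>act g x\<close> continuous in \<open>g\<close> uniformly in \<open>x\<close>. The
  induced actions inherit this uniform form, with the same neighbourhood \<open>U\<close>, and it makes distances
  and diameters along orbits continuous functions of the group element.
\<close>

locale uniform_action = bounded_separable_metric M d K C
  for M :: "'a set" and d :: "'a \<Rightarrow> 'a \<Rightarrow> real" and K :: real and C :: "'a set" +
  fixes \<mu> :: "'g::{topological_group_add, t2_space} measure" and act :: "'g \<Rightarrow> 'a \<Rightarrow> 'a"
  assumes sets_mu: "sets \<mu> = sets borel"
    and act_in [simp]: "x \<in> M \<Longrightarrow> act g x \<in> M"
    and act_unif: "0 < e \<Longrightarrow> \<exists>U. open U \<and> g \<in> U \<and> (\<forall>h\<in>U. \<forall>x\<in>M. d (act h x) (act g x) \<le> e)"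
begin

lemma orbit_measurable:
  assumes "x \<in> M" shows "(\<lambda>g. act g x) \<in> measurable borel \<B>"
proof (rule measurable_mborelI)
  fix V assume V: "openin mtopology V"
  have "\<exists>U. open U \<and> g \<in> U \<and> U \<subseteq> (\<lambda>g. act g x) -` V" if g: "act g x \<in> V" for g
  proof -
    obtain r where r: "r > 0" "mball (act g x) r \<subseteq> V" using V g by (auto simp: openin_mtopology)
    obtain U where U: "open U" "g \<in> U" "\<forall>h\<in>U. \<forall>x\<in>M. d (act h x) (act g x) \<le> r / 2"
      using act_unif[of "r/2" g] r by auto
    have "U \<subseteq> (\<lambda>g. act g x) -` V"
    proof
      fix h assume "h \<in> U"
      then have "d (act g x) (act h x) \<le> r / 2" using U(3) assms commute by metis
      then have "act h x \<in> mball (act g x) r" using assms r by simp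
      then show "h \<in> (\<lambda>g. act g x) -` V" using r by auto
    qed
    with U show ?thesis by blast
  qed
  then have "open ((\<lambda>g. act g x) -` V)"
    by (simp add: open_subopen[of "(\<lambda>g. act g x) -` V"])
  then show "(\<lambda>g. act g x) -` V \<inter> space borel \<in> sets borel" by simp
qed (use assms in simp)

lemma dist_orbit_measurable:
  "x \<in> M \<Longrightarrow> y \<in> M \<Longrightarrow> (\<lambda>g. d (act g x) (act g y)) \<in> borel_measurable borel"
  by (intro borel_measurable_dist orbit_measurable)

lemma image_subset: "A \<subseteq> M \<Longrightarrow> act g ` A \<subseteq> M" by auto

lemma diam_image_perturb:
  assumes "A \<subseteq> M" "A \<noteq> {}" "\<forall>x\<in>M. d (act h x) (act g x) \<le> e"
  shows "mset_diam d (act h ` A) \<le> mset_diam d (act g ` A) + 2 * e"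
proof (rule mset_diam_least)
  fix u v assume "u \<in> act h ` A" "v \<in> act h ` A"
  then obtain x y where xy: "x \<in> A" "y \<in> A" "u = act h x" "v = act h y" by auto
  then have M: "x \<in> M" "y \<in> M" using assms by auto
  have "d u v \<le> d u (act g x) + d (act g x) v" using xy M by (auto intro: triangle)
  moreover have "d (act g x) v \<le> d (act g x) (act g y) + d (act g y) v" using xy M by (auto intro: triangle)
  moreover have "d (act g x) (act g y) \<le> mset_diam d (act g ` A)"
    using xy assms by (intro mset_diam_upper) auto
  moreover have "d u (act g x) \<le> e" "d (act g y) v \<le> e"
    using assms(3) M xy by (simp_all add: commute[of "act g y"])
  ultimately show "d u v \<le> mset_diam d (act g ` A) + 2 * e" by linarith
qed (use assms in auto)

lemma diam_orbit_measurable: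
  assumes "A \<subseteq> M" "A \<noteq> {}"
  shows "(\<lambda>g. mset_diam d (act g ` A)) \<in> borel_measurable borel"
proof (rule borel_measurable_locally_close)
  fix g and e :: real assume "0 < e"
  then obtain U where U: "open U" "g \<in> U" "\<forall>h\<in>U. \<forall>x\<in>M. d (act h x) (act g x) \<le> e / 2"
    using act_unif[of "e/2" g] by auto
  have "\<bar>mset_diam d (act h ` A) - mset_diam d (act g ` A)\<bar> \<le> e" if "h \<in> U" for h
    using diam_image_perturb[OF assms, of h g "e/2"] diam_image_perturb[OF assms, of g h "e/2"] that U(3)
    by (auto simp: commute)
  with U show "\<exists>U. open U \<and> g \<in> U \<and> (\<forall>h\<in>U. \<bar>mset_diam d (act h ` A) - mset_diam d (act g ` A)\<bar> \<le> e)"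
    by blast
qed

abbreviation unif :: "'g set \<Rightarrow> 'g measure" where "unif F \<equiv> uniform_measure \<mu> F"

definition avg_dist :: "'g set \<Rightarrow> 'a \<Rightarrow> 'a \<Rightarrow> real" where
  "avg_dist F x y = (LINT g|unif F. d (act g x) (act g y))"

definition avg_diam :: "'g set \<Rightarrow> 'a set \<Rightarrow> real" where
  "avg_diam F A = (LINT g|unif F. mset_diam d (act g ` A))"

definition emp_wasserstein :: "'g set \<Rightarrow> 'a \<Rightarrow> 'a \<Rightarrow> real" where
  "emp_wasserstein F x y = \<W> (empirical_measure \<mu> M d act F x) (empirical_measure \<mu> M d act F y)"

lemma folner_emeasure:
  assumes "folner \<mu> F"
  shows "F n \<in> sets \<mu>" "emeasure \<mu> (F n) \<noteq> 0" "emeasure \<mu> (F n) \<noteq> \<infinity>"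
proof -
  have F: "compact (F n)" "0 < measure \<mu> (F n)" using assms by (auto simp: folner_def)
  show "F n \<in> sets \<mu>" using compact_imp_closed[OF F(1)] by (simp add: sets_mu)
  show "emeasure \<mu> (F n) \<noteq> 0" "emeasure \<mu> (F n) \<noteq> \<infinity>"
    using F(2) by (auto simp: measure_def)
qed

lemma prob_space_unif: "folner \<mu> F \<Longrightarrow> prob_space (unif (F n))"
  using folner_emeasure[of F n] by (intro prob_space_uniform_measure) auto

lemma sets_unif [simp]: "sets (unif A) = sets borel" by (simp add: sets_mu)

lemma measurable_unif: "measurable (unif A) N = measurable borel N"
  by (rule measurable_cong_sets[OF sets_unif refl])

text \<open>
  A normalised integral over a Folner set is an expectation with respect to the uniform
  distribution on it; this lets group elements play the role of random variables.
\<close>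

lemma average_eq:
  assumes "folner \<mu> F" "f \<in> borel_measurable borel"
  shows "1 / measure \<mu> (F n) * (LINT g:F n|\<mu>. f g) = (LINT g|unif (F n). f g :: real)"
proof -
  note F = folner_emeasure[OF assms(1), of n]
  have pos: "0 < measure \<mu> (F n)" using assms(1) by (auto simp: folner_def)
  have em: "emeasure \<mu> (F n) = ennreal (measure \<mu> (F n))" using F by (simp add: emeasure_eq_ennreal_measure)
  have "unif (F n) = density \<mu> (\<lambda>g. ennreal (indicator (F n) g / measure \<mu> (F n)))"
    unfolding uniform_measure_def em using pos
    by (intro arg_cong[where f="density \<mu>"] ext) (auto simp: indicator_def divide_ennreal simp flip: ennreal_1)
  also have "(LINT g|\<dots>. f g) = (LINT g|\<mu>. indicator (F n) g / measure \<mu> (F n) * f g)"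
    using F(1)[unfolded sets_mu] assms(2)
    by (subst integral_density) (auto simp: measurable_cong_sets[OF sets_mu refl])
  also have "\<dots> = (LINT g|\<mu>. 1 / measure \<mu> (F n) * (indicator (F n) g * f g))"
    by (simp add: field_simps)
  also have "\<dots> = 1 / measure \<mu> (F n) * (LINT g:F n|\<mu>. f g)"
    by (simp add: set_lebesgue_integral_def)
  finally show ?thesis by simp
qed

lemma mean_dist_eq:
  assumes "x \<in> M" "y \<in> M"
  shows "mean_dist \<mu> d act x y = (SUP F\<in>{F. folner \<mu> F}. limsup (\<lambda>n. ereal (avg_dist (F n) x y)))"
  unfolding mean_dist_def mean_dist_along_def avg_dist_def
  by (intro SUP_cong arg_cong[where f=limsup] ext arg_cong[where f=ereal] average_eq
      dist_orbit_measurable assms) auto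

lemma mean_diam_eq:
  assumes "A \<subseteq> M" "A \<noteq> {}"
  shows "mean_diam \<mu> d act A = (SUP F\<in>{F. folner \<mu> F}. limsup (\<lambda>n. ereal (avg_diam (F n) A)))"
  unfolding mean_diam_def mean_diam_along_def avg_diam_def
  by (intro SUP_cong arg_cong[where f=limsup] ext arg_cong[where f=ereal] average_eq
      diam_orbit_measurable assms) auto

lemma weak_mean_dist_eq:
  "weak_mean_dist \<mu> M d act x y = (SUP F\<in>{F. folner \<mu> F}. limsup (\<lambda>n. ereal (emp_wasserstein (F n) x y)))"
  unfolding weak_mean_dist_def weak_mean_dist_along_def emp_wasserstein_def ..

lemma mean_point_iff:
  assumes "x \<in> M"
  shows "mean_equicontinuity_point \<mu> M d act x \<longleftrightarrow>
    (\<forall>e>0. \<exists>\<delta>>0. \<forall>y\<in>M. d x y \<le> \<delta> \<longrightarrow> (\<forall>F. folner \<mu> F \<longrightarrow> (\<forall>\<^sub>F n in sequentially. avg_dist (F n) x y < e)))"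
proof -
  have "mean_equicontinuity_point \<mu> M d act x \<longleftrightarrow>
    (\<forall>e>0. \<exists>\<delta>>0. \<forall>y\<in>mcball x \<delta>. (SUP F\<in>{F. folner \<mu> F}. limsup (\<lambda>n. ereal (avg_dist (F n) x y))) < ereal e)"
    unfolding mean_equicontinuity_point_def
    by (intro all_cong1 imp_cong refl ex_cong1 conj_cong ball_cong) (simp add: mean_dist_eq)
  then show ?thesis
    unfolding SUP_limsup_small_iff[where a="\<lambda>y F n. avg_dist (F n) x y"] using assms by (simp add: Ball_def imp_conjL)
qed

lemma weak_mean_point_iff:
  assumes "x \<in> M"
  shows "weak_mean_equicontinuity_point \<mu> M d act x \<longleftrightarrow>
    (\<forall>e>0. \<exists>\<delta>>0. \<forall>y\<in>M. d x y \<le> \<delta> \<longrightarrow> (\<forall>F. folner \<mu> F \<longrightarrow> (\<forall>\<^sub>F n in sequentially. emp_wasserstein (F n) x y < e)))"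
  unfolding weak_mean_equicontinuity_point_def weak_mean_dist_eq
    SUP_limsup_small_iff[where a="\<lambda>y F n. emp_wasserstein (F n) x y"] using assms by (simp add: Ball_def imp_conjL)

lemma diam_mean_point_iff:
  assumes "x \<in> M"
  shows "diam_mean_equicontinuity_point \<mu> M d act x \<longleftrightarrow>
    (\<forall>e>0. \<exists>\<delta>>0. \<forall>F. folner \<mu> F \<longrightarrow> (\<forall>\<^sub>F n in sequentially. avg_diam (F n) (mcball x \<delta>) < e))"
proof -
  have "diam_mean_equicontinuity_point \<mu> M d act x \<longleftrightarrow>
    (\<forall>e>0. \<exists>\<delta>>0. \<forall>r\<in>{\<delta>}. (SUP F\<in>{F. folner \<mu> F}. limsup (\<lambda>n. ereal (avg_diam (F n) (mcball x r)))) < ereal e)"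
    unfolding diam_mean_equicontinuity_point_def using assms
    by (intro all_cong1 imp_cong refl ex_cong1 conj_cong)
      (simp add: mean_diam_eq mcball_subset_mspace mcball_eq_empty)
  then show ?thesis
    unfolding SUP_limsup_small_iff[where a="\<lambda>r F n. avg_diam (F n) (mcball x r)"] by simp
qed

lemma integrable_dist_orbit:
  "folner \<mu> F \<Longrightarrow> x \<in> M \<Longrightarrow> y \<in> M \<Longrightarrow> integrable (unif (F n)) (\<lambda>g. d (act g x) (act g y))"
  by (intro integrable_dist prob_space_unif) (auto simp: measurable_unif intro: orbit_measurable)

lemma integrable_bounded_unif:
  fixes f :: "'g \<Rightarrow> real"
  assumes "folner \<mu> F" "f \<in> borel_measurable borel" "\<And>g. \<bar>f g\<bar> \<le> B"
  shows "integrable (unif (F n)) f"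
proof -
  interpret prob_space "unif (F n)" by (rule prob_space_unif) fact
  show ?thesis using assms by (intro integrable_const_bound[of _ B]) (auto simp: measurable_unif)
qed

lemma integrable_diam_orbit:
  assumes "folner \<mu> F" "A \<subseteq> M" "A \<noteq> {}"
  shows "integrable (unif (F n)) (\<lambda>g. mset_diam d (act g ` A))"
proof (rule integrable_bounded_unif[OF assms(1), of _ K])
  fix g show "\<bar>mset_diam d (act g ` A)\<bar> \<le> K"
    using mset_diam_nonneg[of "act g ` A"] mset_diam_le_K[of "act g ` A"] assms(2,3) image_subset[of A g] by auto
qed (intro diam_orbit_measurable assms)

lemma avg_dist_le_avg_diam:
  assumes "folner \<mu> F" "A \<subseteq> M" "x \<in> A" "y \<in> A"
  shows "avg_dist (F n) x y \<le> avg_diam (F n) A"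
  unfolding avg_dist_def avg_diam_def using assms
  by (intro integral_mono integrable_dist_orbit integrable_diam_orbit mset_diam_upper) auto

lemma avg_diam_mono:
  assumes "folner \<mu> F" "A \<noteq> {}" "A \<subseteq> B" "B \<subseteq> M"
  shows "avg_diam (F n) A \<le> avg_diam (F n) B"
  unfolding avg_diam_def
proof (intro integral_mono integrable_diam_orbit assms(1))
  fix g show "mset_diam d (act g ` A) \<le> mset_diam d (act g ` B)"
    using assms by (intro mset_diam_least mset_diam_upper[OF image_subset[OF assms(4)]]) auto
qed (use assms in auto)

lemma avg_dist_triangle:
  assumes "folner \<mu> F" "x \<in> M" "y \<in> M" "z \<in> M"
  shows "avg_dist (F n) x z \<le> avg_dist (F n) x y + avg_dist (F n) y z"
proof -
  have "avg_dist (F n) x z \<le> (LINT g|unif (F n). d (act g x) (act g y) + d (act g y) (act g z))"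
    unfolding avg_dist_def using assms
    by (intro integral_mono Bochner_Integration.integrable_add integrable_dist_orbit triangle) auto
  also have "\<dots> = avg_dist (F n) x y + avg_dist (F n) y z"
    unfolding avg_dist_def using assms
    by (intro Bochner_Integration.integral_add integrable_dist_orbit)
  finally show ?thesis .
qed

lemma avg_dist_bounds:
  assumes "folner \<mu> F" "x \<in> M" "y \<in> M" shows "0 \<le> avg_dist (F n) x y" "avg_dist (F n) x y \<le> K"
proof -
  interpret prob_space "unif (F n)" by (rule prob_space_unif[OF assms(1)])
  show "0 \<le> avg_dist (F n) x y" unfolding avg_dist_def by (simp add: nonneg)
  have "avg_dist (F n) x y \<le> (LINT g|unif (F n). K)"
    unfolding avg_dist_def using assms by (intro integral_mono integrable_dist_orbit le_K) auto
  then show "avg_dist (F n) x y \<le> K" unfolding lebesgue_integral_const prob_space by simp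
qed

lemma avg_dist_commute: "avg_dist F x y = avg_dist F y x"
  unfolding avg_dist_def by (simp add: commute)

lemma empirical_measure_eq_distr:
  assumes "folner \<mu> F" "x \<in> M"
  shows "empirical_measure \<mu> M d act (F n) x = distr (unif (F n)) \<B> (\<lambda>g. act g x)"
proof -
  interpret prob_space "unif (F n)" by (rule prob_space_unif) fact
  show ?thesis
    unfolding empirical_measure_def using not_empty orbit_measurable[OF assms(2)]
    by (intro bind_return_distr') (auto simp: measurable_unif)
qed

text \<open>
  Moving both points with the same random group element couples the two empirical measures.
\<close>

lemma emp_wasserstein_le_avg_dist:
  assumes "folner \<mu> F" "x \<in> M" "y \<in> M" shows "emp_wasserstein (F n) x y \<le> avg_dist (F n) x y"
  unfolding emp_wasserstein_def avg_dist_def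
  using assms by (auto simp: empirical_measure_eq_distr measurable_unif intro!: wasserstein_distr_le
      prob_space_unif orbit_measurable)

text \<open>
  The empirical measure of \<open>x\<close> is the law of \<open>act g x\<close> for random \<open>g\<close>, so integrating \<open>\<phi>\<close> against
  it averages \<open>\<phi>\<close> along the orbit. All consequences of weak-mean equicontinuity are drawn from this
  inequality.
\<close>

lemma lipschitz_average_le_emp_wasserstein:
  assumes F: "folner \<mu> F" and xy: "x \<in> M" "y \<in> M"
    and lip: "\<And>x y. x \<in> M \<Longrightarrow> y \<in> M \<Longrightarrow> \<bar>\<phi> x - \<phi> y\<bar> \<le> d x y"
  shows "(LINT g|unif (F n). \<phi> (act g x)) - (LINT g|unif (F n). \<phi> (act g y)) \<le> emp_wasserstein (F n) x y"
proof -
  note m = orbit_measurable[OF xy(1)] orbit_measurable[OF xy(2)]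
  have \<phi>: "\<phi> \<in> borel_measurable \<B>" by (rule borel_measurable_lipschitz[of _ 1]) (use lip in simp)
  have "(LINT x|distr (unif (F n)) \<B> (\<lambda>g. act g x). \<phi> x) - (LINT x|distr (unif (F n)) \<B> (\<lambda>g. act g y). \<phi> x)
    \<le> emp_wasserstein (F n) x y"
    unfolding emp_wasserstein_def using m F xy
    by (simp add: empirical_measure_eq_distr)
      (intro kantorovich_lower_bound lip distr_mem_prob_measures prob_space_unif; simp add: measurable_unif)
  then show ?thesis using m \<phi> by (simp add: integral_distr measurable_unif)
qed

lemma integrable_lipschitz_orbit:
  assumes F: "folner \<mu> F" and x: "x \<in> M"
    and lip: "\<And>x y. x \<in> M \<Longrightarrow> y \<in> M \<Longrightarrow> \<bar>\<phi> x - \<phi> y\<bar> \<le> d x y"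
  shows "integrable (unif (F n)) (\<lambda>g. \<phi> (act g x))"
  using lip by (intro integrable_lipschitz[of _ 1] prob_space_unif F)
    (auto simp: measurable_unif intro: orbit_measurable x)

text \<open>
  A ball that is displaced by at most \<open>R g\<close> around the translate of its centre has
  diameter at most \<open>2 * R g\<close>. Averages of the displacement bound therefore control averages of
  diameters.
\<close>

lemma diam_mean_pointI:
  assumes x: "x \<in> M"
    and R: "\<And>e. 0 < e \<Longrightarrow> \<exists>\<delta> R. 0 < \<delta> \<and> (\<forall>g. \<forall>y\<in>M. d x y \<le> \<delta> \<longrightarrow> d (act g x) (act g y) \<le> R g) \<and>
      (\<forall>F. folner \<mu> F \<longrightarrow> (\<forall>n. integrable (unif (F n)) R) \<and> (\<forall>\<^sub>F n in sequentially. (LINT g|unif (F n). R g) < e))"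
  shows "diam_mean_equicontinuity_point \<mu> M d act x"
  unfolding diam_mean_point_iff[OF x]
proof (intro allI impI)
  fix e :: real assume "0 < e"
  then have "0 < e / 2" by simp
  from R[OF this] obtain \<delta> R where \<delta>: "0 < \<delta>"
    and le: "\<And>g y. y \<in> M \<Longrightarrow> d x y \<le> \<delta> \<Longrightarrow> d (act g x) (act g y) \<le> R g"
    and int: "\<And>F n. folner \<mu> F \<Longrightarrow> integrable (unif (F n)) R"
    and small: "\<And>F. folner \<mu> F \<Longrightarrow> \<forall>\<^sub>F n in sequentially. (LINT g|unif (F n). R g) < e / 2"
    by blast
  have ne: "mcball x \<delta> \<noteq> {}" using x \<delta> by (auto simp: mcball_eq_empty)
  have diam: "mset_diam d (act g ` mcball x \<delta>) \<le> 2 * R g" for g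
  proof (rule mset_diam_le_radius[where z="act g x"])
    fix u assume "u \<in> act g ` mcball x \<delta>"
    then show "d (act g x) u \<le> R g" using le by auto
  qed (use x ne in \<open>auto simp: mcball_subset_mspace\<close>)
  show "\<exists>\<delta>>0. \<forall>F. folner \<mu> F \<longrightarrow> (\<forall>\<^sub>F n in sequentially. avg_diam (F n) (mcball x \<delta>) < e)"
  proof (intro exI[of _ \<delta>] conjI allI impI \<delta>)
    fix F assume F: "folner \<mu> F"
    have le2: "avg_diam (F n) (mcball x \<delta>) \<le> 2 * (LINT g|unif (F n). R g)" for n
    proof -
      have "avg_diam (F n) (mcball x \<delta>) \<le> (LINT g|unif (F n). 2 * R g)"
        unfolding avg_diam_def
        by (intro integral_mono integrable_diam_orbit F mcball_subset_mspace ne diam integrable_mult_right int)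
      then show ?thesis by simp
    qed
    have "\<forall>\<^sub>F n in sequentially. 2 * (LINT g|unif (F n). R g) < e"
      using small[OF F] by (rule eventually_mono) simp
    then show "\<forall>\<^sub>F n in sequentially. avg_diam (F n) (mcball x \<delta>) < e"
      by (rule eventually_le_less) (rule le2)
  qed
qed

lemma emp_wasserstein_commute:
  assumes "folner \<mu> F" "x \<in> M" "y \<in> M" shows "emp_wasserstein (F n) x y = emp_wasserstein (F n) y x"
proof -
  have "empirical_measure \<mu> M d act (F n) z \<in> \<P>" if "z \<in> M" for z
    unfolding empirical_measure_eq_distr[OF assms(1) that]
    by (intro distr_mem_prob_measures prob_space_unif assms(1)) (simp add: measurable_unif orbit_measurable that)
  then show ?thesis unfolding emp_wasserstein_def using assms wasserstein_commute_le by (intro antisym) auto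
qed

lemma mean_imp_weakly_mean_equicontinuous:
  assumes "mean_equicontinuous \<mu> M d act" shows "weakly_mean_equicontinuous \<mu> M d act"
  unfolding weakly_mean_equicontinuous_def
proof
  fix x assume x: "x \<in> M"
  have *: "mean_equicontinuity_point \<mu> M d act x" using assms x by (simp add: mean_equicontinuous_def)
  show "weak_mean_equicontinuity_point \<mu> M d act x"
    unfolding weak_mean_point_iff[OF x]
  proof safe
    fix e :: real assume "0 < e"
    then obtain \<delta> where \<delta>: "\<delta> > 0"
      "\<And>y F. y \<in> M \<Longrightarrow> d x y \<le> \<delta> \<Longrightarrow> folner \<mu> F \<Longrightarrow> \<forall>\<^sub>F n in sequentially. avg_dist (F n) x y < e"
      using * unfolding mean_point_iff[OF x] by meson
    show "\<exists>\<delta>>0. \<forall>y\<in>M. d x y \<le> \<delta> \<longrightarrow> (\<forall>F. folner \<mu> F \<longrightarrow> (\<forall>\<^sub>F n in sequentially. emp_wasserstein (F n) x y < e))"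
    proof (intro exI[of _ \<delta>] conjI ballI impI allI)
      fix y F assume y: "y \<in> M" "d x y \<le> \<delta>" and F: "folner \<mu> F"
      show "\<forall>\<^sub>F n in sequentially. emp_wasserstein (F n) x y < e"
        by (rule eventually_mono[OF \<delta>(2)[OF y F]]) (rule le_less_trans[OF emp_wasserstein_le_avg_dist[OF F x y(1)]])
    qed fact
  qed
qed

lemma diam_mean_imp_mean_equicontinuous:
  assumes "diam_mean_equicontinuous \<mu> M d act" shows "mean_equicontinuous \<mu> M d act"
  unfolding mean_equicontinuous_def
proof
  fix x assume x: "x \<in> M"
  have *: "diam_mean_equicontinuity_point \<mu> M d act x" using assms x by (simp add: diam_mean_equicontinuous_def)
  show "mean_equicontinuity_point \<mu> M d act x"
    unfolding mean_point_iff[OF x]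
  proof safe
    fix e :: real assume "0 < e"
    then obtain \<delta> where \<delta>: "\<delta> > 0" "\<And>F. folner \<mu> F \<Longrightarrow> \<forall>\<^sub>F n in sequentially. avg_diam (F n) (mcball x \<delta>) < e"
      using * unfolding diam_mean_point_iff[OF x] by meson
    show "\<exists>\<delta>>0. \<forall>y\<in>M. d x y \<le> \<delta> \<longrightarrow> (\<forall>F. folner \<mu> F \<longrightarrow> (\<forall>\<^sub>F n in sequentially. avg_dist (F n) x y < e))"
    proof (intro exI[of _ \<delta>] conjI ballI impI allI)
      fix y F assume y: "y \<in> M" "d x y \<le> \<delta>" and F: "folner \<mu> F"
      have "avg_dist (F n) x y \<le> avg_diam (F n) (mcball x \<delta>)" for n
        using y x \<delta>(1) by (intro avg_dist_le_avg_diam F) auto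
      then show "\<forall>\<^sub>F n in sequentially. avg_dist (F n) x y < e"
        using \<delta>(2)[OF F] by (auto elim!: eventually_mono intro: le_less_trans)
    qed fact
  qed
qed

lemma almost_diam_mean_iff:
  "almost_diam_mean_equicontinuous \<mu> M d act \<longleftrightarrow>
    (\<forall>x\<in>M. \<forall>r>0. \<exists>y\<in>M. diam_mean_equicontinuity_point \<mu> M d act y \<and> d x y < r)"
  unfolding almost_diam_mean_equicontinuous_def metric_closure_of by auto

end

section \<open>The Wasserstein space of a compact metric space\<close>

text \<open>
  The two factors are glued so that they are independent given the common value of \<open>u\<close> and \<open>v\<close>. Since
  this value ranges over a finite set, the conditional law is elementary: relative to the product
  measure, the glued measure has density \<open>1 / m z\<close> on the rectangle where both values are \<open>z\<close>,
  with \<open>m z\<close> the probability of the value \<open>z\<close>. This takes the place of a disintegration.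
\<close>

lemma finite_gluing:
  fixes A :: "'a measure" and B :: "'b measure" and u :: "'a \<Rightarrow> 'c" and v :: "'b \<Rightarrow> 'c"
  assumes "prob_space A" "prob_space B" and Z: "finite Z"
    and u: "u \<in> measurable A (count_space Z)" and v: "v \<in> measurable B (count_space Z)"
    and eq: "distr A (count_space Z) u = distr B (count_space Z) v"
  obtains J where "prob_space J" "sets J = sets (A \<Otimes>\<^sub>M B)"
    "distr J A fst = A" "distr J B snd = B" "AE w in J. u (fst w) = v (snd w)"
proof -
  interpret A: prob_space A by fact
  interpret B: prob_space B by fact
  interpret AB: pair_prob_space A B ..
  define Au where "Au z = u -` {z} \<inter> space A" for z
  define Bv where "Bv z = v -` {z} \<inter> space B" for z
  have sA: "Au z \<in> sets A" and sB: "Bv z \<in> sets B" if "z \<in> Z" for z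
    using that u v by (auto simp: Au_def Bv_def intro!: measurable_sets)
  define m where "m z = emeasure A (Au z)" for z
  have mB: "emeasure B (Bv z) = m z" if "z \<in> Z" for z
  proof -
    have "emeasure (distr A (count_space Z) u) {z} = emeasure (distr B (count_space Z) v) {z}"
      by (simp add: eq)
    then show ?thesis using that u v by (simp add: emeasure_distr m_def Au_def Bv_def)
  qed
  \<comment> \<open>Cells of mass zero have infinite density, which is harmless since \<open>a\<close> vanishes there.\<close>
  have cancel: "1 / m z * (m z * a) = a" if "a \<le> m z" for z a
  proof (cases "m z = 0")
    case False
    have "m z \<noteq> \<infinity>" by (simp add: m_def)
    then show ?thesis using False
      by (metis (no_types, lifting) ennreal_mult_divide_eq mult.commute mult_1 times_divide_eq_right infinity_ennreal_def ennreal_times_divide)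
  qed (use that in auto)
  define f where "f w = (\<Sum>z\<in>Z. 1 / m z * indicator (Au z \<times> Bv z) w)" for w
  have rect [measurable]: "Au z \<times> Bv z \<in> sets (A \<Otimes>\<^sub>M B)" if "z \<in> Z" for z
    using sA[OF that] sB[OF that] by auto
  have f_meas: "f \<in> borel_measurable (A \<Otimes>\<^sub>M B)"
    unfolding f_def by measurable
  define J where "J = density (A \<Otimes>\<^sub>M B) f"
  have J_rect: "emeasure J (E \<times> E') = (\<Sum>z\<in>Z. 1 / m z * (emeasure A (E \<inter> Au z) * emeasure B (E' \<inter> Bv z)))"
    if E: "E \<in> sets A" "E' \<in> sets B" for E E'
  proof -
    have "emeasure J (E \<times> E') = (\<integral>\<^sup>+w. f w * indicator (E \<times> E') w \<partial>(A \<Otimes>\<^sub>M B))"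
      unfolding J_def using f_meas E by (intro emeasure_density) auto
    also have "\<dots> = (\<integral>\<^sup>+w. (\<Sum>z\<in>Z. 1 / m z * indicator ((E \<inter> Au z) \<times> (E' \<inter> Bv z)) w) \<partial>(A \<Otimes>\<^sub>M B))"
      unfolding f_def sum_distrib_right
      by (intro nn_integral_cong sum.cong) (auto simp: indicator_def)
    also have "\<dots> = (\<Sum>z\<in>Z. 1 / m z * emeasure (A \<Otimes>\<^sub>M B) ((E \<inter> Au z) \<times> (E' \<inter> Bv z)))"
      using E sA sB by (subst nn_integral_sum) (auto simp: nn_integral_cmult intro!: sum.cong)
    also have "\<dots> = (\<Sum>z\<in>Z. 1 / m z * (emeasure A (E \<inter> Au z) * emeasure B (E' \<inter> Bv z)))"
      using E sA sB by (intro sum.cong refl) (subst B.emeasure_pair_measure_Times, auto)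
    finally show ?thesis .
  qed
  have sJ: "sets J = sets (A \<Otimes>\<^sub>M B)" by (simp add: J_def)
  have fstm: "fst \<in> measurable J A" and sndm: "snd \<in> measurable J B"
    by (simp_all add: measurable_cong_sets[OF sJ refl])
  have spJ: "space J = space A \<times> space B" by (simp add: J_def space_pair_measure)
  have partA: "(\<Sum>z\<in>Z. emeasure A (E \<inter> Au z)) = emeasure A E" if E: "E \<in> sets A" for E
  proof -
    have "(\<Sum>z\<in>Z. emeasure A (E \<inter> Au z)) = emeasure A (\<Union>z\<in>Z. E \<inter> Au z)"
      using E sA Z by (intro sum_emeasure) (auto simp: disjoint_family_on_def Au_def)
    also have "(\<Union>z\<in>Z. E \<inter> Au z) = E"
      using sets.sets_into_space[OF E] measurable_space[OF u] by (auto simp: Au_def)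
    finally show ?thesis .
  qed
  have partB: "(\<Sum>z\<in>Z. emeasure B (E \<inter> Bv z)) = emeasure B E" if E: "E \<in> sets B" for E
  proof -
    have "(\<Sum>z\<in>Z. emeasure B (E \<inter> Bv z)) = emeasure B (\<Union>z\<in>Z. E \<inter> Bv z)"
      using E sB Z by (intro sum_emeasure) (auto simp: disjoint_family_on_def Bv_def)
    also have "(\<Union>z\<in>Z. E \<inter> Bv z) = E"
      using sets.sets_into_space[OF E] measurable_space[OF v] by (auto simp: Bv_def)
    finally show ?thesis .
  qed
  have dA: "distr J A fst = A"
  proof (rule measure_eqI)
    fix E assume "E \<in> sets (distr J A fst)"
    then have E: "E \<in> sets A" by simp
    have "emeasure (distr J A fst) E = emeasure J (E \<times> space B)"
      using E fstm sets.sets_into_space[OF E] by (auto simp: emeasure_distr spJ intro!: arg_cong[where f="emeasure J"])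
    also have "\<dots> = (\<Sum>z\<in>Z. 1 / m z * (m z * emeasure A (E \<inter> Au z)))"
      using sB by (subst J_rect[OF E]) (auto intro!: sum.cong simp: mB mult.commute Int_absorb1 sets.sets_into_space)
    also have "\<dots> = (\<Sum>z\<in>Z. emeasure A (E \<inter> Au z))"
      using sA by (intro sum.cong refl cancel) (auto simp: m_def intro!: emeasure_mono)
    finally show "emeasure (distr J A fst) E = emeasure A E" by (simp add: partA E)
  qed simp
  have dB: "distr J B snd = B"
  proof (rule measure_eqI)
    fix E assume "E \<in> sets (distr J B snd)"
    then have E: "E \<in> sets B" by simp
    have "emeasure (distr J B snd) E = emeasure J (space A \<times> E)"
      using E sndm sets.sets_into_space[OF E] by (auto simp: emeasure_distr spJ intro!: arg_cong[where f="emeasure J"])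
    also have "\<dots> = (\<Sum>z\<in>Z. 1 / m z * (m z * emeasure B (E \<inter> Bv z)))"
      using sA by (subst J_rect[OF _ E]) (auto intro!: sum.cong simp: m_def Int_absorb1 sets.sets_into_space)
    also have "\<dots> = (\<Sum>z\<in>Z. emeasure B (E \<inter> Bv z))"
      using sB by (intro sum.cong refl cancel) (auto simp: mB[symmetric] intro!: emeasure_mono)
    finally show "emeasure (distr J B snd) E = emeasure B E" by (simp add: partB E)
  qed simp
  have "emeasure J (space J) = emeasure (distr J A fst) (space A)"
    using fstm by (auto simp: emeasure_distr spJ intro!: arg_cong[where f="emeasure J"])
  then have pJ: "prob_space J" by (intro prob_spaceI) (simp add: dA A.emeasure_space_1)
  have "AE w in J. u (fst w) = v (snd w)"
    unfolding J_def AE_density[OF f_meas]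
  proof (rule AE_I2, rule impI)
    fix w assume "0 < f w"
    then have "\<exists>z\<in>Z. indicator (Au z \<times> Bv z) w \<noteq> (0::ennreal)"
      unfolding f_def by (metis (no_types, lifting) mult_zero_right not_less_zero sum.neutral)
    then show "u (fst w) = v (snd w)" by (auto simp: indicator_def Au_def Bv_def split: if_splits)
  qed
  then show ?thesis using that pJ sJ dA dB by blast
qed

locale compact_metric_space = bounded_separable_metric M d K C
  for M :: "'a set" and d :: "'a \<Rightarrow> 'a \<Rightarrow> real" and K :: real and C :: "'a set" +
  assumes compact: "compact_space mtopology" and nonempty: "M \<noteq> {}"
begin

text \<open>
  A point is sent to the first member of a finite net that is close to it; taking the first one
  makes the choice measurable. The net can be drawn from any dense set \<open>D\<close>, which
  serves to approximate measures by ones that live on diam-mean equicontinuity points.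
\<close>

lemma finite_net_map:
  assumes D: "D \<subseteq> M" "\<And>x r. x \<in> M \<Longrightarrow> 0 < r \<Longrightarrow> \<exists>y\<in>D. d x y < r" and e: "0 < e"
  obtains Z p where "finite Z" "Z \<subseteq> D" "p \<in> measurable \<B> (count_space Z)" "\<And>x. x \<in> M \<Longrightarrow> d x (p x) < e"
proof -
  have "M \<subseteq> \<Union> ((\<lambda>z. mball z e) ` D)"
    using D e by (auto simp: commute subset_iff)
  then obtain \<F> where "finite \<F>" "\<F> \<subseteq> (\<lambda>z. mball z e) ` D" "M \<subseteq> \<Union>\<F>"
    using compact unfolding compact_space_alt by (metis (no_types, lifting) imageE openin_mball topspace_mtopology)
  then obtain Z where Z: "Z \<subseteq> D" "finite Z" "M \<subseteq> (\<Union>z\<in>Z. mball z e)"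
    by (metis finite_subset_image)
  obtain zs where zs: "set zs = Z" using finite_list Z by blast
  define q where "q x = (LEAST i. i < length zs \<and> d x (zs ! i) < e)" for x
  have q: "q x < length zs \<and> d x (zs ! q x) < e" if "x \<in> M" for x
  proof -
    have "\<exists>z\<in>set zs. d x z < e" using Z(3) that zs by (auto simp: commute[of x] subset_iff)
    then obtain z where "z \<in> set zs" "d x z < e" by blast
    then obtain i where "i < length zs \<and> d x (zs ! i) < e" by (auto simp: in_set_conv_nth)
    then show ?thesis unfolding q_def by (rule LeastI)
  qed
  have [measurable]: "q \<in> measurable \<B> (count_space UNIV)"
    unfolding q_def
  proof (rule measurable_Least)
    fix i
    show "(\<lambda>x. i < length zs \<and> d x (zs ! i) < e) \<in> measurable \<B> (count_space UNIV)"
    proof (cases "i < length zs")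
      case True
      then have "zs ! i \<in> M" using zs Z(1) D(1) nth_mem by blast
      note [measurable] = borel_measurable_dist_point[OF this]
      show ?thesis by measurable
    qed simp
  qed
  have m: "(\<lambda>x. zs ! q x) \<in> measurable \<B> (count_space UNIV)" by measurable
  have "(\<lambda>x. zs ! q x) \<in> measurable \<B> (count_space Z)"
    unfolding measurable_count_space_eq2[OF Z(2)]
  proof (intro conjI ballI funcsetI)
    fix x assume "x \<in> space \<B>"
    then show "zs ! q x \<in> Z" using q[of x] zs nth_mem by fastforce
  next
    fix z show "(\<lambda>x. zs ! q x) -` {z} \<inter> space \<B> \<in> sets \<B>"
      by (rule measurable_sets[OF m]) simp
  qed
  from that[OF Z(2,1) this] show ?thesis using q by blast
qed

lemma self_dense: "x \<in> M \<Longrightarrow> 0 < r \<Longrightarrow> \<exists>y\<in>M. d x y < r"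
  using mdist_zero by metis

lemma net_map_sequence:
  obtains Z :: "nat \<Rightarrow> 'a set" and p where "\<And>n. finite (Z n)" "\<And>n. Z n \<subseteq> M"
    "\<And>n. p n \<in> measurable \<B> (count_space (Z n))" "\<And>n x. x \<in> M \<Longrightarrow> d x (p n x) < 1 / real (Suc n)"
proof -
  have "\<exists>Z p. finite Z \<and> Z \<subseteq> M \<and> p \<in> measurable \<B> (count_space Z) \<and> (\<forall>x\<in>M. d x (p x) < 1 / real (Suc n))" for n
  proof -
    have pos: "0 < 1 / real (Suc n)" by simp
    obtain Z p where "finite Z" "Z \<subseteq> M" "p \<in> measurable \<B> (count_space Z)"
      "\<And>x. x \<in> M \<Longrightarrow> d x (p x) < 1 / real (Suc n)"
      using finite_net_map[OF subset_refl self_dense pos] by metis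
    then show ?thesis by blast
  qed
  then show ?thesis using that by metis
qed

lemma net_map_measurable:
  assumes "p \<in> measurable \<B> (count_space Z)" "Z \<subseteq> M" shows "p \<in> measurable \<B> \<B>"
  by (rule measurable_compose[OF assms(1), of "\<lambda>x. x"]) (use assms(2) in \<open>auto simp: measurable_count_space_eq1\<close>)

lemma wasserstein_le_K: "\<W> \<nu>1 \<nu>2 \<le> K"
proof (cases "\<nu>1 \<in> \<P> \<and> \<nu>2 \<in> \<P>")
  case True
  then obtain \<kappa> where \<kappa>: "\<kappa> \<in> couplings M d \<nu>1 \<nu>2" using couplings_nonempty by blast
  note c = couplingD[OF \<kappa>]
  interpret prob_space \<kappa> by fact
  have "\<W> \<nu>1 \<nu>2 \<le> (LINT p|\<kappa>. d (fst p) (snd p))"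
    using True \<kappa> by (intro wasserstein_le_cost) auto
  also have "\<dots> \<le> (LINT p|\<kappa>. K)"
    using measurable_space[OF c(2)] measurable_space[OF c(3)]
    by (intro integral_mono integrable_dist c) (auto intro!: le_K)
  finally show ?thesis by (simp add: prob_space)
qed (use K_pos in \<open>auto simp: wasserstein_def\<close>)

text \<open>
  Two nearly optimal couplings are glued along the middle measure, after its points have been
  rounded to a finite net of mesh \<open>e\<close>. In the glued measure the two middle points are not equal but
  have the same rounding, which costs at most \<open>2 * e\<close>.
\<close>

lemma wasserstein_triangle:
  assumes \<nu>: "\<nu>1 \<in> \<P>" "\<nu>2 \<in> \<P>" "\<nu>3 \<in> \<P>"
  shows "\<W> \<nu>1 \<nu>3 \<le> \<W> \<nu>1 \<nu>2 + \<W> \<nu>2 \<nu>3"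
proof (rule field_le_epsilon)
  fix e' :: real assume "0 < e'"
  define e where "e = e' / 4"
  have e: "0 < e" using \<open>0 < e'\<close> by (simp add: e_def)
  obtain \<kappa> where \<kappa>: "\<kappa> \<in> couplings M d \<nu>1 \<nu>2"
    "(LINT p|\<kappa>. d (fst p) (snd p)) < \<W> \<nu>1 \<nu>2 + e"
    using obtain_coupling[OF \<nu>(1,2) e] by blast
  obtain \<kappa>' where \<kappa>': "\<kappa>' \<in> couplings M d \<nu>2 \<nu>3"
    "(LINT p|\<kappa>'. d (fst p) (snd p)) < \<W> \<nu>2 \<nu>3 + e"
    using obtain_coupling[OF \<nu>(2,3) e] by blast
  note c = couplingD[OF \<kappa>(1)] and c' = couplingD[OF \<kappa>'(1)]
  obtain Z p where Z: "finite Z" "Z \<subseteq> M" and p: "p \<in> measurable \<B> (count_space Z)"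
    and close: "\<And>x. x \<in> M \<Longrightarrow> d x (p x) < e"
    using finite_net_map[OF subset_refl self_dense e] by metis
  have pM: "p x \<in> M" if "x \<in> M" for x using measurable_space[OF p] that Z by auto
  have "distr \<kappa> (count_space Z) (\<lambda>w. p (snd w)) = distr \<nu>2 (count_space Z) p"
    using distr_distr[OF p c(3)] c(5) by (simp add: comp_def)
  also have "\<dots> = distr \<kappa>' (count_space Z) (\<lambda>w. p (fst w))"
    using distr_distr[OF p c'(2)] c'(4) by (simp add: comp_def)
  finally obtain J where J: "prob_space J" "sets J = sets (\<kappa> \<Otimes>\<^sub>M \<kappa>')"
    "distr J \<kappa> fst = \<kappa>" "distr J \<kappa>' snd = \<kappa>'" "AE w in J. p (snd (fst w)) = p (fst (snd w))"
    by (rule finite_gluing[OF c(1) c'(1) Z(1) measurable_compose[OF c(3) p] measurable_compose[OF c'(2) p]])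
  have m: "fst \<in> measurable J \<kappa>" "snd \<in> measurable J \<kappa>'"
    by (simp_all add: measurable_cong_sets[OF J(2) refl])
  note m' = measurable_compose[OF m(1) c(2)] measurable_compose[OF m(1) c(3)]
    measurable_compose[OF m(2) c'(2)] measurable_compose[OF m(2) c'(3)]
  have "distr J \<B> (\<lambda>w. fst (fst w)) = distr (distr J \<kappa> fst) \<B> fst"
    using distr_distr[OF c(2) m(1)] by (simp add: comp_def)
  then have 1: "distr J \<B> (\<lambda>w. fst (fst w)) = \<nu>1" using J c by simp
  have "distr J \<B> (\<lambda>w. snd (snd w)) = distr (distr J \<kappa>' snd) \<B> snd"
    using distr_distr[OF c'(3) m(2)] by (simp add: comp_def)
  then have 3: "distr J \<B> (\<lambda>w. snd (snd w)) = \<nu>3" using J c' by simp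
  interpret J: prob_space J by fact
  have "\<W> \<nu>1 \<nu>3 \<le> (LINT w|J. d (fst (fst w)) (snd (snd w)))"
    using wasserstein_distr_le[OF J(1) m'(1,4)] by (simp only: 1 3)
  also have "\<dots> \<le> (LINT w|J. (d (fst (fst w)) (snd (fst w)) + 2 * e) + d (fst (snd w)) (snd (snd w)))"
  proof (rule integral_mono_AE)
    have "AE w in J. w \<in> space J" by (rule AE_space)
    with J(5) show "AE w in J. d (fst (fst w)) (snd (snd w))
      \<le> (d (fst (fst w)) (snd (fst w)) + 2 * e) + d (fst (snd w)) (snd (snd w))"
    proof eventually_elim
      case (elim w)
      obtain x y y' z where w: "w = ((x, y), (y', z))" by (metis prod.collapse)
      have M: "x \<in> M" "y \<in> M" "y' \<in> M" "z \<in> M"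
        using m'[THEN measurable_space, OF elim(2)] by (auto simp: w)
      have "d x z \<le> d x y + d y z" "d y z \<le> d y (p y) + d (p y) z"
        "d (p y) z \<le> d (p y) y' + d y' z"
        using M pM by (auto intro: triangle)
      moreover have "d y (p y) < e" "d (p y) y' < e"
        using close[of y] close[of y'] elim(1) M by (auto simp: w commute)
      ultimately show ?case by (simp add: w)
    qed
  qed (auto intro!: integrable_dist J m')
  also have "\<dots> = (LINT w|J. d (fst (fst w)) (snd (fst w))) + 2 * e + (LINT w|J. d (fst (snd w)) (snd (snd w)))"
    using integrable_dist[OF J(1) m'(1,2)] integrable_dist[OF J(1) m'(3,4)] by (simp add: J.prob_space)
  also have "(LINT w|J. d (fst (fst w)) (snd (fst w))) = (LINT p|\<kappa>. d (fst p) (snd p))"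
    using integral_distr[OF m(1) borel_measurable_dist[OF c(2,3)]] by (simp only: J(3))
  also have "(LINT w|J. d (fst (snd w)) (snd (snd w))) = (LINT p|\<kappa>'. d (fst p) (snd p))"
    using integral_distr[OF m(2) borel_measurable_dist[OF c'(2,3)]] by (simp only: J(4))
  finally show "\<W> \<nu>1 \<nu>3 \<le> \<W> \<nu>1 \<nu>2 + \<W> \<nu>2 \<nu>3 + e'"
    using \<kappa>(2) \<kappa>'(2) e_def by linarith
qed

lemma wasserstein_self: "\<nu> \<in> \<P> \<Longrightarrow> \<W> \<nu> \<nu> = 0"
proof -
  assume \<nu>: "\<nu> \<in> \<P>"
  then have s: "sets \<nu> = sets \<B>" and p: "prob_space \<nu>" by (auto simp: mem_prob_measures)
  have m: "(\<lambda>x. x) \<in> measurable \<nu> \<B>" by (simp add: measurable_cong_sets[OF s refl])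
  have "distr \<nu> \<B> (\<lambda>x. x) = \<nu>" by (rule distr_id2) (simp add: s)
  then have "\<W> \<nu> \<nu> \<le> (LINT x|\<nu>. d x x)"
    using wasserstein_distr_le[OF p m m] by simp
  also have "\<dots> = (LINT x|\<nu>. 0)"
    by (rule Bochner_Integration.integral_cong) (use space_prob_measures[OF \<nu>] in auto)
  finally show ?thesis using wasserstein_nonneg[of \<nu> \<nu>] by simp
qed

text \<open>
  The functions \<open>min 1 (n * dist (x, M - U))\<close> are Lipschitz and converge to the indicator of \<open>U\<close>. By
  the Kantorovich bound their integrals with respect to both measures agree.
\<close>

lemma wasserstein_zero_measure_open:
  assumes \<nu>: "\<nu>1 \<in> \<P>" "\<nu>2 \<in> \<P>"
    and W: "\<W> \<nu>1 \<nu>2 = 0" and U: "openin mtopology U"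
  shows "measure \<nu>1 U = measure \<nu>2 U"
proof (cases "M - U = {}")
  case True
  then have "U = M" using openin_subset[OF U] by auto
  then show ?thesis using \<nu>
    by (metis mem_prob_measures space_prob_measures prob_space.prob_space)
next
  case False
  define f where "f n x = min 1 (real n * infd x (M - U))" for n x
  have lip: "\<bar>f n x - f n y\<bar> \<le> real n * d x y" if "x \<in> M" "y \<in> M" for n x y
  proof -
    have "\<bar>f n x - f n y\<bar> \<le> \<bar>real n * infd x (M - U) - real n * infd y (M - U)\<bar>" by (auto simp: f_def)
    also have "\<dots> = real n * \<bar>infd x (M - U) - infd y (M - U)\<bar>" by (simp add: abs_mult flip: right_diff_distrib)
    also have "\<dots> \<le> real n * d x y" using infd_lipschitz[of "M - U" x y] False that by (intro mult_left_mono) auto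
    finally show ?thesis .
  qed
  have fm: "f n \<in> borel_measurable \<B>" for n by (rule borel_measurable_lipschitz[OF lip])
  have lim: "(\<lambda>n. f n x) \<longlonglongrightarrow> indicator U x" if x: "x \<in> M" for x
  proof (cases "x \<in> U")
    case True
    then obtain r where r: "r > 0" "mball x r \<subseteq> U" using U by (auto simp: openin_mtopology)
    have "r \<le> infd x (M - U)"
      using r x by (intro infd_greatest False) (force simp: not_less[symmetric])
    obtain n0 where n0: "1 / r < real n0" using reals_Archimedean2 by blast
    have "f n x = 1" if "n0 \<le> n" for n
    proof -
      have "1 / r < real n" using that n0 by (metis of_nat_le_iff less_le_trans)
      then have "1 < real n * r" using r by (simp add: field_simps)
      also have "\<dots> \<le> real n * infd x (M - U)" using \<open>r \<le> _\<close> by (intro mult_left_mono) auto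
      finally show ?thesis by (simp add: f_def)
    qed
    then have "\<forall>\<^sub>F n in sequentially. f n x = indicator U x"
      using True by (auto simp: eventually_sequentially)
    then show ?thesis by (rule tendsto_eventually)
  next
    case False
    then have "x \<in> M - U" using x by simp
    then have "infd x (M - U) \<le> d x x" "0 \<le> infd x (M - U)" by (blast intro: infd_le infd_nonneg)+
    then show ?thesis using False x by (simp add: f_def)
  qed
  have eq: "(LINT x|\<nu>1. f n x) = (LINT x|\<nu>2. f n x)" for n
  proof -
    define c where "c = 1 / (real n + 1)"
    have c: "0 < c" "c * (real n + 1) = 1" by (simp_all add: c_def)
    have l: "\<bar>c * f n x - c * f n y\<bar> \<le> d x y" if "x \<in> M" "y \<in> M" for x y
    proof -
      have "\<bar>f n x - f n y\<bar> \<le> (real n + 1) * d x y"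
        using lip[OF that, of n] nonneg[of x y] unfolding distrib_right by linarith
      then have "c * \<bar>f n x - f n y\<bar> \<le> c * ((real n + 1) * d x y)"
        using c(1) by (intro mult_left_mono) auto
      also have "\<dots> = d x y" using c(2) by (simp flip: mult.assoc)
      finally show ?thesis using c(1) by (simp add: abs_mult flip: right_diff_distrib)
    qed
    have l': "\<bar>- (c * f n x) - - (c * f n y)\<bar> \<le> d x y" if "x \<in> M" "y \<in> M" for x y
      using l[OF that] by (simp add: abs_minus_commute)
    have "c * (LINT x|\<nu>1. f n x) = c * (LINT x|\<nu>2. f n x)"
      using kantorovich_lower_bound[OF l \<nu>] kantorovich_lower_bound[OF l' \<nu>] W by auto
    then show ?thesis using c(1) by simp
  qed
  have conv: "(\<lambda>n. LINT x|\<nu>. f n x) \<longlonglongrightarrow> measure \<nu> U" if \<nu>: "\<nu> \<in> \<P>" for \<nu>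
  proof -
    have s: "sets \<nu> = sets \<B>" and sp: "space \<nu> = M" and "prob_space \<nu>"
      using \<nu> by (auto simp: mem_prob_measures space_prob_measures)
    interpret prob_space \<nu> by fact
    have UU: "U \<in> sets \<nu>" using U s sets_mborel_openin by simp
    have "(\<lambda>n. LINT x|\<nu>. f n x) \<longlonglongrightarrow> (LINT x|\<nu>. indicator U x)"
    proof (rule integral_dominated_convergence[where w="\<lambda>_. 1"])
      show "AE x in \<nu>. (\<lambda>n. f n x) \<longlonglongrightarrow> indicat_real U x" using lim sp by (auto intro!: AE_I2)
      show "AE x in \<nu>. norm (f n x) \<le> 1" for n
        using infd_nonneg[OF False] by (auto intro!: AE_I2 simp: f_def)
    qed (use fm sets_mborel_openin[OF U] in \<open>auto simp: measurable_cong_sets[OF s refl]\<close>)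
    also have "(LINT x|\<nu>. indicator U x) = measure \<nu> U" using UU by simp
    finally show ?thesis .
  qed
  show ?thesis
    using conv[OF \<nu>(1)] conv[OF \<nu>(2)] unfolding eq by (rule LIMSEQ_unique)
qed

lemma wasserstein_zero_imp_eq:
  assumes \<nu>: "\<nu>1 \<in> \<P>" "\<nu>2 \<in> \<P>"
    and W: "\<W> \<nu>1 \<nu>2 = 0"
  shows "\<nu>1 = \<nu>2"
proof (rule measure_eqI_generator_eq[where E="{U. openin mtopology U}" and \<Omega>=M and A="\<lambda>_. M"])
  interpret A: prob_space \<nu>1 using \<nu> by (simp add: mem_prob_measures)
  interpret B: prob_space \<nu>2 using \<nu> by (simp add: mem_prob_measures)
  show "Int_stable {U. openin mtopology U}" by (auto simp: Int_stable_def)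
  show "{U. openin mtopology U} \<subseteq> Pow M" by (rule openin_sets_Pow)
  have s: "sets \<B> = sigma_sets M {U. openin mtopology U}"
    unfolding mborel_def by (rule sets_measure_of[OF openin_sets_Pow])
  then show "sets \<nu>1 = sigma_sets M {U. openin mtopology U}" "sets \<nu>2 = sigma_sets M {U. openin mtopology U}"
    using \<nu> by (simp_all add: mem_prob_measures)
  show "emeasure \<nu>1 U = emeasure \<nu>2 U" if "U \<in> {U. openin mtopology U}" for U
    using wasserstein_zero_measure_open[OF \<nu> W] that by (simp add: A.emeasure_eq_measure B.emeasure_eq_measure)
qed (use \<nu> in \<open>auto simp: mem_prob_measures prob_space_def finite_measure.emeasure_finite\<close>)

lemma Metric_space_wasserstein: "Metric_space \<P> \<W>"
proof
  show "\<W> \<nu>1 \<nu>2 = \<W> \<nu>2 \<nu>1" for \<nu>1 \<nu>2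
  proof (cases "\<nu>1 \<in> \<P> \<and> \<nu>2 \<in> \<P>")
    case True
    then show ?thesis using wasserstein_commute_le by (intro antisym) auto
  next
    case False
    then show ?thesis by (auto simp: wasserstein_def)
  qed
qed (auto intro: wasserstein_nonneg wasserstein_triangle simp: wasserstein_self dest: wasserstein_zero_imp_eq)

text \<open>
  The measure is moved to a finite net, then the mass of each net point is rounded down to a
  multiple of \<open>1 / N\<close> and the surplus is collected at one net point \<open>z0\<close>. The rounding is realised
  with an independent uniform variable \<open>t\<close> in \<open>[0, 1]\<close>: a point stays at its net point \<open>z\<close> if
  \<open>t \<le> r z\<close>, where \<open>r z\<close> is the fraction of the mass to be kept, and jumps to \<open>z0\<close> otherwise.
\<close>

lemma rational_weights_approx:
  assumes \<nu>: "\<nu> \<in> \<P>" and e: "0 < e" and Z: "finite Z" "Z \<subseteq> M"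
    and p: "p \<in> measurable \<B> (count_space Z)" and close: "\<And>x. x \<in> M \<Longrightarrow> d x (p x) < e / 2"
  obtains \<nu>' where "\<nu>' \<in> \<P>" "measure \<nu>' Z = 1" "\<And>z. z \<in> Z \<Longrightarrow> measure \<nu>' {z} \<in> \<rat>"
    "\<W> \<nu> \<nu>' < e"
proof -
  have s: "sets \<nu> = sets \<B>" and sp: "space \<nu> = M" and "prob_space \<nu>"
    using \<nu> by (auto simp: mem_prob_measures space_prob_measures)
  interpret N: prob_space \<nu> by fact
  define U where "U = uniform_measure lborel {0..1::real}"
  interpret U: prob_space U unfolding U_def by (rule prob_space_uniform_measure) auto
  interpret \<Omega>: pair_prob_space \<nu> U ..
  let ?\<Omega> = "\<nu> \<Otimes>\<^sub>M U"
  have sU [measurable_cong]: "sets U = sets borel" and spU: "space U = UNIV" by (simp_all add: U_def)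
  have pZ: "p x \<in> Z" if "x \<in> M" for x using measurable_space[OF p] that by auto
  have pM: "p x \<in> M" if "x \<in> M" for x using pZ[OF that] Z by auto
  obtain z0 where z0: "z0 \<in> Z" using nonempty pZ by blast
  obtain N where N: "2 * K * card Z / e < real N" using reals_Archimedean2 by blast
  have "0 \<le> 2 * K * card Z / e" using K_pos e by simp
  then have Npos: "0 < real N" using N by linarith
  have Nbound: "K * (card Z * (1 / N)) < e / 2" using N Npos e by (simp add: field_simps)
  define P where "P z = p -` {z} \<inter> M" for z
  have P_sets: "P z \<in> sets \<nu>" if "z \<in> Z" for z
    using measurable_sets[OF p, of "{z}"] that by (simp add: P_def s)
  define r where "r z = (if measure \<nu> (P z) = 0 then 1 else \<lfloor>N * measure \<nu> (P z)\<rfloor> / (N * measure \<nu> (P z)))" for z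
  have r01: "0 \<le> r z" "r z \<le> 1" for z
  proof -
    have "0 \<le> r z \<and> r z \<le> 1"
    proof (cases "measure \<nu> (P z) = 0")
      case False
      then have "0 < N * measure \<nu> (P z)" using Npos by (simp add: zero_less_measure_iff)
      then show ?thesis using False by (simp add: r_def)
    qed (simp add: r_def)
    then show "0 \<le> r z" "r z \<le> 1" by auto
  qed
  have mr: "measure \<nu> (P z) * r z = \<lfloor>N * measure \<nu> (P z)\<rfloor> / N" for z
    using Npos by (auto simp: r_def)
  have mr': "measure \<nu> (P z) * (1 - r z) \<le> 1 / N" for z
  proof -
    have "N * measure \<nu> (P z) - \<lfloor>N * measure \<nu> (P z)\<rfloor> \<le> 1" by linarith
    then have "(N * measure \<nu> (P z) - \<lfloor>N * measure \<nu> (P z)\<rfloor>) / N \<le> 1 / N" using Npos by (intro divide_right_mono) auto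
    then show ?thesis using Npos by (simp add: right_diff_distrib mr diff_divide_distrib)
  qed
  have U_le: "measure U {..r z} = r z" for z
  proof -
    have "{0..1} \<inter> {..r z} = {0..r z}" using r01[of z] by auto
    then show ?thesis using r01[of z] by (simp add: U_def measure_def divide_ennreal_def)
  qed
  have U_gt: "measure U {r z<..} = 1 - r z" for z
  proof -
    have "measure U (space U - {..r z}) = 1 - measure U {..r z}" by (rule U.prob_compl) (simp add: sU)
    also have "space U - {..r z} = {r z<..}" by (auto simp: spU)
    finally show ?thesis by (simp add: U_le)
  qed
  have rect: "measure ?\<Omega> (P z \<times> S) = measure \<nu> (P z) * measure U S" if "z \<in> Z" "S \<in> sets borel" for z S
    using P_sets[OF that(1)] that(2) by (simp add: measure_def U.emeasure_pair_measure_Times sU enn2real_mult)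
  define h where "h w = (if snd w \<le> r (p (fst w)) then p (fst w) else z0)" for w
  have pm: "p \<in> measurable \<B> \<B>" by (rule net_map_measurable[OF p Z(2)])
  have fm: "fst \<in> measurable ?\<Omega> \<B>" by (rule measurable_fst''[where f="\<lambda>x. x"] | simp add: measurable_cong_sets[OF refl s[symmetric]])+
  have rm: "(\<lambda>w. r (p (fst w))) \<in> borel_measurable ?\<Omega>"
    by (rule measurable_compose[OF measurable_compose[OF fm p]]) simp
  have sm: "snd \<in> borel_measurable ?\<Omega>"
    using measurable_snd[of \<nu> U] by (simp add: measurable_cong_sets[OF refl sU])
  have pred: "Measurable.pred ?\<Omega> (\<lambda>w. snd w \<le> r (p (fst w)))" using rm sm by measurable
  have hm: "h \<in> measurable ?\<Omega> \<B>"
    unfolding h_def using z0 Z(2) by (intro measurable_If measurable_compose[OF fm pm] pred[unfolded pred_def]) auto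
  have hZ: "h w \<in> Z" if "w \<in> space ?\<Omega>" for w
    using that pZ z0 by (auto simp: h_def space_pair_measure sp)
  define \<nu>' where "\<nu>' = distr ?\<Omega> \<B> h"
  have ZB: "Z \<in> sets \<B>" using Z by (rule sets_mborel_finite)
  have \<nu>': "\<nu>' \<in> \<P>" unfolding \<nu>'_def by (intro distr_mem_prob_measures hm \<Omega>.prob_space_axioms)
  interpret N': prob_space \<nu>' using \<nu>' by (simp add: mem_prob_measures)
  have "measure \<nu>' Z = measure ?\<Omega> (h -` Z \<inter> space ?\<Omega>)" unfolding \<nu>'_def by (rule measure_distr[OF hm ZB])
  also have "h -` Z \<inter> space ?\<Omega> = space ?\<Omega>" using hZ by auto
  finally have Z1: "measure \<nu>' Z = 1" by (simp add: \<Omega>.prob_space)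
  have rat: "measure \<nu>' {z} \<in> \<rat>" if "z \<in> Z" "z \<noteq> z0" for z
  proof -
    have "measure \<nu>' {z} = measure ?\<Omega> (h -` {z} \<inter> space ?\<Omega>)" unfolding \<nu>'_def
      using that Z by (intro measure_distr[OF hm] sets_mborel_singleton) auto
    also have "h -` {z} \<inter> space ?\<Omega> = P z \<times> {..r z}"
      using that by (auto simp: h_def P_def space_pair_measure sp spU split: if_splits)
    also have "measure ?\<Omega> \<dots> = \<lfloor>N * measure \<nu> (P z)\<rfloor> / N" using that by (simp add: rect U_le mr)
    finally show ?thesis by simp
  qed
  have "measure \<nu>' Z = (\<Sum>z\<in>Z. measure \<nu>' {z})"
    using Z by (intro N'.finite_measure_eq_sum_singleton) (auto simp: \<nu>'_def sets_mborel_singleton)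
  then have "measure \<nu>' {z0} = 1 - (\<Sum>z\<in>Z - {z0}. measure \<nu>' {z})"
    using Z1 z0 Z(1) by (simp add: sum.remove)
  also have "\<dots> \<in> \<rat>" using rat by (intro Rats_diff Rats_sum) auto
  finally have rat': "measure \<nu>' {z} \<in> \<rat>" if "z \<in> Z" for z using rat that by (cases "z = z0") auto
  define Bad where "Bad = (\<Union>z\<in>Z. P z \<times> {r z<..})"
  have Bad_sets: "P z \<times> {r z<..} \<in> sets ?\<Omega>" if "z \<in> Z" for z using P_sets[OF that] by (simp add: sU)
  have Bad_m: "Bad \<in> sets ?\<Omega>" unfolding Bad_def using Bad_sets Z by auto
  have "measure ?\<Omega> Bad \<le> (\<Sum>z\<in>Z. measure ?\<Omega> (P z \<times> {r z<..}))"
    unfolding Bad_def using Z Bad_sets by (intro measure_UNION_le) auto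
  also have "\<dots> \<le> (\<Sum>z\<in>Z. 1 / N)" by (intro sum_mono) (simp add: rect U_gt mr')
  finally have Bad_le: "measure ?\<Omega> Bad \<le> card Z * (1 / N)" by simp
  have "distr ?\<Omega> \<B> fst = distr ?\<Omega> \<nu> fst" by (rule distr_cong) (simp_all add: s)
  also have "\<dots> = \<nu>" by (rule U.distr_pair_fst)
  finally have "\<W> \<nu> \<nu>' \<le> (LINT w|?\<Omega>. d (fst w) (h w))"
    unfolding \<nu>'_def using wasserstein_distr_le[OF \<Omega>.prob_space_axioms fm hm] by simp
  also have "\<dots> \<le> (LINT w|?\<Omega>. e / 2 + K * indicator Bad w)"
  proof (rule integral_mono)
    show "integrable ?\<Omega> (\<lambda>w. d (fst w) (h w))" by (intro integrable_dist \<Omega>.prob_space_axioms fm hm)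
    show "integrable ?\<Omega> (\<lambda>w. e / 2 + K * indicator Bad w)" using Bad_m
      by (intro Bochner_Integration.integrable_add integrable_mult_right) (auto simp: \<Omega>.emeasure_eq_measure)
    fix w assume w: "w \<in> space ?\<Omega>"
    then have w1: "fst w \<in> M" by (auto simp: space_pair_measure sp)
    show "d (fst w) (h w) \<le> e / 2 + K * indicator Bad w"
    proof (cases "snd w \<le> r (p (fst w))")
      case True
      then have "d (fst w) (h w) < e / 2" using close[OF w1] by (simp add: h_def)
      moreover have "0 \<le> K * indicator Bad w" using K_pos by simp
      ultimately show ?thesis by linarith
    next
      case False
      then have "w \<in> Bad" using w1 pZ[OF w1] by (cases w) (auto simp: Bad_def P_def)
      moreover have "d (fst w) (h w) \<le> K" using w1 hZ[OF w] Z by (intro le_K) auto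
      ultimately show ?thesis using e by simp
    qed
  qed
  also have "\<dots> = e / 2 + K * measure ?\<Omega> Bad"
    using Bad_m by (subst Bochner_Integration.integral_add) (auto simp: \<Omega>.prob_space \<Omega>.emeasure_eq_measure)
  also have "\<dots> \<le> e / 2 + K * (card Z * (1 / N))" using Bad_le K_pos by (intro add_left_mono mult_left_mono) auto
  also have "\<dots> < e" using Nbound by linarith
  finally show ?thesis using that \<nu>' Z1 rat' by blast
qed

text \<open>
  Such a measure is determined by its finitely many rational masses.
\<close>

lemma countable_rational_measures:
  assumes "finite Z" "Z \<subseteq> M"
  shows "countable {\<nu> \<in> \<P>. measure \<nu> Z = 1 \<and> (\<forall>z\<in>Z. measure \<nu> {z} \<in> \<rat>)}" (is "countable ?S")
proof -
  let ?w = "\<lambda>\<nu>. \<lambda>z\<in>Z. measure \<nu> {z}"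
  have "inj_on ?w ?S"
  proof (rule inj_onI)
    fix \<nu> \<nu>' assume \<nu>: "\<nu> \<in> ?S" "\<nu>' \<in> ?S" and eq: "?w \<nu> = ?w \<nu>'"
    have eq': "measure \<nu> {z} = measure \<nu>' {z}" if "z \<in> Z" for z
      using fun_cong[OF eq, of z] that by simp
    have *: "measure \<nu> A = (\<Sum>z\<in>A \<inter> Z. measure \<nu> {z})" if \<nu>: "\<nu> \<in> ?S" and A: "A \<in> sets \<B>" for \<nu> A
    proof -
      have s: "sets \<nu> = sets \<B>" and sp: "space \<nu> = M" and "prob_space \<nu>"
        using \<nu> by (auto simp: mem_prob_measures space_prob_measures)
      interpret prob_space \<nu> by fact
      have Zs: "Z \<in> sets \<nu>" using assms s sets_mborel_finite by simp
      have "AE x in \<nu>. x \<in> Z" using \<nu> Zs by (subst AE_in_set_eq_1) auto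
      then have "measure \<nu> A = measure \<nu> (A \<inter> Z)"
        using A s Zs by (intro measure_eq_AE) auto
      also have "\<dots> = (\<Sum>z\<in>A \<inter> Z. measure \<nu> {z})"
        using assms by (intro finite_measure_eq_sum_singleton) (auto simp: s intro!: sets_mborel_singleton)
      finally show ?thesis .
    qed
    show "\<nu> = \<nu>'"
    proof (rule measure_eqI)
      show "sets \<nu> = sets \<nu>'" using \<nu> by (auto simp: mem_prob_measures)
      fix A assume "A \<in> sets \<nu>"
      then have A: "A \<in> sets \<B>" using \<nu> by (auto simp: mem_prob_measures)
      have "measure \<nu> A = measure \<nu>' A" using *[OF \<nu>(1) A] *[OF \<nu>(2) A] eq' by simp
      moreover have "finite_measure \<nu>" "finite_measure \<nu>'"
        using \<nu> by (auto simp: mem_prob_measures prob_space_def)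
      ultimately show "emeasure \<nu> A = emeasure \<nu>' A" by (simp add: finite_measure.emeasure_eq_measure)
    qed
  qed
  moreover have "countable (?w ` ?S)"
    by (rule countable_subset[OF _ countable_PiE[OF assms(1), of "\<lambda>_. \<rat>"]]) (auto simp: countable_rat)
  ultimately show ?thesis by (simp add: countable_image_inj_eq)
qed

lemma separable_wasserstein:
  obtains D where "countable D" "D \<subseteq> \<P>"
    "\<And>\<nu> e. \<nu> \<in> \<P> \<Longrightarrow> 0 < e \<Longrightarrow> \<exists>c\<in>D. \<W> \<nu> c < e"
proof -
  obtain Z p where Z: "\<And>n. finite (Z n)" "\<And>n. Z n \<subseteq> M"
    and p: "\<And>n. p n \<in> measurable \<B> (count_space (Z n))" "\<And>n x. x \<in> M \<Longrightarrow> d x (p n x) < 1 / real (Suc n)"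
    using net_map_sequence by metis
  define D where "D = (\<Union>n. {\<nu> \<in> \<P>. measure \<nu> (Z n) = 1 \<and> (\<forall>z\<in>Z n. measure \<nu> {z} \<in> \<rat>)})"
  show ?thesis
  proof (rule that)
    show "countable D" unfolding D_def using countable_rational_measures[OF Z] by blast
    show "D \<subseteq> \<P>" by (auto simp: D_def)
    fix \<nu> and e :: real assume \<nu>: "\<nu> \<in> \<P>" and e: "0 < e"
    obtain n where n: "1 / real (Suc n) < e / 2" using e nat_approx_posE[of "e/2"] by auto
    then have "d x (p n x) < e / 2" if "x \<in> M" for x using p(2)[OF that, of n] by simp
    then obtain \<nu>' where "\<nu>' \<in> \<P>" "measure \<nu>' (Z n) = 1" "\<And>z. z \<in> Z n \<Longrightarrow> measure \<nu>' {z} \<in> \<rat>"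
      "\<W> \<nu> \<nu>' < e"
      using rational_weights_approx[OF \<nu> e Z p(1)] by blast
    then show "\<exists>c\<in>D. \<W> \<nu> c < e" by (auto simp: D_def)
  qed
qed

end

section \<open>The hyperspace of a compact metric space\<close>

context compact_metric_space
begin

lemma hyperspaceD:
  assumes "A \<in> \<H>" shows "closedin mtopology A" "A \<subseteq> M" "A \<noteq> {}"
  using assms closedin_subset by (fastforce simp: hyperspace_def)+

lemma finite_mem_hyperspace: "finite A \<Longrightarrow> A \<subseteq> M \<Longrightarrow> A \<noteq> {} \<Longrightarrow> A \<in> \<H>"
  unfolding hyperspace_def
  by (simp add: finite_imp_compactin compactin_imp_closedin Hausdorff_space_mtopology)

lemma hausdorff_eq:
  assumes "A \<in> \<H>" "B \<in> \<H>"
  shows "dH A B = max (SUP a\<in>A. infd a B) (SUP b\<in>B. infd b A)"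
  using assms by (simp add: hausdorff_metric_def infd_def commute)

lemma hausdorff_commute: "dH A B = dH B A"
  by (auto simp: hausdorff_metric_def commute max.commute)

lemma infd_le_hausdorff:
  assumes "A \<in> \<H>" "B \<in> \<H>" "a \<in> A"
  shows "infd a B \<le> dH A B"
proof -
  note A = hyperspaceD[OF assms(1)] and B = hyperspaceD[OF assms(2)]
  have "infd a B \<le> (SUP a\<in>A. infd a B)"
    using A B assms(3) by (intro cSUP_upper bdd_aboveI[of _ K]) (auto intro!: infd_le_K)
  then show ?thesis by (simp add: hausdorff_eq assms)
qed

lemma infd_le_hausdorff':
  assumes "A \<in> \<H>" "B \<in> \<H>" "b \<in> B"
  shows "infd b A \<le> dH A B"
  using infd_le_hausdorff[OF assms(2,1,3)] by (simp add: hausdorff_commute)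

lemma hausdorff_le:
  assumes "A \<in> \<H>" "B \<in> \<H>"
    "\<And>a. a \<in> A \<Longrightarrow> infd a B \<le> r" "\<And>b. b \<in> B \<Longrightarrow> infd b A \<le> r"
  shows "dH A B \<le> r"
  using hyperspaceD(3)[OF assms(1)] hyperspaceD(3)[OF assms(2)] assms(3,4)
  by (auto simp: hausdorff_eq assms(1,2) intro!: cSUP_least)

lemma infd_hausdorff_triangle:
  assumes "A \<in> \<H>" "B \<in> \<H>" "x \<in> M"
  shows "infd x B \<le> infd x A + dH A B"
proof -
  note A = hyperspaceD[OF assms(1)] and B = hyperspaceD[OF assms(2)]
  have "infd x B - dH A B \<le> infd x A"
  proof (rule infd_greatest[OF A(3)])
    fix a assume a: "a \<in> A"
    then have "infd x B \<le> d x a + infd a B" using A B assms(3) by (intro infd_triangle) auto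
    with infd_le_hausdorff[OF assms(1,2) a] show "infd x B - dH A B \<le> d x a" by linarith
  qed
  then show ?thesis by simp
qed

text \<open>
  The distance to a fixed point is thereby a Lipschitz function on the hyperspace, to which
  averages along orbits of sets can be applied.
\<close>

lemma infd_hausdorff_lipschitz:
  assumes "A \<in> \<H>" "B \<in> \<H>" "x \<in> M"
  shows "\<bar>infd x A - infd x B\<bar> \<le> dH A B"
  using infd_hausdorff_triangle[OF assms] infd_hausdorff_triangle[OF assms(2,1,3)]
  by (simp add: hausdorff_commute)

lemma hausdorff_nonneg: "0 \<le> dH A B"
proof (cases "A \<in> \<H> \<and> B \<in> \<H>")
  case True
  then obtain a where "a \<in> A" using hyperspaceD(3)[of A] by auto
  then have "infd a B \<le> dH A B" "0 \<le> infd a B"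
    using infd_le_hausdorff[of A B a] infd_nonneg[of B a] hyperspaceD(3)[of B] True by auto
  then show ?thesis by linarith
qed (auto simp: hausdorff_metric_def)

lemma hausdorff_le_K: "dH A B \<le> K"
proof (cases "A \<in> \<H> \<and> B \<in> \<H>")
  case True
  then show ?thesis using hyperspaceD[of A] hyperspaceD[of B]
    by (intro hausdorff_le) (auto intro!: infd_le_K)
qed (use K_pos in \<open>auto simp: hausdorff_metric_def\<close>)

lemma Metric_space_hausdorff: "Metric_space \<H> dH"
proof
  fix A B assume AB: "A \<in> \<H>" "B \<in> \<H>"
  note A = hyperspaceD[OF AB(1)] and B = hyperspaceD[OF AB(2)]
  show "dH A B = 0 \<longleftrightarrow> A = B"
  proof
    assume 0: "dH A B = 0"
    show "A = B"
    proof (intro equalityI subsetI)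
      fix x assume "x \<in> A"
      then show "x \<in> B"
        using infd_eq_0_imp_mem[OF B(1,3) _ infd_le_hausdorff[OF AB, unfolded 0]] A(2) by blast
    next
      fix x assume "x \<in> B"
      then show "x \<in> A"
        using infd_eq_0_imp_mem[OF A(1,3) _ infd_le_hausdorff'[OF AB, unfolded 0]] B(2) by blast
    qed
  next
    assume "A = B"
    then have "dH A B \<le> 0" using AB A by (intro hausdorff_le) (auto intro!: infd_mem)
    then show "dH A B = 0" using hausdorff_nonneg[of A B] by simp
  qed
  fix C' assume C': "C' \<in> \<H>"
  show "dH A C' \<le> dH A B + dH B C'"
  proof (rule hausdorff_le[OF AB(1) C'])
    fix a assume a: "a \<in> A"
    then have "a \<in> M" using A by auto
    with infd_hausdorff_triangle[OF AB(2) C' this] infd_le_hausdorff[OF AB a]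
    show "infd a C' \<le> dH A B + dH B C'" by linarith
  next
    fix c assume c: "c \<in> C'"
    then have "c \<in> M" using hyperspaceD[OF C'] by auto
    with infd_hausdorff_triangle[OF AB(2,1) this] infd_le_hausdorff'[OF AB(2) C' c]
    show "infd c A \<le> dH A B + dH B C'" by (simp add: hausdorff_commute)
  qed
qed (auto intro: hausdorff_nonneg hausdorff_commute)

lemma finite_subset_approx:
  assumes D: "D \<subseteq> M" "\<And>x r. x \<in> M \<Longrightarrow> 0 < r \<Longrightarrow> \<exists>y\<in>D. d x y < r" and e: "0 < e"
    and A: "A \<in> \<H>"
  obtains S where "finite S" "S \<subseteq> D" "S \<in> \<H>" "dH A S < e"
proof -
  note A' = hyperspaceD[OF A]
  obtain Z p where Z: "finite Z" "Z \<subseteq> D" and p: "p \<in> measurable \<B> (count_space Z)"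
    and close: "\<And>x. x \<in> M \<Longrightarrow> d x (p x) < e / 2"
    using finite_net_map[OF D, of "e/2"] e by auto
  have S: "p ` A \<subseteq> Z" using measurable_space[OF p] A' by auto
  have fin: "finite (p ` A)" using S Z finite_subset by blast
  have H: "p ` A \<in> \<H>" using S Z D A' fin by (intro finite_mem_hyperspace) auto
  have "dH A (p ` A) \<le> e / 2"
  proof (rule hausdorff_le[OF A H])
    fix a assume "a \<in> A"
    then show "infd a (p ` A) \<le> e / 2"
      using close[of a] A' infd_le[of "p a" "p ` A" a] by fastforce
  next
    fix b assume "b \<in> p ` A"
    then obtain a where "a \<in> A" "b = p a" by auto
    then show "infd b A \<le> e / 2" using close[of a] A' infd_le[of a A b] commute[of a "p a"] by fastforce
  qed
  then show ?thesis using that[OF fin _ H] S Z e by auto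
qed

lemma separable_hausdorff:
  obtains D where "countable D" "D \<subseteq> \<H>"
    "\<And>A e. A \<in> \<H> \<Longrightarrow> 0 < e \<Longrightarrow> \<exists>S\<in>D. dH A S < e"
proof (rule that)
  let ?D = "{S. finite S \<and> S \<subseteq> C} \<inter> \<H>"
  show "countable ?D" using countable_Collect_finite_subset[OF countable_C] by (rule countable_Int1)
  show "?D \<subseteq> \<H>" by auto
  fix A and e :: real assume A: "A \<in> \<H>" and e: "0 < e"
  show "\<exists>S\<in>?D. dH A S < e"
    using finite_subset_approx[OF C_subset C_dense e A] by blast
qed

lemma singleton_mem_hyperspace: "x \<in> M \<Longrightarrow> {x} \<in> \<H>"
  by (intro finite_mem_hyperspace) auto

lemma mcball_mem_hyperspace: "x \<in> M \<Longrightarrow> 0 < \<delta> \<Longrightarrow> mcball x \<delta> \<in> \<H>"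
  by (auto simp: hyperspace_def mcball_eq_empty)

lemma infd_le_halfD:
  assumes "A \<in> \<H>" "infd x A \<le> \<eta> / 2" "0 < \<eta>"
  obtains a where "a \<in> A" "d x a \<le> \<eta>" "a \<in> M"
proof -
  have "infd x A < \<eta>" using assms by simp
  then show ?thesis using infd_lessD hyperspaceD(2,3)[OF assms(1)] that by (metis less_imp_le subsetD)
qed

text \<open>
  For nested sets the differences \<open>infd z A - infd z B\<close> are all nonnegative, so that their sum, and
  not just the sum of their absolute values, bounds the distance. The average of such a difference
  is a difference of averages and is visible to the empirical measures of \<open>A\<close> and \<open>B\<close>; the average
  of an absolute value would not be.
\<close>

lemma hausdorff_nested_le:
  assumes A: "A \<in> \<H>" and B: "B \<in> \<H>" and AB: "A \<subseteq> B"
    and Z: "finite Z" "Z \<subseteq> M" "\<And>x. x \<in> M \<Longrightarrow> \<exists>z\<in>Z. d x z \<le> e"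
  shows "dH A B \<le> 2 * e + (\<Sum>z\<in>Z. infd z A - infd z B)"
proof (rule hausdorff_le[OF A B])
  note A' = hyperspaceD[OF A] and B' = hyperspaceD[OF B]
  have term_nonneg: "0 \<le> infd z A - infd z B" for z using infd_antimono[OF A'(3) AB] by simp
  then have sum: "0 \<le> (\<Sum>z\<in>Z. infd z A - infd z B)" by (intro sum_nonneg)
  { fix b assume b: "b \<in> B"
    then have bM: "b \<in> M" using B' by auto
    obtain z where z: "z \<in> Z" "d b z \<le> e" using Z(3)[OF bM] by blast
    have "infd b A \<le> d b z + infd z A" using z Z(2) bM A' by (intro infd_triangle) auto
    moreover have "infd z B \<le> d z b" using b by (rule infd_le)
    moreover have "infd z A - infd z B \<le> (\<Sum>z\<in>Z. infd z A - infd z B)"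
      using z(1) Z(1) term_nonneg by (intro member_le_sum) auto
    ultimately show "infd b A \<le> 2 * e + (\<Sum>z\<in>Z. infd z A - infd z B)" using z(2) commute[of z b] by linarith }
  fix a assume a: "a \<in> A"
  then have aM: "a \<in> M" using A' by auto
  have "infd a B \<le> d a a" using a AB by (intro infd_le) auto
  moreover have "0 \<le> e" using Z(3)[OF aM] nonneg order_trans by blast
  ultimately show "infd a B \<le> 2 * e + (\<Sum>z\<in>Z. infd z A - infd z B)" using sum aM by simp
qed

lemma closed_neighbourhood_mem_hyperspace:
  assumes A: "A \<in> \<H>" and \<delta>: "0 < \<delta>"
  shows "{x \<in> M. infd x A \<le> \<delta>} \<in> \<H>"
proof -
  note A' = hyperspaceD[OF A]
  have "closedin mtopology {x \<in> M. infd x A \<le> \<delta>}"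
    unfolding closedin_metric
  proof (intro conjI allI impI)
    fix x assume "x \<in> M - {x \<in> M. infd x A \<le> \<delta>}"
    then have x: "x \<in> M" "\<delta> < infd x A" by auto
    have "disjnt {x \<in> M. infd x A \<le> \<delta>} (mball x (infd x A - \<delta>))"
      unfolding disjnt_iff
    proof (intro allI notI)
      fix y assume "y \<in> {x \<in> M. infd x A \<le> \<delta>} \<and> y \<in> mball x (infd x A - \<delta>)"
      then have y: "y \<in> M" "infd y A \<le> \<delta>" "d x y < infd x A - \<delta>" by auto
      with infd_triangle[OF A'(3,2) x(1) y(1)] show False by linarith
    qed
    with x(2) show "\<exists>r>0. disjnt {x \<in> M. infd x A \<le> \<delta>} (mball x r)" by (intro exI[of _ "infd x A - \<delta>"]) auto
  qed auto
  moreover have "A \<subseteq> {x \<in> M. infd x A \<le> \<delta>}"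
    using A' \<delta> infd_mem by force
  ultimately show ?thesis using A' by (auto simp: hyperspace_def)
qed

text \<open>
  Each value of a net map on \<open>A\<close> is replaced with a point of \<open>A\<close> that is sent to it, so that the net
  lies inside \<open>A\<close>: only sets nested with \<open>A\<close> can be compared with it through averages.
\<close>

lemma finite_inner_net:
  assumes A: "A \<in> \<H>" and \<delta>: "0 < \<delta>"
  obtains S where "finite S" "S \<subseteq> A" "S \<in> \<H>" "dH A S \<le> \<delta>"
proof -
  note A' = hyperspaceD[OF A]
  have \<delta>2: "0 < \<delta> / 2" using \<delta> by simp
  obtain Z p where Z: "finite Z" and p: "p \<in> measurable \<B> (count_space Z)"
    and close: "\<And>x. x \<in> M \<Longrightarrow> d x (p x) < \<delta> / 2" and ZM: "Z \<subseteq> M"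
    using finite_net_map[OF subset_refl self_dense \<delta>2] by metis
  have pM: "p x \<in> Z" if "x \<in> M" for x using measurable_space[OF p] that by auto
  define S where "S = inv_into A p ` p ` A"
  have "finite (p ` A)" using pM A'(2) by (intro finite_subset[OF _ Z]) auto
  then have S: "finite S" "S \<subseteq> A" "S \<noteq> {}"
    using A'(3) by (auto simp: S_def intro!: inv_into_into)
  have SH: "S \<in> \<H>" using S A' by (intro finite_mem_hyperspace) auto
  have "dH A S \<le> \<delta>"
  proof (rule hausdorff_le[OF A SH])
    fix a assume a: "a \<in> A"
    define s where "s = inv_into A p (p a)"
    have s: "s \<in> A" "p s = p a" "s \<in> S" using a by (auto simp: s_def S_def inv_into_into f_inv_into_f)
    have M: "a \<in> M" "s \<in> M" "p a \<in> M" using a s A' pM ZM by auto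
    have "infd a S \<le> d a s" using s(3) by (rule infd_le)
    also have "\<dots> \<le> d a (p a) + d (p a) s" using M by (intro triangle)
    also have "\<dots> \<le> \<delta>" using close[OF M(1)] close[OF M(2)] s(2) commute[of "p a" s] by simp
    finally show "infd a S \<le> \<delta>" .
  next
    fix s assume "s \<in> S"
    then have "s \<in> A" using S by auto
    then show "infd s A \<le> \<delta>" using infd_mem[of s A] A' \<delta> by force
  qed
  with that S SH show ?thesis by blast
qed

end

section \<open>Compact metric spaces from the topological hypotheses\<close>

text \<open>
  The tube lemma: every \<open>(g, x)\<close> has a product neighbourhood on which the action varies by less than
  \<open>e / 2\<close>. Finitely many of them cover \<open>{g} \<times> M\<close>, and their first factors are intersected.
\<close>

lemma (in Metric_space) uniformly_close_near:
  fixes act :: "'g::topological_space \<Rightarrow> 'a \<Rightarrow> 'a"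
  assumes compact: "compact_space mtopology"
    and cont: "continuous_map (prod_topology euclidean mtopology) mtopology (\<lambda>(g, x). act g x)"
    and e: "0 < e"
  shows "\<exists>U. open U \<and> g \<in> U \<and> (\<forall>h\<in>U. \<forall>x\<in>M. d (act h x) (act g x) \<le> e)"
proof -
  have in_M: "act h x \<in> M" if "x \<in> M" for h x
    using continuous_map_funspace[OF cont] that by (auto simp: Pi_iff)
  have "\<forall>x\<in>M. \<exists>UV. open (fst UV) \<and> g \<in> fst UV \<and> openin mtopology (snd UV) \<and> x \<in> snd UV \<and>
    (\<forall>h\<in>fst UV. \<forall>y\<in>snd UV. d (act h y) (act g x) < e / 2)"
  proof
    fix x assume x: "x \<in> M"
    let ?W = "{w \<in> topspace (prod_topology euclidean mtopology). (case w of (h, y) \<Rightarrow> act h y) \<in> mball (act g x) (e / 2)}"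
    have "openin (prod_topology euclidean mtopology) ?W"
      by (rule openin_continuous_map_preimage[OF cont openin_mball])
    moreover have "(g, x) \<in> ?W" using x e in_M by auto
    ultimately obtain U V where "openin euclidean U"
      and UV: "openin mtopology V" "g \<in> U" "x \<in> V" "U \<times> V \<subseteq> ?W"
      unfolding openin_prod_topology_alt by meson
    then have U: "open U" by simp
    have "d (act h y) (act g x) < e / 2" if "h \<in> U" "y \<in> V" for h y
    proof -
      have "(h, y) \<in> ?W" using UV(4) that by blast
      then show ?thesis by (simp add: commute)
    qed
    with U UV show "\<exists>UV. open (fst UV) \<and> g \<in> fst UV \<and> openin mtopology (snd UV) \<and> x \<in> snd UV \<and>
      (\<forall>h\<in>fst UV. \<forall>y\<in>snd UV. d (act h y) (act g x) < e / 2)"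
      by (intro exI[of _ "(U, V)"]) simp
  qed
  from bchoice[OF this] obtain f where f: "\<forall>x\<in>M. open (fst (f x)) \<and> g \<in> fst (f x) \<and>
    openin mtopology (snd (f x)) \<and> x \<in> snd (f x) \<and>
    (\<forall>h\<in>fst (f x). \<forall>y\<in>snd (f x). d (act h y) (act g x) < e / 2)" by blast
  define U V where "U x = fst (f x)" and "V x = snd (f x)" for x
  have UV: "open (U x)" "g \<in> U x" "openin mtopology (V x)" "x \<in> V x"
    "\<And>h y. h \<in> U x \<Longrightarrow> y \<in> V x \<Longrightarrow> d (act h y) (act g x) < e / 2" if "x \<in> M" for x
    using f that by (auto simp: U_def V_def)
  have "(\<forall>W\<in>V ` M. openin mtopology W) \<and> topspace mtopology \<subseteq> \<Union> (V ` M)" using UV(3,4) by auto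
  then obtain \<F> where "finite \<F>" "\<F> \<subseteq> V ` M" "M \<subseteq> \<Union>\<F>"
    using compact unfolding compact_space_alt by (metis topspace_mtopology)
  then obtain S where S: "S \<subseteq> M" "finite S" "M \<subseteq> (\<Union>x\<in>S. V x)" by (metis finite_subset_image)
  have "d (act h y) (act g y) \<le> e" if h: "h \<in> (\<Inter>x\<in>S. U x)" and y: "y \<in> M" for h y
  proof -
    obtain x where x: "x \<in> S" "y \<in> V x" using S(3) y by auto
    then have xM: "x \<in> M" using S by auto
    have "d (act h y) (act g x) < e / 2" "d (act g y) (act g x) < e / 2"
      using UV(5)[OF xM _ x(2)] UV(2)[OF xM] h x(1) by auto
    moreover have "d (act h y) (act g y) \<le> d (act h y) (act g x) + d (act g y) (act g x)"
      using xM y in_M by (intro triangle') auto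
    ultimately show ?thesis by linarith
  qed
  then show ?thesis using S(1,2) UV(1,2) by (intro exI[of _ "\<Inter>x\<in>S. U x"] conjI open_INT) auto
qed

lemma (in Metric_space) compact_imp_bounded_separable:
  assumes "compact_space mtopology"
  obtains K C where "0 < K" "\<And>x y. x \<in> M \<Longrightarrow> y \<in> M \<Longrightarrow> d x y \<le> K" "countable C" "C \<subseteq> M"
    "\<And>x e. x \<in> M \<Longrightarrow> 0 < e \<Longrightarrow> \<exists>c\<in>C. d x c < e"
proof -
  have cM: "compactin mtopology M" using assms by (simp add: compact_space_def)
  obtain B where B: "0 < B" "\<forall>x\<in>M. \<forall>y\<in>M. d x y \<le> B"
    using compactin_imp_mbounded[OF cM] unfolding mbounded_alt_pos by auto
  have tb: "\<exists>S. finite S \<and> S \<subseteq> M \<and> M \<subseteq> (\<Union>x\<in>S. mball x (1 / real (Suc n)))" for n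
    using compactin_imp_mtotally_bounded[OF cM] unfolding mtotally_bounded_def by simp
  then obtain S where S: "\<And>n. finite (S n)" "\<And>n. S n \<subseteq> M" "\<And>n. M \<subseteq> (\<Union>x\<in>S n. mball x (1 / real (Suc n)))"
    by metis
  show ?thesis
  proof (rule that[OF B(1)])
    show "countable (\<Union>n. S n)" using S(1) by (intro countable_UN) (auto intro: countable_finite)
    show "(\<Union>n. S n) \<subseteq> M" using S(2) by auto
    fix x and e :: real assume "x \<in> M" "0 < e"
    obtain n where "1 / real (Suc n) < e" using nat_approx_posE[OF \<open>0 < e\<close>] by blast
    moreover obtain c where "c \<in> S n" "d c x < 1 / real (Suc n)" using S(3)[of n] \<open>x \<in> M\<close> by fastforce
    ultimately show "\<exists>c\<in>(\<Union>n. S n). d x c < e" by (intro bexI[of _ c]) (auto simp: commute)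
  qed (use B in auto)
qed

section \<open>The induced actions\<close>

locale compact_action = compact_metric_space M d K C + uniform_action M d K C \<mu> act
  for M :: "'a set" and d :: "'a \<Rightarrow> 'a \<Rightarrow> real" and K :: real and C :: "'a set"
    and \<mu> :: "'g::{topological_group_add, t2_space} measure" and act :: "'g \<Rightarrow> 'a \<Rightarrow> 'a" +
  assumes act_continuous: "continuous_map mtopology mtopology (act g)"
begin

abbreviation push :: "'g \<Rightarrow> 'a measure \<Rightarrow> 'a measure" where "push \<equiv> measure_action M d act"

lemma uniform_radius:
  assumes "\<And>x. x \<in> M \<Longrightarrow> 0 < r x"
  obtains \<delta> where "0 < \<delta>" "\<And>x. x \<in> M \<Longrightarrow> \<exists>z\<in>M. mcball x \<delta> \<subseteq> mcball z (r z)"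
proof -
  have "\<exists>\<delta>>0. \<forall>x\<in>M. \<exists>U\<in>(\<lambda>z. mball z (r z)) ` M. mball x \<delta> \<subseteq> U"
  proof (rule lebesgue_number)
    show "compactin mtopology M" using compact by (simp add: compact_space_def)
    show "M \<subseteq> \<Union> ((\<lambda>z. mball z (r z)) ` M)" using assms by fastforce
  qed auto
  then obtain \<delta> where \<delta>: "0 < \<delta>" "\<And>x. x \<in> M \<Longrightarrow> \<exists>U\<in>(\<lambda>z. mball z (r z)) ` M. mball x \<delta> \<subseteq> U" by blast
  show ?thesis
  proof (rule that[of "\<delta> / 2"])
    fix x assume "x \<in> M"
    then obtain z where z: "z \<in> M" "mball x \<delta> \<subseteq> mball z (r z)" using \<delta>(2) by blast
    moreover have "mcball x (\<delta> / 2) \<subseteq> mball x \<delta>" using \<delta>(1) by (intro mcball_subset_mball_concentric) simp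
    ultimately show "\<exists>z\<in>M. mcball x (\<delta> / 2) \<subseteq> mcball z (r z)"
      using mball_subset_mcball by blast
  qed (use \<delta> in simp)
qed

lemma act_measurable: "act g \<in> measurable \<B> \<B>"
proof (rule measurable_mborelI)
  fix U assume "openin mtopology U"
  then have "openin mtopology {x \<in> topspace mtopology. act g x \<in> U}"
    by (rule openin_continuous_map_preimage[OF act_continuous])
  moreover have "{x \<in> topspace mtopology. act g x \<in> U} = act g -` U \<inter> space \<B>" by auto
  ultimately show "act g -` U \<inter> space \<B> \<in> sets \<B>" using sets_mborel_openin by metis
qed simp

lemma image_mem_hyperspace: "A \<in> \<H> \<Longrightarrow> act g ` A \<in> \<H>"
proof -
  assume A: "A \<in> \<H>"
  then have "compactin mtopology A" using compact by (auto simp: hyperspace_def closedin_compact_space)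
  then have "compactin mtopology (act g ` A)" by (rule image_compactin[OF _ act_continuous])
  then show ?thesis using A by (auto simp: hyperspace_def intro: compactin_imp_closedin[OF Hausdorff_space_mtopology])
qed

lemma prob_measure_measurable:
  assumes "\<nu> \<in> \<P>" shows "measurable \<nu> N = measurable \<B> N"
  using assms by (intro measurable_cong_sets) (auto simp: mem_prob_measures)

lemma measure_action_mem: "\<nu> \<in> \<P> \<Longrightarrow> push g \<nu> \<in> \<P>"
  unfolding measure_action_def
  by (intro distr_mem_prob_measures) (auto simp: prob_measure_measurable act_measurable mem_prob_measures)

lemma measure_action_distr:
  assumes "f \<in> measurable N \<B>"
  shows "push g (distr N \<B> f) = distr N \<B> (\<lambda>\<omega>. act g (f \<omega>))"
  unfolding measure_action_def using distr_distr[OF act_measurable assms] by (simp add: comp_def)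

lemma wasserstein_action_le:
  assumes \<nu>: "\<nu> \<in> \<P>" and le: "\<forall>x\<in>M. d (act h x) (act g x) \<le> e"
  shows "\<W> (push h \<nu>) (push g \<nu>) \<le> e"
proof -
  interpret prob_space \<nu> using \<nu> by (simp add: mem_prob_measures)
  have m: "act h \<in> measurable \<nu> \<B>" "act g \<in> measurable \<nu> \<B>"
    by (simp_all add: prob_measure_measurable[OF \<nu>] act_measurable)
  have "\<W> (push h \<nu>) (push g \<nu>)
    \<le> (LINT x|\<nu>. d (act h x) (act g x))"
    unfolding measure_action_def by (rule wasserstein_distr_le[OF prob_space_axioms m])
  also have "\<dots> \<le> (LINT x|\<nu>. e)"
    using le space_prob_measures[OF \<nu>] by (intro integral_mono integrable_dist m prob_space_axioms) auto
  finally show ?thesis by (simp add: prob_space)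
qed

lemma hausdorff_action_le:
  assumes A: "A \<in> \<H>" and le: "\<forall>x\<in>M. d (act h x) (act g x) \<le> e"
  shows "dH (set_action act h A) (set_action act g A) \<le> e"
  unfolding set_action_def
proof (rule hausdorff_le[OF image_mem_hyperspace[OF A] image_mem_hyperspace[OF A]])
  note A' = hyperspaceD[OF A]
  fix u assume "u \<in> act h ` A"
  then obtain a where "a \<in> A" "u = act h a" by auto
  then have "infd u (act g ` A) \<le> d u (act g a)" "d u (act g a) \<le> e" using A' le by (auto intro: infd_le)
  then show "infd u (act g ` A) \<le> e" by linarith
next
  note A' = hyperspaceD[OF A]
  fix u assume "u \<in> act g ` A"
  then obtain a where a: "a \<in> A" "u = act g a" by auto
  then have "infd u (act h ` A) \<le> d u (act h a)" by (auto intro: infd_le)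
  moreover have "d u (act h a) \<le> e" using a A' le by (auto simp: commute[of "act g a"])
  ultimately show "infd u (act h ` A) \<le> e" by linarith
qed

text \<open>
  The dense sets are parameters of the interpretations below and have to be terms, so they are
  chosen once and for all.
\<close>

definition dense_measures :: "'a measure set" where
  "dense_measures = (SOME D. countable D \<and> D \<subseteq> \<P> \<and>
    (\<forall>\<nu>\<in>\<P>. \<forall>e>0. \<exists>c\<in>D. \<W> \<nu> c < e))"

definition dense_sets :: "'a set set" where
  "dense_sets = (SOME D. countable D \<and> D \<subseteq> \<H> \<and>
    (\<forall>A\<in>\<H>. \<forall>e>0. \<exists>c\<in>D. dH A c < e))"

lemma dense_measures: "countable dense_measures \<and> dense_measures \<subseteq> \<P> \<and>
    (\<forall>\<nu>\<in>\<P>. \<forall>e>0. \<exists>c\<in>dense_measures. \<W> \<nu> c < e)"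
  unfolding dense_measures_def by (rule someI_ex, rule separable_wasserstein) blast

lemma dense_sets: "countable dense_sets \<and> dense_sets \<subseteq> \<H> \<and>
    (\<forall>A\<in>\<H>. \<forall>e>0. \<exists>c\<in>dense_sets. dH A c < e)"
  unfolding dense_sets_def by (rule someI_ex, rule separable_hausdorff) blast

sublocale PM: uniform_action "\<P>" "\<W>" K dense_measures \<mu> "push"
proof -
  interpret W: Metric_space "\<P>" "\<W>" by (rule Metric_space_wasserstein)
  show "uniform_action \<P> \<W> K dense_measures \<mu> push"
  proof
    fix e :: real and g :: 'g assume "0 < e"
    then obtain U where U: "open U" "g \<in> U" "\<forall>h\<in>U. \<forall>x\<in>M. d (act h x) (act g x) \<le> e" using act_unif by blast
    show "\<exists>U. open U \<and> g \<in> U \<and> (\<forall>h\<in>U. \<forall>\<nu>\<in>\<P>.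
      \<W> (push h \<nu>) (push g \<nu>) \<le> e)"
      using U by (intro exI[of _ U] conjI ballI wasserstein_action_le) auto
  qed (use K_pos wasserstein_le_K dense_measures sets_mu measure_action_mem in auto)
qed

sublocale HY: uniform_action "\<H>" "dH" K dense_sets \<mu> "set_action act"
proof -
  interpret W: Metric_space "\<H>" "dH" by (rule Metric_space_hausdorff)
  show "uniform_action \<H> dH K dense_sets \<mu> (set_action act)"
  proof
    fix e :: real and g :: 'g assume "0 < e"
    then obtain U where U: "open U" "g \<in> U" "\<forall>h\<in>U. \<forall>x\<in>M. d (act h x) (act g x) \<le> e" using act_unif by blast
    show "\<exists>U. open U \<and> g \<in> U \<and> (\<forall>h\<in>U. \<forall>A\<in>\<H>.
      dH (set_action act h A) (set_action act g A) \<le> e)"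
      using U by (intro exI[of _ U] conjI ballI hausdorff_action_le) auto
  qed (use K_pos hausdorff_le_K dense_sets sets_mu image_mem_hyperspace in \<open>auto simp: set_action_def\<close>)
qed

lemma distr_const_eq_return: "prob_space N \<Longrightarrow> x \<in> M \<Longrightarrow> distr N \<B> (\<lambda>_. x) = return \<B> x"
  by (simp add: prob_space.distr_const)

text \<open>
  The lower bound comes from the Lipschitz function \<open>d u y\<close> of \<open>u\<close>.
\<close>

lemma wasserstein_return:
  assumes x: "x \<in> M" and y: "y \<in> M"
  shows "\<W> (return \<B> x) (return \<B> y) = d x y"
proof (rule antisym)
  have N: "prob_space (return \<B> x)" using x by (intro prob_space_return) simp
  interpret N: prob_space "return \<B> x" by (rule N)
  have "\<W> (distr (return \<B> x) \<B> (\<lambda>_. x)) (distr (return \<B> x) \<B> (\<lambda>_. y)) \<le> (LINT _|return \<B> x. d x y)"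
    by (rule wasserstein_distr_le[OF N]) (use x y in auto)
  then show "\<W> (return \<B> x) (return \<B> y) \<le> d x y"
    using N.prob_space by (simp add: distr_const_eq_return[OF N] x y)
  have "\<bar>d u y - d v y\<bar> \<le> d u v" if "u \<in> M" "v \<in> M" for u v
    using that y by (metis commute mdist_reverse_triangle)
  from kantorovich_lower_bound[OF this return_mem_prob_measures[OF x] return_mem_prob_measures[OF y]]
  show "d x y \<le> \<W> (return \<B> x) (return \<B> y)"
    using x y borel_measurable_dist_point[OF y] by (simp add: integral_return)
qed

lemma measure_action_return: "x \<in> M \<Longrightarrow> push g (return \<B> x) = return \<B> (act g x)"
  unfolding measure_action_def by (rule distr_return[OF act_measurable]) simp

lemma avg_dist_return:
  assumes "x \<in> M" "y \<in> M" shows "PM.avg_dist F (return \<B> x) (return \<B> y) = avg_dist F x y"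
  unfolding PM.avg_dist_def avg_dist_def using assms by (simp add: measure_action_return wasserstein_return)

lemma mean_of_measures_imp_mean:
  assumes "mean_equicontinuous \<mu> \<P> \<W> push"
  shows "mean_equicontinuous \<mu> M d act"
  unfolding mean_equicontinuous_def
proof
  fix x assume x: "x \<in> M"
  have "mean_equicontinuity_point \<mu> \<P> \<W> push (return \<B> x)"
    using assms return_mem_prob_measures[OF x] by (auto simp: mean_equicontinuous_def)
  note * = this[unfolded PM.mean_point_iff[OF return_mem_prob_measures[OF x]]]
  show "mean_equicontinuity_point \<mu> M d act x"
    unfolding mean_point_iff[OF x]
  proof (intro allI impI)
    fix e :: real assume "0 < e"
    then obtain \<delta> where \<delta>: "0 < \<delta>" "\<And>\<nu> F. \<nu> \<in> \<P> \<Longrightarrow> \<W> (return \<B> x) \<nu> \<le> \<delta> \<Longrightarrow>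
      folner \<mu> F \<Longrightarrow> \<forall>\<^sub>F n in sequentially. PM.avg_dist (F n) (return \<B> x) \<nu> < e"
      using * by meson
    show "\<exists>\<delta>>0. \<forall>y\<in>M. d x y \<le> \<delta> \<longrightarrow> (\<forall>F. folner \<mu> F \<longrightarrow> (\<forall>\<^sub>F n in sequentially. avg_dist (F n) x y < e))"
      using \<delta>(1) \<delta>(2)[OF return_mem_prob_measures] x
      by (intro exI[of _ \<delta>]) (auto simp: wasserstein_return avg_dist_return)
  qed
qed

text \<open>
  The Dirac measures at the points of a ball lie in the ball of the same radius in the space of
  measures, isometrically and equivariantly.
\<close>

lemma diam_mean_of_measures_imp_diam_mean:
  assumes "diam_mean_equicontinuous \<mu> \<P> \<W> push"
  shows "diam_mean_equicontinuous \<mu> M d act"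
  unfolding diam_mean_equicontinuous_def
proof
  fix x assume x: "x \<in> M"
  note rx = return_mem_prob_measures[OF x]
  have "diam_mean_equicontinuity_point \<mu> \<P> \<W> push (return \<B> x)"
    using assms rx by (auto simp: diam_mean_equicontinuous_def)
  note * = this[unfolded PM.diam_mean_point_iff[OF rx]]
  show "diam_mean_equicontinuity_point \<mu> M d act x"
  proof (rule diam_mean_pointI[OF x])
    fix e :: real assume "0 < e"
    then obtain \<delta> where \<delta>: "0 < \<delta>"
      "\<And>F. folner \<mu> F \<Longrightarrow> \<forall>\<^sub>F n in sequentially. PM.avg_diam (F n) (PM.mcball (return \<B> x) \<delta>) < e"
      using * by meson
    let ?B = "PM.mcball (return \<B> x) \<delta>"
    let ?R = "\<lambda>g. mset_diam \<W> (push g ` ?B)"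
    have sub: "?B \<subseteq> \<P>" by (rule PM.mcball_subset_mspace)
    have centre: "return \<B> x \<in> ?B" using rx \<delta>(1) by simp
    have le: "d (act g x) (act g y) \<le> ?R g" if y: "y \<in> M" "d x y \<le> \<delta>" for g y
    proof -
      have "return \<B> y \<in> ?B" using y x by (simp add: wasserstein_return return_mem_prob_measures)
      then have "\<W> (push g (return \<B> x)) (push g (return \<B> y)) \<le> ?R g"
        by (intro PM.mset_diam_upper[OF PM.image_subset[OF sub]] imageI centre)
      then show ?thesis using x y(1) by (simp add: measure_action_return wasserstein_return)
    qed
    have "integrable (unif (F n)) ?R" if "folner \<mu> F" for F n
      by (rule PM.integrable_diam_orbit[OF that sub]) (use centre in blast)
    with \<delta> le show "\<exists>\<delta> R. 0 < \<delta> \<and> (\<forall>g. \<forall>y\<in>M. d x y \<le> \<delta> \<longrightarrow> d (act g x) (act g y) \<le> R g) \<and>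
      (\<forall>F. folner \<mu> F \<longrightarrow> (\<forall>n. integrable (unif (F n)) R) \<and> (\<forall>\<^sub>F n in sequentially. (LINT g|unif (F n). R g) < e))"
      by (intro exI[of _ \<delta>] exI[of _ ?R]) (auto simp: PM.avg_diam_def)
  qed
qed

end

section \<open>Mean equicontinuity of measures\<close>

context compact_action
begin

text \<open>
  The measure \<open>(\<delta>_x + \<delta>_y) / 2\<close>, written as the law of a point chosen by a fair coin, so that the
  rules for laws of random variables apply to it.
\<close>

definition two_point :: "'a \<Rightarrow> 'a \<Rightarrow> 'a measure" where
  "two_point x y = distr (measure_pmf (bernoulli_pmf (1/2))) \<B> (\<lambda>b. if b then x else y)"

lemma two_point_mem: "x \<in> M \<Longrightarrow> y \<in> M \<Longrightarrow> two_point x y \<in> \<P>"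
  unfolding two_point_def by (intro distr_mem_prob_measures prob_space_measure_pmf) auto

lemma measure_action_two_point:
  assumes "x \<in> M" "y \<in> M" shows "push g (two_point x y) = two_point (act g x) (act g y)"
  unfolding two_point_def using assms by (subst measure_action_distr) (auto simp: if_distrib)

lemma wasserstein_return_two_point:
  assumes "x \<in> M" "y \<in> M" shows "\<W> (return \<B> x) (two_point x y) \<le> d x y"
proof -
  let ?N = "measure_pmf (bernoulli_pmf (1/2))"
  have "return \<B> x = distr ?N \<B> (\<lambda>_. x)"
    using assms by (simp add: distr_const_eq_return prob_space_measure_pmf)
  then have "\<W> (return \<B> x) (two_point x y) \<le> (LINT b|?N. d x (if b then x else y))"
    unfolding two_point_def using assms by (simp only:) (rule wasserstein_distr_le; simp add: prob_space_measure_pmf)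
  also have "\<dots> \<le> d x y" using assms nonneg[of x y] by simp
  finally show ?thesis .
qed

abbreviation diracs :: "'a measure set" where "diracs \<equiv> return \<B> ` M"

lemma diracs: "diracs \<noteq> {}" "diracs \<subseteq> \<P>"
  using nonempty by (auto intro: return_mem_prob_measures)

text \<open>
  Transporting the two-point measure to a single point \<open>z\<close> costs \<open>(d x z + d y z) / 2\<close>.
\<close>

lemma infd_two_point_diracs:
  assumes "x \<in> M" "y \<in> M" shows "d x y / 2 \<le> PM.infd (two_point x y) diracs"
proof (rule PM.infd_greatest[OF diracs(1)])
  fix \<nu> assume "\<nu> \<in> diracs"
  then obtain z where z: "z \<in> M" "\<nu> = return \<B> z" by auto
  have lip: "\<bar>d u z - d v z\<bar> \<le> d u v" if "u \<in> M" "v \<in> M" for u v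
    using that z by (metis commute mdist_reverse_triangle)
  have "(LINT x|two_point x y. d x z) = (d x z + d y z) / 2"
    unfolding two_point_def using assms borel_measurable_dist_point[OF z(1)]
    by (subst integral_distr) auto
  moreover have "(LINT x|return \<B> z. d x z) = 0"
    using z borel_measurable_dist_point[OF z(1)] by (simp add: integral_return)
  ultimately have "(d x z + d y z) / 2 \<le> \<W> (two_point x y) \<nu>"
    using kantorovich_lower_bound[OF lip two_point_mem[OF assms] return_mem_prob_measures[OF z(1)]] z(2) by simp
  moreover have "d x y \<le> d x z + d z y" using assms z by (intro triangle)
  ultimately show "d x y / 2 \<le> \<W> (two_point x y) \<nu>" using commute[of z y] by argo
qed

text \<open>
  The distance to the Dirac measures is a single function on the space of measures that
  sees the distance of two orbits: it vanishes along the orbit of the Dirac measure at \<open>x\<close>, and along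
  the orbit of the two-point measure it is at least half the distance of the orbits of \<open>x\<close> and \<open>y\<close>.
\<close>

lemma avg_dist_le_emp_wasserstein_two_point:
  assumes F: "folner \<mu> F" and xy: "x \<in> M" "y \<in> M"
  shows "avg_dist (F n) x y \<le> 2 * PM.emp_wasserstein (F n) (return \<B> x) (two_point x y)"
proof -
  note mem = return_mem_prob_measures[OF xy(1)] two_point_mem[OF xy]
  let ?\<phi> = "\<lambda>\<nu>. - PM.infd \<nu> diracs"
  have lip: "\<bar>?\<phi> \<nu> - ?\<phi> \<nu>'\<bar> \<le> \<W> \<nu> \<nu>'"
    if "\<nu> \<in> \<P>" "\<nu>' \<in> \<P>" for \<nu> \<nu>'
    using PM.infd_lipschitz[OF diracs that] by (simp add: abs_minus_commute)
  have "avg_dist (F n) x y \<le> (LINT g|unif (F n). 2 * (?\<phi> (push g (return \<B> x)) - ?\<phi> (push g (two_point x y))))"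
    unfolding avg_dist_def
  proof (rule integral_mono)
    fix g
    have g: "act g x \<in> M" "act g y \<in> M" using xy by auto
    have "PM.infd (return \<B> (act g x)) diracs \<le> 0"
      using PM.infd_le[of "return \<B> (act g x)" diracs "return \<B> (act g x)"] g
      by (simp add: wasserstein_return)
    with infd_two_point_diracs[OF g]
    show "d (act g x) (act g y) \<le> 2 * (?\<phi> (push g (return \<B> x)) - ?\<phi> (push g (two_point x y)))"
      using xy by (simp add: measure_action_return measure_action_two_point)
  qed (intro integrable_dist_orbit F xy integrable_mult_right Bochner_Integration.integrable_diff
      PM.integrable_lipschitz_orbit mem lip)+
  also have "\<dots> = 2 * ((LINT g|unif (F n). ?\<phi> (push g (return \<B> x)))
      - (LINT g|unif (F n). ?\<phi> (push g (two_point x y))))"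
    by (subst integral_mult_right_zero, subst Bochner_Integration.integral_diff)
      (intro PM.integrable_lipschitz_orbit F mem lip refl; assumption)+
  also have "\<dots> \<le> 2 * PM.emp_wasserstein (F n) (return \<B> x) (two_point x y)"
    using PM.lipschitz_average_le_emp_wasserstein[OF F mem lip, of n] by simp
  finally show ?thesis .
qed

lemma weakly_mean_of_measures_imp_mean:
  assumes "weakly_mean_equicontinuous \<mu> \<P> \<W> push"
  shows "mean_equicontinuous \<mu> M d act"
  unfolding mean_equicontinuous_def
proof
  fix x assume x: "x \<in> M"
  note rx = return_mem_prob_measures[OF x]
  have "weak_mean_equicontinuity_point \<mu> \<P> \<W> push (return \<B> x)"
    using assms rx by (auto simp: weakly_mean_equicontinuous_def)
  note * = this[unfolded PM.weak_mean_point_iff[OF rx]]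
  show "mean_equicontinuity_point \<mu> M d act x"
    unfolding mean_point_iff[OF x]
  proof (intro allI impI)
    fix e :: real assume "0 < e"
    then obtain \<delta> where \<delta>: "0 < \<delta>" "\<And>\<nu> F. \<nu> \<in> \<P> \<Longrightarrow> \<W> (return \<B> x) \<nu> \<le> \<delta> \<Longrightarrow>
      folner \<mu> F \<Longrightarrow> \<forall>\<^sub>F n in sequentially. PM.emp_wasserstein (F n) (return \<B> x) \<nu> < e / 2"
      using * half_gt_zero by meson
    show "\<exists>\<delta>>0. \<forall>y\<in>M. d x y \<le> \<delta> \<longrightarrow> (\<forall>F. folner \<mu> F \<longrightarrow> (\<forall>\<^sub>F n in sequentially. avg_dist (F n) x y < e))"
    proof (intro exI[of _ \<delta>] conjI ballI impI allI \<delta>(1))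
      fix y F assume y: "y \<in> M" "d x y \<le> \<delta>" and F: "folner \<mu> F"
      have "\<forall>\<^sub>F n in sequentially. PM.emp_wasserstein (F n) (return \<B> x) (two_point x y) < e / 2"
        using wasserstein_return_two_point[OF x y(1)] y(2) by (intro \<delta>(2) two_point_mem x y F) simp
      then have "\<forall>\<^sub>F n in sequentially. 2 * PM.emp_wasserstein (F n) (return \<B> x) (two_point x y) < e"
        by (rule eventually_mono) simp
      then show "\<forall>\<^sub>F n in sequentially. avg_dist (F n) x y < e"
        by (rule eventually_le_less) (rule avg_dist_le_emp_wasserstein_two_point[OF F x y(1)])
    qed
  qed
qed

lemma act_continuousD:
  assumes "x \<in> M" "0 < e"
  obtains \<delta> where "0 < \<delta>" "\<And>y. y \<in> M \<Longrightarrow> d x y < \<delta> \<Longrightarrow> d (act g x) (act g y) < e"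
  using act_continuous[of g] assms unfolding metric_continuous_map[OF Metric_space_axioms] by meson

text \<open>
  The group may lack a countable base, and then continuity on the product does not imply
  measurability for the product \<open>\<sigma>\<close>-algebra. Rounding the two points to finite nets leaves
  finitely many functions of the group element alone; the general case is their pointwise limit.
\<close>

lemma borel_measurable_dist_act:
  "(\<lambda>w. d (act (fst w) (fst (snd w))) (act (fst w) (snd (snd w)))) \<in> borel_measurable (borel \<Otimes>\<^sub>M (\<B> \<Otimes>\<^sub>M \<B>))"
proof -
  let ?N = "(borel :: 'g measure) \<Otimes>\<^sub>M (\<B> \<Otimes>\<^sub>M \<B>)"
  obtain Z p where Z: "\<And>n. finite (Z n)" "\<And>n. Z n \<subseteq> M"
    and p: "\<And>n. p n \<in> measurable \<B> (count_space (Z n))" "\<And>n x. x \<in> M \<Longrightarrow> d x (p n x) < 1 / real (Suc n)"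
    using net_map_sequence by metis
  have pM: "p n x \<in> M" if "x \<in> M" for n x using measurable_space[OF p(1)[of n]] that Z by auto
  have m1: "(\<lambda>w. p n (fst (snd w))) \<in> measurable ?N (count_space (Z n))"
    and m2: "(\<lambda>w. p n (snd (snd w))) \<in> measurable ?N (count_space (Z n))" for n
    by (rule measurable_compose[OF _ p(1)]; measurable)+
  have meas: "(\<lambda>w. d (act (fst w) (p n (fst (snd w)))) (act (fst w) (p n (snd (snd w))))) \<in> borel_measurable ?N" for n
  proof (rule measurable_compose_countable'[OF _ m1 countable_finite[OF Z(1)]])
    fix a assume a: "a \<in> Z n"
    show "(\<lambda>w. d (act (fst w) a) (act (fst w) (p n (snd (snd w))))) \<in> borel_measurable ?N"
    proof (rule measurable_compose_countable'[OF _ m2 countable_finite[OF Z(1)]])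
      fix b assume b: "b \<in> Z n"
      have "a \<in> M" "b \<in> M" using a b Z by auto
      from measurable_compose[OF measurable_fst dist_orbit_measurable[OF this]]
      show "(\<lambda>w. d (act (fst w) a) (act (fst w) b)) \<in> borel_measurable ?N" .
    qed
  qed
  show ?thesis
  proof (rule borel_measurable_LIMSEQ_real[OF _ meas])
    fix w assume "w \<in> space ?N"
    then obtain g x y where w: "w = (g, x, y)" and xy: "x \<in> M" "y \<in> M" by (auto simp: space_pair_measure)
    have lim: "(\<lambda>n. d (act g x) (act g (p n x))) \<longlonglongrightarrow> 0" if x: "x \<in> M" for x
    proof (rule LIMSEQ_I)
      fix e :: real assume "0 < e"
      then obtain \<delta> where \<delta>: "0 < \<delta>" "\<And>y. y \<in> M \<Longrightarrow> d x y < \<delta> \<Longrightarrow> d (act g x) (act g y) < e"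
        using act_continuousD[OF x] by metis
      obtain n0 where n0: "1 / real (Suc n0) < \<delta>" using \<delta>(1) nat_approx_posE by blast
      have "d (act g x) (act g (p n x)) < e" if "n0 \<le> n" for n
      proof (rule \<delta>(2)[OF pM[OF x]])
        have "1 / real (Suc n) \<le> 1 / real (Suc n0)" using that by (simp add: field_simps)
        then show "d x (p n x) < \<delta>" using p(2)[OF x, of n] n0 by linarith
      qed
      then show "\<exists>n0. \<forall>n\<ge>n0. norm (d (act g x) (act g (p n x)) - 0) < e" by auto
    qed
    have "(\<lambda>n. d (act g (p n x)) (act g (p n y))) \<longlonglongrightarrow> d (act g x) (act g y)"
    proof (rule Lim_transform_bound[where g="\<lambda>n. d (act g x) (act g (p n x)) + d (act g y) (act g (p n y))", THEN LIM_zero_cancel])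
      show "\<forall>\<^sub>F n in sequentially. norm (d (act g (p n x)) (act g (p n y)) - d (act g x) (act g y))
        \<le> norm (d (act g x) (act g (p n x)) + d (act g y) (act g (p n y)))"
      proof (rule always_eventually, rule allI)
        fix n
        let ?a = "act g x" and ?b = "act g y" and ?a' = "act g (p n x)" and ?b' = "act g (p n y)"
        have M: "?a \<in> M" "?b \<in> M" "?a' \<in> M" "?b' \<in> M" using xy pM by auto
        have "d ?a ?b \<le> d ?a ?a' + d ?a' ?b" "d ?a' ?b \<le> d ?a' ?b' + d ?b' ?b"
          "d ?a' ?b' \<le> d ?a' ?a + d ?a ?b'" "d ?a ?b' \<le> d ?a ?b + d ?b ?b'"
          using M by (auto intro: triangle)
        then show "norm (d ?a' ?b' - d ?a ?b) \<le> norm (d ?a ?a' + d ?b ?b')"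
          using commute[of ?a' ?a] commute[of ?b' ?b] nonneg[of ?a ?a'] nonneg[of ?b ?b']
          unfolding real_norm_def by linarith
      qed
      show "(\<lambda>n. d (act g x) (act g (p n x)) + d (act g y) (act g (p n y))) \<longlonglongrightarrow> 0"
        using tendsto_add[OF lim[OF xy(1)] lim[OF xy(2)]] by simp
    qed
    then show "(\<lambda>n. d (act (fst w) (p n (fst (snd w)))) (act (fst w) (p n (snd (snd w)))))
      \<longlonglongrightarrow> d (act (fst w) (fst (snd w))) (act (fst w) (snd (snd w)))" by (simp add: w)
  qed
qed

lemma coupling_space: "\<kappa> \<in> couplings M d \<nu>1 \<nu>2 \<Longrightarrow> space \<kappa> = M \<times> M"
  using sets_eq_imp_space_eq[OF couplingD(6)] by (simp add: space_pair_measure)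

lemma wasserstein_measure_action_le:
  assumes \<kappa>: "\<kappa> \<in> couplings M d \<nu>1 \<nu>2"
  shows "\<W> (push g \<nu>1) (push g \<nu>2)
    \<le> (LINT w|\<kappa>. d (act g (fst w)) (act g (snd w)))"
proof -
  note c = couplingD[OF \<kappa>]
  have "push g \<nu>1 = distr \<kappa> \<B> (\<lambda>w. act g (fst w))"
    "push g \<nu>2 = distr \<kappa> \<B> (\<lambda>w. act g (snd w))"
    using measure_action_distr[OF c(2)] measure_action_distr[OF c(3)] c(4,5) by simp_all
  then show ?thesis
    using wasserstein_distr_le[OF c(1) measurable_compose[OF c(2) act_measurable[of g]] measurable_compose[OF c(3) act_measurable[of g]]]
    by simp
qed

text \<open>
  A coupling of two measures is moved along by every group element, which bounds the distance of the
  translated measures; Fubini then exchanges the average over the group with the coupling.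
\<close>

lemma avg_dist_measures_le:
  assumes \<kappa>: "\<kappa> \<in> couplings M d \<nu>1 \<nu>2" and \<nu>: "\<nu>1 \<in> \<P>" "\<nu>2 \<in> \<P>"
    and F: "folner \<mu> F"
  shows "integrable \<kappa> (\<lambda>w. avg_dist (F n) (fst w) (snd w))"
    "PM.avg_dist (F n) \<nu>1 \<nu>2 \<le> (LINT w|\<kappa>. avg_dist (F n) (fst w) (snd w))"
proof -
  note c = couplingD[OF \<kappa>]
  interpret U: prob_space "unif (F n)" by (rule prob_space_unif[OF F])
  interpret k: prob_space \<kappa> by (rule c(1))
  interpret P: pair_prob_space "unif (F n)" \<kappa> ..
  let ?f = "\<lambda>g w. d (act g (fst w)) (act g (snd w))"
  have s: "sets (unif (F n) \<Otimes>\<^sub>M \<kappa>) = sets (borel \<Otimes>\<^sub>M (\<B> \<Otimes>\<^sub>M \<B>))"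
    by (rule sets_pair_measure_cong) (use c in \<open>simp_all add: sets_mu\<close>)
  have int: "integrable (unif (F n) \<Otimes>\<^sub>M \<kappa>) (case_prod ?f)"
  proof (rule P.integrable_const_bound[of _ K])
    show "case_prod ?f \<in> borel_measurable (unif (F n) \<Otimes>\<^sub>M \<kappa>)"
      using borel_measurable_dist_act by (simp add: measurable_cong_sets[OF s refl] case_prod_beta)
    show "AE w in unif (F n) \<Otimes>\<^sub>M \<kappa>. norm (case_prod ?f w) \<le> K"
      by (rule AE_I2) (auto simp: space_pair_measure coupling_space[OF \<kappa>] intro!: le_K)
  qed
  show "integrable \<kappa> (\<lambda>w. avg_dist (F n) (fst w) (snd w))"
    unfolding avg_dist_def by (rule P.integrable_snd[OF int])
  have "PM.avg_dist (F n) \<nu>1 \<nu>2 \<le> (LINT g|unif (F n). LINT w|\<kappa>. ?f g w)"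
    unfolding PM.avg_dist_def
    by (intro integral_mono PM.integrable_dist_orbit F \<nu> P.integrable_fst'[OF int, simplified] wasserstein_measure_action_le \<kappa>)
  also have "\<dots> = (LINT w|\<kappa>. avg_dist (F n) (fst w) (snd w))"
    unfolding avg_dist_def by (rule P.Fubini_integral[OF int, symmetric])
  finally show "PM.avg_dist (F n) \<nu>1 \<nu>2 \<le> (LINT w|\<kappa>. avg_dist (F n) (fst w) (snd w))" .
qed

text \<open>
  Two close points lie in one of the balls given by equicontinuity at its centre, with a
  Lebesgue number as the measure of closeness.
\<close>

lemma mean_equicontinuous_uniform:
  assumes "mean_equicontinuous \<mu> M d act" "0 < e"
  obtains \<delta> where "0 < \<delta>" "\<And>x y F. x \<in> M \<Longrightarrow> y \<in> M \<Longrightarrow> d x y \<le> \<delta> \<Longrightarrow> folner \<mu> F \<Longrightarrow>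
    \<forall>\<^sub>F n in sequentially. avg_dist (F n) x y < e"
proof -
  have "\<forall>x\<in>M. \<exists>\<delta>>0. \<forall>y\<in>M. d x y \<le> \<delta> \<longrightarrow> (\<forall>F. folner \<mu> F \<longrightarrow> (\<forall>\<^sub>F n in sequentially. avg_dist (F n) x y < e / 2))"
    using assms mean_point_iff half_gt_zero unfolding mean_equicontinuous_def by meson
  then obtain r where r: "\<And>x. x \<in> M \<Longrightarrow> 0 < r x"
    "\<And>x y F. x \<in> M \<Longrightarrow> y \<in> M \<Longrightarrow> d x y \<le> r x \<Longrightarrow> folner \<mu> F \<Longrightarrow> \<forall>\<^sub>F n in sequentially. avg_dist (F n) x y < e / 2"
    by metis
  obtain \<delta> where \<delta>: "0 < \<delta>" "\<And>x. x \<in> M \<Longrightarrow> \<exists>z\<in>M. mcball x \<delta> \<subseteq> mcball z (r z)"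
    using uniform_radius[of r] r(1) by blast
  show ?thesis
  proof (rule that[OF \<delta>(1)])
    fix x y F assume xy: "x \<in> M" "y \<in> M" "d x y \<le> \<delta>" and F: "folner \<mu> F"
    obtain z where z: "z \<in> M" "mcball x \<delta> \<subseteq> mcball z (r z)" using \<delta>(2)[OF xy(1)] by blast
    have "x \<in> mcball x \<delta>" "y \<in> mcball x \<delta>" using xy \<delta>(1) by auto
    then have "d z x \<le> r z" "d z y \<le> r z" using z(2) by (meson in_mcball subsetD)+
    then have "\<forall>\<^sub>F n in sequentially. avg_dist (F n) z x < e / 2" "\<forall>\<^sub>F n in sequentially. avg_dist (F n) z y < e / 2"
      using r(2) z xy F by blast+
    then show "\<forall>\<^sub>F n in sequentially. avg_dist (F n) x y < e"
    proof eventually_elim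
      case (elim n)
      then show ?case using avg_dist_triangle[OF F xy(1) z(1) xy(2), of n] avg_dist_commute[of "F n" x z] by linarith
    qed
  qed
qed

text \<open>
  Under a nearly optimal coupling, a pair at distance at most \<open>\<delta>\<close> contributes less than \<open>e / 4\<close> to the
  average, eventually but not uniformly in the pair. A pair at distance more than \<open>\<delta>\<close>
  contributes at most \<open>K\<close>, hence at most \<open>K / \<delta>\<close> times its distance. What exceeds these two
  bounds tends to \<open>0\<close> pointwise, and its integral does so by dominated convergence.
\<close>

lemma mean_imp_mean_of_measures:
  assumes "mean_equicontinuous \<mu> M d act"
  shows "mean_equicontinuous \<mu> \<P> \<W> push"
  unfolding mean_equicontinuous_def
proof
  fix \<nu> assume \<nu>: "\<nu> \<in> \<P>"
  show "mean_equicontinuity_point \<mu> \<P> \<W> push \<nu>"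
    unfolding PM.mean_point_iff[OF \<nu>]
  proof (intro allI impI)
    fix e :: real assume e: "0 < e"
    then have "0 < e / 4" by simp
    then obtain \<delta> where \<delta>: "0 < \<delta>" "\<And>x y F. x \<in> M \<Longrightarrow> y \<in> M \<Longrightarrow> d x y \<le> \<delta> \<Longrightarrow> folner \<mu> F \<Longrightarrow>
      \<forall>\<^sub>F n in sequentially. avg_dist (F n) x y < e / 4"
      using mean_equicontinuous_uniform[OF assms] by metis
    define \<eta> where "\<eta> = e / 4 * \<delta> / K / 2"
    have \<eta>: "0 < \<eta>" "K / \<delta> * (2 * \<eta>) = e / 4" using e \<delta>(1) K_pos by (simp_all add: \<eta>_def)
    show "\<exists>\<delta>>0. \<forall>\<nu>'\<in>\<P>. \<W> \<nu> \<nu>' \<le> \<delta> \<longrightarrow>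
      (\<forall>F. folner \<mu> F \<longrightarrow> (\<forall>\<^sub>F n in sequentially. PM.avg_dist (F n) \<nu> \<nu>' < e))"
    proof (intro exI[of _ \<eta>] conjI ballI impI allI \<eta>(1))
      fix \<nu>' F assume \<nu>': "\<nu>' \<in> \<P>" "\<W> \<nu> \<nu>' \<le> \<eta>" and F: "folner \<mu> F"
      obtain \<kappa> where \<kappa>: "\<kappa> \<in> couplings M d \<nu> \<nu>'" "(LINT p|\<kappa>. d (fst p) (snd p)) < \<W> \<nu> \<nu>' + \<eta>"
        using obtain_coupling[OF \<nu> \<nu>'(1) \<eta>(1)] by blast
      note c = couplingD[OF \<kappa>(1)] and sp = coupling_space[OF \<kappa>(1)]
      interpret k: prob_space \<kappa> by (rule c(1))
      let ?a = "\<lambda>n w. avg_dist (F n) (fst w) (snd w)"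
      let ?b = "\<lambda>w. e / 4 + K / \<delta> * d (fst w) (snd w)"
\<comment> \<open>The excess of the average over the two admissible contributions.\<close>
      let ?c = "\<lambda>n w. max 0 (?a n w - ?b w)"
      note a_int = avg_dist_measures_le(1)[OF \<kappa>(1) \<nu> \<nu>'(1) F]
      have d_int: "integrable \<kappa> (\<lambda>w. d (fst w) (snd w))" using integrable_dist[OF c(1,2,3)] .
      have b_int: "integrable \<kappa> ?b" using d_int by simp
      have c_int: "integrable \<kappa> (?c n)" for n
        using a_int b_int by (intro integrable_max) auto
      have "(\<lambda>n. LINT w|\<kappa>. ?c n w) \<longlonglongrightarrow> (LINT w|\<kappa>. 0)"
      proof (rule integral_dominated_convergence[where w="\<lambda>_. K"])
        show "AE w in \<kappa>. (\<lambda>n. ?c n w) \<longlonglongrightarrow> 0"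
        proof (rule AE_I2)
          fix w assume "w \<in> space \<kappa>"
          then have w: "fst w \<in> M" "snd w \<in> M" by (auto simp: sp)
          have "\<forall>\<^sub>F n in sequentially. ?c n w = 0"
          proof (cases "d (fst w) (snd w) \<le> \<delta>")
            case True
            from \<delta>(2)[OF w True F] show ?thesis
            proof eventually_elim
              case (elim n)
              moreover have "0 \<le> K / \<delta> * d (fst w) (snd w)" using K_pos \<delta>(1) nonneg by simp
              ultimately show ?case by simp
            qed
          next
            case False
            then have "K / \<delta> * \<delta> \<le> K / \<delta> * d (fst w) (snd w)" using K_pos \<delta>(1) by (intro mult_left_mono) auto
            then have "K \<le> ?b w" using \<delta>(1) e by simp
            then have "?a n w - ?b w \<le> 0" for n using avg_dist_bounds(2)[OF F w, of n] by linarith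
            then show ?thesis by (intro always_eventually allI max_absorb1)
          qed
          then show "(\<lambda>n. ?c n w) \<longlonglongrightarrow> 0" by (rule tendsto_eventually)
        qed
        show "AE w in \<kappa>. norm (?c n w) \<le> K" for n
        proof (rule AE_I2)
          fix w assume "w \<in> space \<kappa>"
          then have w: "fst w \<in> M" "snd w \<in> M" by (auto simp: sp)
          have "0 \<le> ?b w" using K_pos \<delta>(1) nonneg[of "fst w" "snd w"] e by (intro add_nonneg_nonneg mult_nonneg_nonneg) auto
          then show "norm (?c n w) \<le> K" using avg_dist_bounds(2)[OF F w, of n] K_pos by (simp add: max_def)
        qed
      qed (use c_int in \<open>auto dest: borel_measurable_integrable\<close>)
      then have "(\<lambda>n. LINT w|\<kappa>. ?c n w) \<longlonglongrightarrow> 0" by simp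
      then have "\<forall>\<^sub>F n in sequentially. (LINT w|\<kappa>. ?c n w) < e / 4"
        using e by (intro order_tendstoD) auto
      then show "\<forall>\<^sub>F n in sequentially. PM.avg_dist (F n) \<nu> \<nu>' < e"
      proof eventually_elim
        case (elim n)
        have "PM.avg_dist (F n) \<nu> \<nu>' \<le> (LINT w|\<kappa>. ?a n w)"
          by (rule avg_dist_measures_le(2)[OF \<kappa>(1) \<nu> \<nu>'(1) F])
        also have "\<dots> \<le> (LINT w|\<kappa>. ?b w + ?c n w)"
          by (intro integral_mono a_int Bochner_Integration.integrable_add[OF b_int c_int]) auto
        also have "\<dots> = (LINT w|\<kappa>. ?b w) + (LINT w|\<kappa>. ?c n w)"
          using b_int c_int by (rule Bochner_Integration.integral_add)
        also have "(LINT w|\<kappa>. ?b w) = e / 4 + K / \<delta> * (LINT w|\<kappa>. d (fst w) (snd w))"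
          using d_int by (simp add: k.prob_space)
        also have "K / \<delta> * (LINT w|\<kappa>. d (fst w) (snd w)) \<le> K / \<delta> * (2 * \<eta>)"
          using \<kappa>(2) \<nu>'(2) K_pos \<delta>(1) by (intro mult_left_mono) auto
        finally show ?case using elim \<eta>(2) e by linarith
      qed
    qed
  qed
qed

end

section \<open>Diam-mean equicontinuity of measures\<close>

context compact_action
begin

text \<open>
  A pair \<open>(x, y)\<close> of a coupling either has distance at most \<open>\<eta> / 2\<close>, and then both points lie in the
  ball of radius \<open>\<eta>\<close> around the net point \<open>p x\<close>, or its translates are at most \<open>K\<close> apart, which is
  bounded by \<open>2 * K / \<eta>\<close> times the distance of \<open>x\<close> and \<open>y\<close>. The resulting bound involves \<open>\<nu>'\<close> only
  through its distance to \<open>\<nu>\<close>, as an estimate of diameters demands.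

  The net map only has to be close to the identity almost everywhere: for a measure carried by a
  finite set, it can be the identity there.
\<close>

lemma wasserstein_action_le_sum_diam:
  assumes \<nu>: "\<nu> \<in> \<P>" "\<nu>' \<in> \<P>" and \<eta>: "0 < \<eta>"
    and Z: "finite Z" "Z \<subseteq> M" and p: "p \<in> measurable \<B> (count_space Z)"
    and close: "AE x in \<nu>. d (p x) x \<le> \<eta> / 2"
  shows "\<W> (push g \<nu>) (push g \<nu>')
    \<le> (\<Sum>z\<in>Z. measure \<nu> (p -` {z} \<inter> M) * mset_diam d (act g ` mcball z \<eta>))
      + 2 * K / \<eta> * \<W> \<nu> \<nu>'" (is "?W \<le> ?S + _ * ?w")
proof (rule field_le_epsilon)
  fix e :: real assume "0 < e"
  then have e': "0 < e / (2 * K / \<eta>)" using K_pos \<eta> by simp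
  obtain \<kappa> where \<kappa>: "\<kappa> \<in> couplings M d \<nu> \<nu>'" "(LINT w|\<kappa>. d (fst w) (snd w)) < ?w + e / (2 * K / \<eta>)"
    using obtain_coupling[OF \<nu> e'] by blast
  note c = couplingD[OF \<kappa>(1)] and sp = coupling_space[OF \<kappa>(1)]
  interpret k: prob_space \<kappa> by (rule c(1))
  let ?f = "\<lambda>z. mset_diam d (act g ` mcball z \<eta>)"
  let ?P = "\<lambda>z. p -` {z} \<inter> M"
  have P: "?P z \<in> sets \<B>" if "z \<in> Z" for z
    using measurable_sets[OF p, of "{z}"] that by simp
  have ind: "integrable \<kappa> (\<lambda>w. ?f z * indicator (?P z) (fst w))" if "z \<in> Z" for z
    using P[OF that] measurable_compose[OF c(2) borel_measurable_indicator[OF P[OF that]]]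
    by (intro integrable_mult_right k.integrable_const_bound[of _ 1]) auto
  have mP: "(LINT w|\<kappa>. indicator (?P z) (fst w)) = measure \<nu> (?P z)" if "z \<in> Z" for z
  proof -
    have "(LINT w|\<kappa>. indicator (?P z) (fst w)) = (LINT x|distr \<kappa> \<B> fst. indicator (?P z) x :: real)"
      by (rule integral_distr[symmetric, OF c(2) borel_measurable_indicator[OF P[OF that]]])
    also have "\<dots> = measure \<nu> (?P z)" using \<nu>(1) P[OF that]
      by (simp add: c(4) mem_prob_measures Int_absorb1 space_prob_measures[OF \<nu>(1)])
    finally show ?thesis .
  qed
  have "AE w in \<kappa>. d (p (fst w)) (fst w) \<le> \<eta> / 2"
    using close unfolding c(4)[symmetric] by (rule AE_distrD[OF c(2)])
  have "?W \<le> (LINT w|\<kappa>. d (act g (fst w)) (act g (snd w)))" by (rule wasserstein_measure_action_le[OF \<kappa>(1)])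
  also have "\<dots> \<le> (LINT w|\<kappa>. (\<Sum>z\<in>Z. ?f z * indicator (?P z) (fst w)) + 2 * K / \<eta> * d (fst w) (snd w))"
  proof (rule integral_mono_AE)
    show "integrable \<kappa> (\<lambda>w. d (act g (fst w)) (act g (snd w)))"
      by (intro integrable_dist c measurable_compose[OF c(2) act_measurable] measurable_compose[OF c(3) act_measurable])
    show "integrable \<kappa> (\<lambda>w. (\<Sum>z\<in>Z. ?f z * indicator (?P z) (fst w)) + 2 * K / \<eta> * d (fst w) (snd w))"
      by (intro Bochner_Integration.integrable_add Bochner_Integration.integrable_sum integrable_mult_right ind integrable_dist c)
    have "AE w in \<kappa>. w \<in> space \<kappa>" by (rule AE_space)
    with \<open>AE w in \<kappa>. d (p (fst w)) (fst w) \<le> \<eta> / 2\<close>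
    show "AE w in \<kappa>. d (act g (fst w)) (act g (snd w))
      \<le> (\<Sum>z\<in>Z. ?f z * indicator (?P z) (fst w)) + 2 * K / \<eta> * d (fst w) (snd w)"
    proof eventually_elim
      case (elim w)
      define x y where "x = fst w" and "y = snd w"
      have xy: "x \<in> M" "y \<in> M" using elim(2) by (auto simp: sp x_def y_def)
      have px: "p x \<in> Z" using measurable_space[OF p] xy by simp
      then have pM: "p x \<in> M" using Z by auto
      have "(\<Sum>z\<in>Z. ?f z * indicator (?P z) x) = (\<Sum>z\<in>Z. if z = p x then ?f z else 0)"
        using xy by (intro sum.cong) (auto simp: indicator_def)
      also have "\<dots> = ?f (p x)" using px Z(1) by simp
      finally have sum: "(\<Sum>z\<in>Z. ?f z * indicator (?P z) x) = ?f (p x)" .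
      have "d (act g x) (act g y) \<le> ?f (p x) + 2 * K / \<eta> * d x y"
      proof (cases "d x y \<le> \<eta> / 2")
        case True
        have px2: "d (p x) x \<le> \<eta> / 2" using elim(1) by (simp add: x_def)
        moreover have "d (p x) y \<le> d (p x) x + d x y" using xy pM by (intro triangle)
        ultimately have "x \<in> mcball (p x) \<eta>" "y \<in> mcball (p x) \<eta>" using True xy pM \<eta> by auto
        then have "d (act g x) (act g y) \<le> ?f (p x)"
          using mcball_subset_mspace by (intro mset_diam_upper image_subset) auto
        moreover have "0 \<le> 2 * K / \<eta> * d x y" using K_pos \<eta> nonneg by simp
        ultimately show ?thesis by linarith
      next
        case False
        have "K = 2 * K / \<eta> * (\<eta> / 2)" using \<eta> by simp
        also have "\<dots> \<le> 2 * K / \<eta> * d x y" using False K_pos \<eta> by (intro mult_left_mono) auto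
        finally have "K \<le> 2 * K / \<eta> * d x y" .
        moreover have "0 \<le> ?f (p x)" using pM \<eta> mcball_eq_empty[of "p x" \<eta>] by (intro mset_diam_nonneg image_subset mcball_subset_mspace) auto
        moreover have "d (act g x) (act g y) \<le> K" using xy by (intro le_K) auto
        ultimately show ?thesis by linarith
      qed
      then show ?case using sum by (simp only: x_def y_def)
    qed
  qed
  also have "\<dots> = (LINT w|\<kappa>. (\<Sum>z\<in>Z. ?f z * indicator (?P z) (fst w))) + (LINT w|\<kappa>. 2 * K / \<eta> * d (fst w) (snd w))"
    by (intro Bochner_Integration.integral_add Bochner_Integration.integrable_sum integrable_mult_right ind integrable_dist c)
  also have "(LINT w|\<kappa>. (\<Sum>z\<in>Z. ?f z * indicator (?P z) (fst w))) = (\<Sum>z\<in>Z. LINT w|\<kappa>. ?f z * indicator (?P z) (fst w))"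
    by (rule Bochner_Integration.integral_sum) (rule ind)
  also have "\<dots> = ?S"
    by (intro sum.cong refl) (simp add: mP)
  also have "(LINT w|\<kappa>. 2 * K / \<eta> * d (fst w) (snd w)) = 2 * K / \<eta> * (LINT w|\<kappa>. d (fst w) (snd w))"
    by (rule integral_mult_right_zero)
  also have "\<dots> \<le> 2 * K / \<eta> * (?w + e / (2 * K / \<eta>))" using \<kappa>(2) K_pos \<eta> by (intro mult_left_mono) auto
  also have "\<dots> = 2 * K / \<eta> * ?w + e" using K_pos \<eta> by (simp add: distrib_left)
  finally show "?W \<le> ?S + 2 * K / \<eta> * ?w + e" by simp
qed

text \<open>
  The masses of the cells of \<open>p\<close> add up to one, so the bound is, up to a small error, a convex
  combination of average diameters of small balls around the net points.
\<close>

lemma diam_mean_point_measure: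
  assumes \<nu>: "\<nu> \<in> \<P>"
    and net: "\<And>e. 0 < e \<Longrightarrow> \<exists>\<eta> Z p. 0 < \<eta> \<and> finite Z \<and> Z \<subseteq> M \<and> p \<in> measurable \<B> (count_space Z) \<and>
      (AE x in \<nu>. d (p x) x \<le> \<eta> / 2) \<and>
      (\<forall>z\<in>Z. \<forall>F. folner \<mu> F \<longrightarrow> (\<forall>\<^sub>F n in sequentially. avg_diam (F n) (mcball z \<eta>) < e))"
  shows "diam_mean_equicontinuity_point \<mu> \<P> \<W> push \<nu>"
proof (rule PM.diam_mean_pointI[OF \<nu>])
  fix e :: real assume e: "0 < e"
  then have "0 < e / 2" by simp
  from net[OF this] obtain \<eta> Z p where \<eta>: "0 < \<eta>" and Z: "finite Z" "Z \<subseteq> M" and p: "p \<in> measurable \<B> (count_space Z)"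
    and close: "AE x in \<nu>. d (p x) x \<le> \<eta> / 2"
    and small: "\<And>z F. z \<in> Z \<Longrightarrow> folner \<mu> F \<Longrightarrow> \<forall>\<^sub>F n in sequentially. avg_diam (F n) (mcball z \<eta>) < e / 2"
    by blast
  define \<delta> where "\<delta> = e * \<eta> / (8 * K)"
  have \<delta>: "0 < \<delta>" "2 * K / \<eta> * \<delta> = e / 4" using e \<eta> K_pos by (simp_all add: \<delta>_def)
  define w where "w z = measure \<nu> (p -` {z} \<inter> M)" for z
  interpret N: prob_space \<nu> using \<nu> by (simp add: mem_prob_measures)
  have P: "p -` {z} \<inter> M \<in> sets \<nu>" if "z \<in> Z" for z
    using measurable_sets[OF p, of "{z}"] that \<nu> by (simp add: mem_prob_measures)
  have "(\<Sum>z\<in>Z. w z) = measure \<nu> (\<Union>z\<in>Z. p -` {z} \<inter> M)"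
    unfolding w_def using Z P by (intro N.finite_measure_finite_Union[symmetric]) (auto simp: disjoint_family_on_def)
  then have w_sum: "(\<Sum>z\<in>Z. w z) \<le> 1" by simp
  let ?f = "\<lambda>g z. mset_diam d (act g ` mcball z \<eta>)"
  have ne: "mcball z \<eta> \<noteq> {}" if "z \<in> Z" for z using that Z \<eta> by (auto simp: mcball_eq_empty)
  let ?R = "\<lambda>g. (\<Sum>z\<in>Z. w z * ?f g z) + e / 4"
  have le: "\<W> (push g \<nu>) (push g \<nu>') \<le> ?R g"
    if \<nu>': "\<nu>' \<in> \<P>" "\<W> \<nu> \<nu>' \<le> \<delta>" for g \<nu>'
  proof -
    have "\<W> (push g \<nu>) (push g \<nu>')
      \<le> (\<Sum>z\<in>Z. w z * ?f g z) + 2 * K / \<eta> * \<W> \<nu> \<nu>'"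
      unfolding w_def by (rule wasserstein_action_le_sum_diam[OF \<nu> \<nu>'(1) \<eta> Z p close])
    also have "2 * K / \<eta> * \<W> \<nu> \<nu>' \<le> 2 * K / \<eta> * \<delta>"
      using \<nu>'(2) K_pos \<eta> by (intro mult_left_mono) auto
    finally show ?thesis using \<delta>(2) by simp
  qed
  have avg: "(\<forall>n. integrable (unif (F n)) ?R) \<and> (\<forall>\<^sub>F n in sequentially. (LINT g|unif (F n). ?R g) < e)"
    if F: "folner \<mu> F" for F
  proof
    have int: "integrable (unif (F n)) (\<lambda>g. ?f g z)" if "z \<in> Z" for z n
      by (intro integrable_diam_orbit F mcball_subset_mspace ne that)
    have int_sum: "integrable (unif (F n)) (\<lambda>g. \<Sum>z\<in>Z. w z * ?f g z)" for n
      by (intro Bochner_Integration.integrable_sum integrable_mult_right int)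
    have const: "integrable (unif (F n)) (\<lambda>g. e / 4)" for n
      using prob_space_unif[OF F, of n] by (intro finite_measure.integrable_const) (simp add: prob_space_def)
    show "\<forall>n. integrable (unif (F n)) ?R"
      by (intro allI Bochner_Integration.integrable_add int_sum const)
    have "\<forall>\<^sub>F n in sequentially. \<forall>z\<in>Z. avg_diam (F n) (mcball z \<eta>) < e / 2"
      using small F by (intro eventually_ball_finite Z) auto
    then show "\<forall>\<^sub>F n in sequentially. (LINT g|unif (F n). ?R g) < e"
    proof eventually_elim
      case (elim n)
      interpret U: prob_space "unif (F n)" by (rule prob_space_unif[OF F])
      have "(LINT g|unif (F n). ?R g) = (LINT g|unif (F n). (\<Sum>z\<in>Z. w z * ?f g z)) + (LINT g|unif (F n). e / 4)"
        by (rule Bochner_Integration.integral_add[OF int_sum const])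
      also have "(LINT g|unif (F n). e / 4) = e / 4" unfolding lebesgue_integral_const U.prob_space by simp
      also have "(LINT g|unif (F n). (\<Sum>z\<in>Z. w z * ?f g z)) = (\<Sum>z\<in>Z. LINT g|unif (F n). w z * ?f g z)"
        by (intro Bochner_Integration.integral_sum integrable_mult_right int)
      also have "\<dots> = (\<Sum>z\<in>Z. w z * avg_diam (F n) (mcball z \<eta>))"
        unfolding avg_diam_def by (intro sum.cong refl integral_mult_right_zero)
      also have "\<dots> \<le> (\<Sum>z\<in>Z. w z * (e / 2))"
        using elim by (intro sum_mono mult_left_mono) (auto simp: w_def intro: less_imp_le)
      also have "\<dots> = (\<Sum>z\<in>Z. w z) * (e / 2)" by (simp add: sum_distrib_right)
      also have "\<dots> \<le> 1 * (e / 2)" using w_sum e by (intro mult_right_mono) auto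
      finally show ?case using e by simp
    qed
  qed
  show "\<exists>\<delta> R. 0 < \<delta> \<and> (\<forall>g. \<forall>\<nu>'\<in>\<P>. \<W> \<nu> \<nu>' \<le> \<delta> \<longrightarrow>
        \<W> (push g \<nu>) (push g \<nu>') \<le> R g) \<and>
      (\<forall>F. folner \<mu> F \<longrightarrow> (\<forall>n. integrable (unif (F n)) R) \<and> (\<forall>\<^sub>F n in sequentially. (LINT g|unif (F n). R g) < e))"
    using \<delta>(1) le avg by (intro exI[of _ \<delta>] exI[of _ ?R]) auto
qed

text \<open>
  A Lebesgue number turns diam-mean equicontinuity at every point into one radius \<open>\<eta>\<close> that serves
  all net points.
\<close>

lemma diam_mean_imp_diam_mean_of_measures:
  assumes "diam_mean_equicontinuous \<mu> M d act"
  shows "diam_mean_equicontinuous \<mu> \<P> \<W> push"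
  unfolding diam_mean_equicontinuous_def
proof
  fix \<nu> assume \<nu>: "\<nu> \<in> \<P>"
  show "diam_mean_equicontinuity_point \<mu> \<P> \<W> push \<nu>"
  proof (rule diam_mean_point_measure[OF \<nu>])
    fix e :: real assume e: "0 < e"
    have "\<forall>x\<in>M. \<exists>\<delta>>0. \<forall>F. folner \<mu> F \<longrightarrow> (\<forall>\<^sub>F n in sequentially. avg_diam (F n) (mcball x \<delta>) < e)"
      using assms e diam_mean_point_iff unfolding diam_mean_equicontinuous_def by meson
    then obtain r where r: "\<And>x. x \<in> M \<Longrightarrow> 0 < r x"
      "\<And>x F. x \<in> M \<Longrightarrow> folner \<mu> F \<Longrightarrow> \<forall>\<^sub>F n in sequentially. avg_diam (F n) (mcball x (r x)) < e"
      by metis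
    obtain \<eta> where \<eta>: "0 < \<eta>" "\<And>x. x \<in> M \<Longrightarrow> \<exists>z\<in>M. mcball x \<eta> \<subseteq> mcball z (r z)"
      using uniform_radius[of r] r(1) by blast
    have "0 < \<eta> / 2" using \<eta> by simp
    then obtain Z p where Z: "finite Z" "Z \<subseteq> M" "p \<in> measurable \<B> (count_space Z)"
      and close: "\<And>x. x \<in> M \<Longrightarrow> d x (p x) < \<eta> / 2"
      using finite_net_map[OF subset_refl self_dense] by metis
    have "AE x in \<nu>. d (p x) x \<le> \<eta> / 2"
      using close space_prob_measures[OF \<nu>] by (auto intro!: AE_I2 less_imp_le simp: commute)
    moreover have "\<forall>\<^sub>F n in sequentially. avg_diam (F n) (mcball z \<eta>) < e" if z: "z \<in> Z" and F: "folner \<mu> F" for z F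
    proof -
      have zM: "z \<in> M" using z Z by auto
      obtain z' where z': "z' \<in> M" "mcball z \<eta> \<subseteq> mcball z' (r z')" using \<eta>(2)[OF zM] by blast
      have "avg_diam (F n) (mcball z \<eta>) \<le> avg_diam (F n) (mcball z' (r z'))" for n
        using zM \<eta>(1) z' by (intro avg_diam_mono F mcball_subset_mspace) (auto simp: mcball_eq_empty)
      then show ?thesis by (rule eventually_le_less[OF r(2)[OF z'(1) F]])
    qed
    ultimately show "\<exists>\<eta> Z p. 0 < \<eta> \<and> finite Z \<and> Z \<subseteq> M \<and> p \<in> measurable \<B> (count_space Z) \<and>
      (AE x in \<nu>. d (p x) x \<le> \<eta> / 2) \<and>
      (\<forall>z\<in>Z. \<forall>F. folner \<mu> F \<longrightarrow> (\<forall>\<^sub>F n in sequentially. avg_diam (F n) (mcball z \<eta>) < e))"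
      using \<eta>(1) Z by blast
  qed
qed

lemma common_radius:
  assumes S: "finite S" "S \<subseteq> M" and pt: "\<And>x. x \<in> S \<Longrightarrow> diam_mean_equicontinuity_point \<mu> M d act x"
    and e: "0 < e"
  obtains \<eta> where "0 < \<eta>" "\<And>x F \<delta>. x \<in> S \<Longrightarrow> folner \<mu> F \<Longrightarrow> 0 < \<delta> \<Longrightarrow> \<delta> \<le> \<eta> \<Longrightarrow>
    \<forall>\<^sub>F n in sequentially. avg_diam (F n) (mcball x \<delta>) < e"
proof -
  have "\<forall>x\<in>S. \<exists>\<delta>>0. \<forall>F. folner \<mu> F \<longrightarrow> (\<forall>\<^sub>F n in sequentially. avg_diam (F n) (mcball x \<delta>) < e)"
    using pt diam_mean_point_iff S(2) e by (meson subsetD)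
  then obtain r where r: "\<And>x. x \<in> S \<Longrightarrow> 0 < r x"
      "\<And>x F. x \<in> S \<Longrightarrow> folner \<mu> F \<Longrightarrow> \<forall>\<^sub>F n in sequentially. avg_diam (F n) (mcball x (r x)) < e"
    by metis
  define \<eta> where "\<eta> = Min (insert 1 (r ` S))"
  have \<eta>: "0 < \<eta>" "\<And>x. x \<in> S \<Longrightarrow> \<eta> \<le> r x" using S(1) r(1) by (auto simp: \<eta>_def)
  show ?thesis
  proof (rule that[OF \<eta>(1)])
    fix x F \<delta> assume x: "x \<in> S" and F: "folner \<mu> F" and \<delta>: "0 < \<delta>" "\<delta> \<le> \<eta>"
    have le: "avg_diam (F n) (mcball x \<delta>) \<le> avg_diam (F n) (mcball x (r x))" for n
    proof (rule avg_diam_mono[OF F])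
      show "mcball x \<delta> \<noteq> {}" using x S(2) \<delta> by (auto simp: mcball_eq_empty)
      show "mcball x \<delta> \<subseteq> mcball x (r x)" using \<delta>(2) \<eta>(2)[OF x] by (intro mcball_subset_concentric) simp
    qed (rule mcball_subset_mspace)
    show "\<forall>\<^sub>F n in sequentially. avg_diam (F n) (mcball x \<delta>) < e"
      by (rule eventually_le_less[OF r(2)[OF x F] le])
  qed
qed

text \<open>
  Rounding to a net of diam-mean equicontinuity points moves a measure by little, and produces a
  measure carried by finitely many such points.
\<close>

lemma almost_diam_mean_measures:
  assumes "almost_diam_mean_equicontinuous \<mu> M d act"
  shows "almost_diam_mean_equicontinuous \<mu> \<P> \<W> push"
  unfolding PM.almost_diam_mean_iff
proof (intro ballI allI impI)
  define D where "D = {x \<in> M. diam_mean_equicontinuity_point \<mu> M d act x}"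
  have D: "D \<subseteq> M" "\<And>x r. x \<in> M \<Longrightarrow> 0 < r \<Longrightarrow> \<exists>y\<in>D. d x y < r"
    using assms unfolding almost_diam_mean_iff D_def by auto
  fix \<nu> and r :: real assume \<nu>: "\<nu> \<in> \<P>" and r: "0 < r"
  have r2: "0 < r / 2" using r by simp
  obtain Z p where Z: "finite Z" "Z \<subseteq> D" and p: "p \<in> measurable \<B> (count_space Z)"
    and close: "\<And>x. x \<in> M \<Longrightarrow> d x (p x) < r / 2"
    using finite_net_map[OF D r2] by metis
  have ZM: "Z \<subseteq> M" using Z D(1) by auto
  have pm: "p \<in> measurable \<B> \<B>" by (rule net_map_measurable[OF p ZM])
  have pZ: "p x \<in> Z" if "x \<in> M" for x using measurable_space[OF p] that by simp
  obtain z0 where z0: "z0 \<in> Z" using pZ nonempty by blast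
  interpret N: prob_space \<nu> using \<nu> by (simp add: mem_prob_measures)
  have s: "sets \<nu> = sets \<B>" using \<nu> by (simp add: mem_prob_measures)
  have pm': "p \<in> measurable \<nu> \<B>" "(\<lambda>x. x) \<in> measurable \<nu> \<B>" using pm by (simp_all add: measurable_cong_sets[OF s refl])
  define \<nu>' where "\<nu>' = distr \<nu> \<B> p"
  have \<nu>': "\<nu>' \<in> \<P>" unfolding \<nu>'_def by (intro distr_mem_prob_measures pm' N.prob_space_axioms)
  have "distr \<nu> \<B> (\<lambda>x. x) = \<nu>" by (rule distr_id2) (simp add: s)
  then have "\<W> \<nu> \<nu>' \<le> (LINT x|\<nu>. d x (p x))"
    using wasserstein_distr_le[OF N.prob_space_axioms pm'(2,1)] by (simp add: \<nu>'_def)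
  also have "\<dots> \<le> (LINT x|\<nu>. r / 2)"
    using close space_prob_measures[OF \<nu>]
    by (intro integral_mono integrable_dist N.prob_space_axioms pm') (auto intro: less_imp_le)
  also have "\<dots> < r" using r by (simp add: N.prob_space)
  finally have near: "\<W> \<nu> \<nu>' < r" .
  have "diam_mean_equicontinuity_point \<mu> \<P> \<W> push \<nu>'"
  proof (rule diam_mean_point_measure[OF \<nu>'])
    fix e :: real assume e: "0 < e"
    have pt: "diam_mean_equicontinuity_point \<mu> M d act z" if "z \<in> Z" for z using that Z(2) by (auto simp: D_def)
    obtain \<eta> where \<eta>: "0 < \<eta>" "\<And>x F \<delta>. x \<in> Z \<Longrightarrow> folner \<mu> F \<Longrightarrow> 0 < \<delta> \<Longrightarrow> \<delta> \<le> \<eta> \<Longrightarrow>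
      \<forall>\<^sub>F n in sequentially. avg_diam (F n) (mcball x \<delta>) < e"
      using common_radius[OF Z(1) ZM pt e] by metis
\<comment> \<open>The identity on the support, and an arbitrary net value elsewhere to stay finite-valued.\<close>
    define q where "q x = (if x \<in> Z then x else z0)" for x
    have ZB: "Z \<in> sets \<B>" using sets_mborel_finite[OF Z(1) ZM] .
    have q: "q \<in> measurable \<B> (count_space Z)"
      unfolding measurable_count_space_eq2[OF Z(1)]
    proof (intro conjI ballI funcsetI)
      fix z assume z: "z \<in> Z"
      have "q -` {z} \<inter> space \<B> = (if z = z0 then {z} \<union> (M - Z) else {z})"
        using z z0 ZM by (auto simp: q_def split: if_splits)
      moreover have "{z} \<in> sets \<B>" using z ZM by (intro sets_mborel_singleton) auto
      moreover have "M - Z \<in> sets \<B>" using sets.compl_sets[OF ZB] by simp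
      ultimately show "q -` {z} \<inter> space \<B> \<in> sets \<B>" by (simp only: sets.Un split: if_split) blast
    qed (use z0 in \<open>auto simp: q_def\<close>)
    have "{x \<in> space \<B>. x \<in> Z} = Z" using ZM by auto
    then have "{x \<in> space \<B>. x \<in> Z} \<in> sets \<B>" using ZB by (simp only:)
    moreover have "AE x in \<nu>. p x \<in> Z" using pZ space_prob_measures[OF \<nu>] by (intro AE_I2) simp
    ultimately have "AE x in \<nu>'. x \<in> Z"
      unfolding \<nu>'_def by (simp only: AE_distr_iff[OF pm'(1)])
    then have "AE x in \<nu>'. d (q x) x \<le> \<eta> / 2"
      by eventually_elim (use ZM \<eta>(1) in \<open>auto simp: q_def\<close>)
    moreover have "\<forall>z\<in>Z. \<forall>F. folner \<mu> F \<longrightarrow> (\<forall>\<^sub>F n in sequentially. avg_diam (F n) (mcball z \<eta>) < e)"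
      using \<eta>(2)[OF _ _ \<eta>(1) order_refl] by blast
    ultimately show "\<exists>\<eta> Z p. 0 < \<eta> \<and> finite Z \<and> Z \<subseteq> M \<and> p \<in> measurable \<B> (count_space Z) \<and>
      (AE x in \<nu>'. d (p x) x \<le> \<eta> / 2) \<and>
      (\<forall>z\<in>Z. \<forall>F. folner \<mu> F \<longrightarrow> (\<forall>\<^sub>F n in sequentially. avg_diam (F n) (mcball z \<eta>) < e))"
      by (intro exI[of _ \<eta>] exI[of _ Z] exI[of _ q] conjI \<eta>(1) Z(1) ZM q)
  qed
  with near \<nu>' show "\<exists>\<nu>'\<in>\<P>. diam_mean_equicontinuity_point \<mu> \<P> \<W> push \<nu>' \<and> \<W> \<nu> \<nu>' < r"
    by blast
qed

end

section \<open>Equicontinuity of closed sets\<close>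

context compact_action
begin

lemma avg_dist_nested_le_emp_wasserstein:
  assumes F: "folner \<mu> F" and A: "A \<in> \<H>" and B: "B \<in> \<H>" and AB: "A \<subseteq> B"
    and Z: "finite Z" "Z \<subseteq> M" "\<And>x. x \<in> M \<Longrightarrow> \<exists>z\<in>Z. d x z \<le> e"
  shows "HY.avg_dist (F n) A B \<le> 2 * e + card Z * HY.emp_wasserstein (F n) A B"
proof -
  interpret U: prob_space "unif (F n)" by (rule prob_space_unif[OF F])
  let ?i = "\<lambda>z A g. infd z (set_action act g A)"
  have int: "integrable (unif (F n)) (?i z S)" if "z \<in> Z" "S \<in> \<H>" for z S
    using that Z(2) by (intro HY.integrable_lipschitz_orbit F infd_hausdorff_lipschitz) auto
  have int_diff: "integrable (unif (F n)) (\<lambda>g. ?i z A g - ?i z B g)" if "z \<in> Z" for z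
    by (intro Bochner_Integration.integrable_diff int that A B)
  have "HY.avg_dist (F n) A B \<le> (LINT g|unif (F n). 2 * e + (\<Sum>z\<in>Z. ?i z A g - ?i z B g))"
    unfolding HY.avg_dist_def
  proof (intro integral_mono HY.integrable_dist_orbit F A B Bochner_Integration.integrable_add
      U.integrable_const Bochner_Integration.integrable_sum int_diff)
    fix g
    show "dH (set_action act g A) (set_action act g B) \<le> 2 * e + (\<Sum>z\<in>Z. ?i z A g - ?i z B g)"
      unfolding set_action_def
      by (intro hausdorff_nested_le image_mem_hyperspace A B image_mono AB Z)
  qed
  also have "\<dots> = (LINT g|unif (F n). 2 * e) + (LINT g|unif (F n). (\<Sum>z\<in>Z. ?i z A g - ?i z B g))"
    by (intro Bochner_Integration.integral_add U.integrable_const Bochner_Integration.integrable_sum int_diff)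
  also have "(LINT g|unif (F n). 2 * e) = 2 * e" unfolding lebesgue_integral_const U.prob_space by simp
  also have "(LINT g|unif (F n). (\<Sum>z\<in>Z. ?i z A g - ?i z B g)) = (\<Sum>z\<in>Z. LINT g|unif (F n). ?i z A g - ?i z B g)"
    by (intro Bochner_Integration.integral_sum int_diff)
  also have "\<dots> \<le> (\<Sum>z\<in>Z. HY.emp_wasserstein (F n) A B)"
  proof (rule sum_mono)
    fix z assume z: "z \<in> Z"
    have "(LINT g|unif (F n). ?i z A g - ?i z B g) = (LINT g|unif (F n). ?i z A g) - (LINT g|unif (F n). ?i z B g)"
      by (intro Bochner_Integration.integral_diff int z A B)
    also have "\<dots> \<le> HY.emp_wasserstein (F n) A B"
      using z Z(2) by (intro HY.lipschitz_average_le_emp_wasserstein F A B infd_hausdorff_lipschitz) auto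
    finally show "(LINT g|unif (F n). ?i z A g - ?i z B g) \<le> HY.emp_wasserstein (F n) A B" .
  qed
  finally show ?thesis by simp
qed

text \<open>
  The number of net points enters as a factor. The net depends only on \<open>e\<close>, so it can be
  fixed before \<open>\<delta>\<close>.
\<close>

lemma weakly_mean_nested:
  assumes wm: "weakly_mean_equicontinuous \<mu> \<H> dH (set_action act)"
    and A: "A \<in> \<H>" and e: "0 < e"
  obtains \<delta> where "0 < \<delta>" "\<And>B F. B \<in> \<H> \<Longrightarrow> dH A B \<le> \<delta> \<Longrightarrow> A \<subseteq> B \<or> B \<subseteq> A \<Longrightarrow>
    folner \<mu> F \<Longrightarrow> \<forall>\<^sub>F n in sequentially. HY.avg_dist (F n) A B < e"
proof -
  have e4: "0 < e / 4" using e by simp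
  obtain Z p where Z: "finite Z" "Z \<subseteq> M" and p: "p \<in> measurable \<B> (count_space Z)"
    and close: "\<And>x. x \<in> M \<Longrightarrow> d x (p x) < e / 4"
    using finite_net_map[OF subset_refl self_dense e4] by metis
  have net: "\<exists>z\<in>Z. d x z \<le> e / 4" if "x \<in> M" for x
    using close[OF that] measurable_space[OF p, of x] that by (intro bexI[of _ "p x"]) auto
  define e' where "e' = e / (2 * (card Z + 1))"
  have e': "0 < e'" "card Z * e' < e / 2" using e by (simp_all add: e'_def field_simps)
  have "weak_mean_equicontinuity_point \<mu> \<H> dH (set_action act) A"
    using wm A by (simp add: weakly_mean_equicontinuous_def)
  then obtain \<delta> where \<delta>: "0 < \<delta>" "\<And>B F. B \<in> \<H> \<Longrightarrow> dH A B \<le> \<delta> \<Longrightarrow> folner \<mu> F \<Longrightarrow>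
    \<forall>\<^sub>F n in sequentially. HY.emp_wasserstein (F n) A B < e'"
    using e'(1) unfolding HY.weak_mean_point_iff[OF A] by meson
  show ?thesis
  proof (rule that[OF \<delta>(1)])
    fix B F assume B: "B \<in> \<H>" "dH A B \<le> \<delta>" and AB: "A \<subseteq> B \<or> B \<subseteq> A" and F: "folner \<mu> F"
    have *: "HY.avg_dist (F n) A B \<le> 2 * (e / 4) + card Z * HY.emp_wasserstein (F n) A B" for n
      using AB
    proof
      assume "A \<subseteq> B" then show ?thesis by (rule avg_dist_nested_le_emp_wasserstein[OF F A B(1) _ Z net])
    next
      assume "B \<subseteq> A"
      from avg_dist_nested_le_emp_wasserstein[OF F B(1) A this Z net, of n]
      show ?thesis by (simp add: HY.avg_dist_commute[of _ A B] HY.emp_wasserstein_commute[OF F A B(1)])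
    qed
    from \<delta>(2)[OF B F] show "\<forall>\<^sub>F n in sequentially. HY.avg_dist (F n) A B < e"
    proof eventually_elim
      case (elim n)
      have "card Z * HY.emp_wasserstein (F n) A B \<le> card Z * e'" using elim by (intro mult_left_mono) auto
      with *[of n] e'(2) show ?case by linarith
    qed
  qed
qed

text \<open>
  A point and a ball around it are nested, and their Hausdorff distance after translation bounds the
  displacement of every point of the ball.
\<close>

lemma weakly_mean_of_sets_imp_diam_mean:
  assumes wm: "weakly_mean_equicontinuous \<mu> \<H> dH (set_action act)"
  shows "diam_mean_equicontinuous \<mu> M d act"
  unfolding diam_mean_equicontinuous_def
proof
  fix x assume x: "x \<in> M"
  note sx = singleton_mem_hyperspace[OF x]
  show "diam_mean_equicontinuity_point \<mu> M d act x"
  proof (rule diam_mean_pointI[OF x])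
    fix e :: real assume e: "0 < e"
    obtain \<delta> where \<delta>: "0 < \<delta>" "\<And>B F. B \<in> \<H> \<Longrightarrow> dH {x} B \<le> \<delta> \<Longrightarrow> {x} \<subseteq> B \<or> B \<subseteq> {x} \<Longrightarrow>
      folner \<mu> F \<Longrightarrow> \<forall>\<^sub>F n in sequentially. HY.avg_dist (F n) {x} B < e"
      using weakly_mean_nested[OF wm sx e] by metis
    define B where "B = mcball x \<delta>"
    have B: "B \<in> \<H>" "{x} \<subseteq> B"
      using x \<delta>(1) by (auto simp: B_def mcball_mem_hyperspace)
    have "dH {x} B \<le> \<delta>"
    proof (rule hausdorff_le[OF sx B(1)])
      fix a assume "a \<in> {x}"
      then show "infd a B \<le> \<delta>" using B(2) x \<delta>(1) infd_le[of x B a] by simp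
    next
      fix b assume "b \<in> B"
      then show "infd b {x} \<le> \<delta>" by (simp add: B_def commute)
    qed
    then have ev: "\<forall>\<^sub>F n in sequentially. HY.avg_dist (F n) {x} B < e" if "folner \<mu> F" for F
      using \<delta>(2) B that by blast
    let ?R = "\<lambda>g. dH (set_action act g {x}) (set_action act g B)"
    have le: "d (act g x) (act g y) \<le> ?R g" if "y \<in> M" "d x y \<le> \<delta>" for g y
    proof -
      have "act g y \<in> act g ` B" using that x by (auto simp: B_def)
      from infd_le_hausdorff'[OF image_mem_hyperspace[OF sx] image_mem_hyperspace[OF B(1)] this]
      show ?thesis by (simp add: set_action_def commute)
    qed
    show "\<exists>\<delta> R. 0 < \<delta> \<and> (\<forall>g. \<forall>y\<in>M. d x y \<le> \<delta> \<longrightarrow> d (act g x) (act g y) \<le> R g) \<and>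
      (\<forall>F. folner \<mu> F \<longrightarrow> (\<forall>n. integrable (unif (F n)) R) \<and> (\<forall>\<^sub>F n in sequentially. (LINT g|unif (F n). R g) < e))"
      using \<delta>(1) le ev HY.integrable_dist_orbit[OF _ sx B(1)]
      by (intro exI[of _ \<delta>] exI[of _ ?R]) (auto simp: HY.avg_dist_def)
  qed
qed

lemma infd_action_le_sum_diam:
  assumes S: "finite S" "S \<subseteq> M" and \<eta>: "0 < \<eta>" and a: "a \<in> S" and y: "y \<in> M" "d a y \<le> \<eta>"
  shows "d (act g a) (act g y) \<le> (\<Sum>a\<in>S. mset_diam d (act g ` mcball a \<eta>))"
proof -
  have aM: "a \<in> M" using a S by auto
  have "d (act g a) (act g y) \<le> mset_diam d (act g ` mcball a \<eta>)"
    using aM y \<eta> by (intro mset_diam_upper image_subset mcball_subset_mspace) auto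
  also have "\<dots> \<le> (\<Sum>a\<in>S. mset_diam d (act g ` mcball a \<eta>))"
  proof (rule member_le_sum[OF a _ S(1)])
    fix b assume "b \<in> S - {a}"
    then show "0 \<le> mset_diam d (act g ` mcball b \<eta>)"
      using S(2) \<eta> mcball_eq_empty[of b \<eta>] by (intro mset_diam_nonneg image_subset mcball_subset_mspace) auto
  qed
  finally show ?thesis .
qed

lemma sum_diam_average:
  assumes S: "finite S" "S \<subseteq> M" and pt: "\<And>x. x \<in> S \<Longrightarrow> diam_mean_equicontinuity_point \<mu> M d act x"
    and e: "0 < e"
  obtains \<eta> where "0 < \<eta>" "\<And>\<delta> F n. 0 < \<delta> \<Longrightarrow> \<delta> \<le> \<eta> \<Longrightarrow> folner \<mu> F \<Longrightarrow>
      integrable (unif (F n)) (\<lambda>g. \<Sum>a\<in>S. mset_diam d (act g ` mcball a \<delta>))"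
    "\<And>\<delta> F. 0 < \<delta> \<Longrightarrow> \<delta> \<le> \<eta> \<Longrightarrow> folner \<mu> F \<Longrightarrow>
      \<forall>\<^sub>F n in sequentially. (LINT g|unif (F n). (\<Sum>a\<in>S. mset_diam d (act g ` mcball a \<delta>))) < e"
proof -
  define e' where "e' = e / (card S + 1)"
  have e': "0 < e'" "card S * e' < e" using e by (simp_all add: e'_def field_simps)
  obtain \<eta> where \<eta>: "0 < \<eta>" "\<And>x F \<delta>. x \<in> S \<Longrightarrow> folner \<mu> F \<Longrightarrow> 0 < \<delta> \<Longrightarrow> \<delta> \<le> \<eta> \<Longrightarrow>
    \<forall>\<^sub>F n in sequentially. avg_diam (F n) (mcball x \<delta>) < e'"
    using common_radius[OF S pt e'(1)] by blast
  have int: "integrable (unif (F n)) (\<lambda>g. mset_diam d (act g ` mcball a \<delta>))"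
    if "0 < \<delta>" "folner \<mu> F" "a \<in> S" for \<delta> F n a
    using that S(2) mcball_eq_empty[of a \<delta>] by (intro integrable_diam_orbit mcball_subset_mspace) auto
  show ?thesis
  proof (rule that[OF \<eta>(1)])
    fix \<delta> F assume \<delta>: "0 < \<delta>" "\<delta> \<le> \<eta>" and F: "folner \<mu> F"
    show "integrable (unif (F n)) (\<lambda>g. \<Sum>a\<in>S. mset_diam d (act g ` mcball a \<delta>))" for n
      by (intro Bochner_Integration.integrable_sum int \<delta> F)
    have "\<forall>\<^sub>F n in sequentially. \<forall>a\<in>S. avg_diam (F n) (mcball a \<delta>) < e'"
      using \<eta>(2)[OF _ F \<delta>] by (intro eventually_ball_finite S) auto
    then show "\<forall>\<^sub>F n in sequentially. (LINT g|unif (F n). (\<Sum>a\<in>S. mset_diam d (act g ` mcball a \<delta>))) < e"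
    proof eventually_elim
      case (elim n)
      have "(LINT g|unif (F n). (\<Sum>a\<in>S. mset_diam d (act g ` mcball a \<delta>))) = (\<Sum>a\<in>S. avg_diam (F n) (mcball a \<delta>))"
        unfolding avg_diam_def by (intro Bochner_Integration.integral_sum int \<delta> F)
      also have "\<dots> \<le> (\<Sum>a\<in>S. e')" using elim by (intro sum_mono) (auto intro: less_imp_le)
      finally show ?case using e'(2) by simp
    qed
  qed
qed

text \<open>
  A set near a finite set \<open>S\<close> has each of its points near a point of \<open>S\<close>, and conversely.
  The displacement is thus bounded by the largest, and hence by the sum, of the diameters of the
  translated balls around the points of \<open>S\<close>.
\<close>

lemma diam_mean_point_finite_set:
  assumes S: "finite S" "S \<subseteq> M" "S \<noteq> {}" and pt: "\<And>x. x \<in> S \<Longrightarrow> diam_mean_equicontinuity_point \<mu> M d act x"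
  shows "diam_mean_equicontinuity_point \<mu> \<H> dH (set_action act) S"
proof (rule HY.diam_mean_pointI)
  show SH: "S \<in> \<H>" by (rule finite_mem_hyperspace[OF S])
  fix e :: real assume e: "0 < e"
  obtain \<eta> where \<eta>: "0 < \<eta>" and int: "\<And>F n. folner \<mu> F \<Longrightarrow>
      integrable (unif (F n)) (\<lambda>g. \<Sum>a\<in>S. mset_diam d (act g ` mcball a \<eta>))"
    and small: "\<And>F. folner \<mu> F \<Longrightarrow>
      \<forall>\<^sub>F n in sequentially. (LINT g|unif (F n). (\<Sum>a\<in>S. mset_diam d (act g ` mcball a \<eta>))) < e"
    using sum_diam_average[OF S(1,2) pt e] by (metis order_refl)
  let ?R = "\<lambda>g. \<Sum>a\<in>S. mset_diam d (act g ` mcball a \<eta>)"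
  have le: "dH (set_action act g S) (set_action act g A) \<le> ?R g"
    if A: "A \<in> \<H>" and near: "dH S A \<le> \<eta> / 2" for g A
    unfolding set_action_def
  proof (rule hausdorff_le[OF image_mem_hyperspace[OF SH] image_mem_hyperspace[OF A]])
    fix u assume "u \<in> act g ` S"
    then obtain s where s: "s \<in> S" "u = act g s" by auto
    have "infd s A \<le> \<eta> / 2" using infd_le_hausdorff[OF SH A s(1)] near by simp
    then obtain a where a: "a \<in> A" "d s a \<le> \<eta>" "a \<in> M" using infd_le_halfD[OF A _ \<eta>] by blast
    have "infd u (act g ` A) \<le> d u (act g a)" using a by (intro infd_le) auto
    also have "\<dots> \<le> ?R g" unfolding s(2) by (rule infd_action_le_sum_diam[OF S(1,2) \<eta> s(1) a(3,2)])
    finally show "infd u (act g ` A) \<le> ?R g" .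
  next
    fix u assume "u \<in> act g ` A"
    then obtain a where a: "a \<in> A" "u = act g a" by auto
    then have aM: "a \<in> M" using hyperspaceD(2)[OF A] by auto
    have "infd a S \<le> \<eta> / 2" using infd_le_hausdorff'[OF SH A a(1)] near by simp
    then obtain s where s: "s \<in> S" "d a s \<le> \<eta>" using infd_le_halfD[OF SH _ \<eta>] by blast
    have "infd u (act g ` S) \<le> d u (act g s)" using s by (intro infd_le) auto
    also have "\<dots> = d (act g s) (act g a)" unfolding a(2) by (rule commute)
    also have "\<dots> \<le> ?R g" using s(2) by (intro infd_action_le_sum_diam[OF S(1,2) \<eta> s(1) aM]) (simp add: commute)
    finally show "infd u (act g ` S) \<le> ?R g" .
  qed
  show "\<exists>\<delta> R. 0 < \<delta> \<and> (\<forall>g. \<forall>A\<in>\<H>. dH S A \<le> \<delta> \<longrightarrow>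
        dH (set_action act g S) (set_action act g A) \<le> R g) \<and>
      (\<forall>F. folner \<mu> F \<longrightarrow> (\<forall>n. integrable (unif (F n)) R) \<and> (\<forall>\<^sub>F n in sequentially. (LINT g|unif (F n). R g) < e))"
    using \<eta> le int small by (intro exI[of _ "\<eta> / 2"] exI[of _ ?R]) auto
qed

lemma almost_diam_mean_sets:
  assumes "almost_diam_mean_equicontinuous \<mu> M d act"
  shows "almost_diam_mean_equicontinuous \<mu> \<H> dH (set_action act)"
  unfolding HY.almost_diam_mean_iff
proof (intro ballI allI impI)
  define D where "D = {x \<in> M. diam_mean_equicontinuity_point \<mu> M d act x}"
  have D: "D \<subseteq> M" "\<And>x r. x \<in> M \<Longrightarrow> 0 < r \<Longrightarrow> \<exists>y\<in>D. d x y < r"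
    using assms unfolding almost_diam_mean_iff D_def by auto
  fix A and r :: real assume A: "A \<in> \<H>" and r: "0 < r"
  obtain S where S: "finite S" "S \<subseteq> D" "S \<in> \<H>" "dH A S < r"
    using finite_subset_approx[OF D r A] by metis
  have "diam_mean_equicontinuity_point \<mu> \<H> dH (set_action act) S"
    using S(2) hyperspaceD[OF S(3)] by (intro diam_mean_point_finite_set S(1)) (auto simp: D_def)
  with S show "\<exists>S\<in>\<H>. diam_mean_equicontinuity_point \<mu> \<H> dH (set_action act) S
    \<and> dH A S < r" by blast
qed

text \<open>
  The displacement of a set \<open>A1\<close> near \<open>A\<close> has two parts. Points of \<open>A1\<close> lie in a closed neighbourhood
  \<open>B\<close> of \<open>A\<close>, which is nested with \<open>A\<close>. Points of \<open>A\<close> are compared with a finite set \<open>S \<subseteq> A\<close>,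
  again nested with \<open>A\<close>, and the points of \<open>S\<close> with nearby points of \<open>A1\<close>; the last comparison
  has to be uniform over all \<open>A1\<close> and uses diameters of balls around the points of \<open>S\<close>. The radius
  \<open>\<eta>\<close> of these balls is chosen after \<open>S\<close>, so that the number of summands is harmless.
\<close>

lemma weakly_mean_of_sets_imp_diam_mean_of_sets:
  assumes wm: "weakly_mean_equicontinuous \<mu> \<H> dH (set_action act)"
  shows "diam_mean_equicontinuous \<mu> \<H> dH (set_action act)"
  unfolding diam_mean_equicontinuous_def
proof
  fix A assume A: "A \<in> \<H>"
  note A' = hyperspaceD[OF A]
  show "diam_mean_equicontinuity_point \<mu> \<H> dH (set_action act) A"
  proof (rule HY.diam_mean_pointI[OF A])
    fix e :: real assume "0 < e"
    then have e: "0 < e / 3" by simp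
    obtain \<delta> where \<delta>: "0 < \<delta>" "\<And>B F. B \<in> \<H> \<Longrightarrow> dH A B \<le> \<delta> \<Longrightarrow> A \<subseteq> B \<or> B \<subseteq> A \<Longrightarrow>
      folner \<mu> F \<Longrightarrow> \<forall>\<^sub>F n in sequentially. HY.avg_dist (F n) A B < e / 3"
      using weakly_mean_nested[OF wm A e] by metis
    define B where "B = {x \<in> M. infd x A \<le> \<delta>}"
    have B: "B \<in> \<H>" unfolding B_def by (rule closed_neighbourhood_mem_hyperspace[OF A \<delta>(1)])
    have AB: "A \<subseteq> B" using A' \<delta>(1) infd_mem unfolding B_def by force
    have nearB: "dH A B \<le> \<delta>"
    proof (rule hausdorff_le[OF A B])
      fix a assume "a \<in> A"
      then show "infd a B \<le> \<delta>" using infd_mem[of a B] AB A' \<delta>(1) by force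
    qed (simp add: B_def)
    obtain S where S: "finite S" "S \<subseteq> A" "S \<in> \<H>" "dH A S \<le> \<delta>"
      using finite_inner_net[OF A \<delta>(1)] by metis
    have SM: "S \<subseteq> M" using S(2) A'(2) by auto
    have pt: "diam_mean_equicontinuity_point \<mu> M d act x" if "x \<in> S" for x
      using weakly_mean_of_sets_imp_diam_mean[OF wm] that SM by (auto simp: diam_mean_equicontinuous_def)
    obtain \<eta>' where \<eta>': "0 < \<eta>'" "\<And>\<delta> F n. 0 < \<delta> \<Longrightarrow> \<delta> \<le> \<eta>' \<Longrightarrow> folner \<mu> F \<Longrightarrow>
        integrable (unif (F n)) (\<lambda>g. \<Sum>a\<in>S. mset_diam d (act g ` mcball a \<delta>))"
      "\<And>\<delta> F. 0 < \<delta> \<Longrightarrow> \<delta> \<le> \<eta>' \<Longrightarrow> folner \<mu> F \<Longrightarrow>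
        \<forall>\<^sub>F n in sequentially. (LINT g|unif (F n). (\<Sum>a\<in>S. mset_diam d (act g ` mcball a \<delta>))) < e / 3"
      using sum_diam_average[OF S(1) SM pt e] by blast
    define \<eta> where "\<eta> = min \<eta>' \<delta>"
    have \<eta>: "0 < \<eta>" "\<eta> \<le> \<eta>'" "\<eta> / 2 \<le> \<delta>" using \<eta>'(1) \<delta>(1) by (auto simp: \<eta>_def)
    let ?h = "\<lambda>C g. dH (set_action act g A) (set_action act g C)"
    let ?s = "\<lambda>g. \<Sum>a\<in>S. mset_diam d (act g ` mcball a \<eta>)"
    let ?R = "\<lambda>g. ?h B g + ?h S g + ?s g"
    have s_nonneg: "0 \<le> ?s g" for g
      using SM \<eta>(1) mcball_eq_empty
      by (intro sum_nonneg mset_diam_nonneg image_subset mcball_subset_mspace) fastforce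
    have le: "dH (set_action act g A) (set_action act g A1) \<le> ?R g"
      if A1: "A1 \<in> \<H>" and near: "dH A A1 \<le> \<eta> / 2" for g A1
      unfolding set_action_def
    proof (rule hausdorff_le[OF image_mem_hyperspace[OF A] image_mem_hyperspace[OF A1]])
      note gH = image_mem_hyperspace[OF A, of g] image_mem_hyperspace[OF B, of g] image_mem_hyperspace[OF S(3), of g]
        image_mem_hyperspace[OF A1, of g]
      fix u assume u: "u \<in> act g ` A"
      then have uM: "u \<in> M" using A' by auto
      have "infd u (act g ` A1) - ?s g \<le> infd u (act g ` S)"
      proof (rule infd_greatest)
        show "act g ` S \<noteq> {}" using hyperspaceD(3)[OF gH(3)] .
        fix v assume "v \<in> act g ` S"
        then obtain s where s: "s \<in> S" "v = act g s" by auto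
        have sA: "s \<in> A" using s S by auto
        have "infd s A1 \<le> \<eta> / 2" using infd_le_hausdorff[OF A A1 sA] near by simp
        then obtain a where a: "a \<in> A1" "d s a \<le> \<eta>" "a \<in> M" using infd_le_halfD[OF A1 _ \<eta>(1)] by blast
        have M: "v \<in> M" using s SM by auto
        have "infd u (act g ` A1) \<le> d u (act g a)" using a by (intro infd_le) auto
        also have "\<dots> \<le> d u v + d v (act g a)" using uM M a by (intro triangle) auto
        also have "d v (act g a) \<le> ?s g" unfolding s(2) by (rule infd_action_le_sum_diam[OF S(1) SM \<eta>(1) s(1) a(3,2)])
        finally show "infd u (act g ` A1) - ?s g \<le> d u v" by simp
      qed
      moreover have "infd u (act g ` S) \<le> dH (act g ` A) (act g ` S)"
        by (rule infd_le_hausdorff[OF gH(1,3) u])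
      ultimately show "infd u (act g ` A1) \<le> dH (act g ` A) (act g ` B)
        + dH (act g ` A) (act g ` S) + ?s g"
        using hausdorff_nonneg[of "act g ` A" "act g ` B"] by linarith
    next
      fix u assume "u \<in> act g ` A1"
      then obtain a where a: "a \<in> A1" "u = act g a" by auto
      have "infd a A \<le> \<delta>" using infd_le_hausdorff'[OF A A1 a(1)] near \<eta>(3) by simp
      then have "u \<in> act g ` B" using a hyperspaceD(2)[OF A1] by (auto simp: B_def)
      from infd_le_hausdorff'[OF image_mem_hyperspace[OF A, of g] image_mem_hyperspace[OF B, of g] this]
      show "infd u (act g ` A) \<le> dH (act g ` A) (act g ` B)
        + dH (act g ` A) (act g ` S) + ?s g"
        using hausdorff_nonneg[of "act g ` A" "act g ` S"] s_nonneg[of g] by linarith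
    qed
    have avg: "(\<forall>n. integrable (unif (F n)) ?R) \<and> (\<forall>\<^sub>F n in sequentially. (LINT g|unif (F n). ?R g) < e)"
      if F: "folner \<mu> F" for F
    proof
      note iB = HY.integrable_dist_orbit[OF F A B] and iS = HY.integrable_dist_orbit[OF F A S(3)]
        and i_sum = \<eta>'(2)[OF \<eta>(1,2) F]
      show "\<forall>n. integrable (unif (F n)) ?R"
        by (intro allI Bochner_Integration.integrable_add iB iS i_sum)
      have "\<forall>\<^sub>F n in sequentially. HY.avg_dist (F n) A B < e / 3" using AB by (intro \<delta>(2) B nearB F) simp
      moreover have "\<forall>\<^sub>F n in sequentially. HY.avg_dist (F n) A S < e / 3" using S(2) by (intro \<delta>(2) S F) simp
      moreover have "\<forall>\<^sub>F n in sequentially. (LINT g|unif (F n). ?s g) < e / 3" by (rule \<eta>'(3)[OF \<eta>(1,2) F])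
      ultimately show "\<forall>\<^sub>F n in sequentially. (LINT g|unif (F n). ?R g) < e"
      proof eventually_elim
        case (elim n)
        have "(LINT g|unif (F n). ?R g) = HY.avg_dist (F n) A B + HY.avg_dist (F n) A S + (LINT g|unif (F n). ?s g)"
          unfolding HY.avg_dist_def
          by (subst Bochner_Integration.integral_add[OF Bochner_Integration.integrable_add[OF iB iS] i_sum],
              subst Bochner_Integration.integral_add[OF iB iS]) (rule refl)
        with elim show ?case by linarith
      qed
    qed
    show "\<exists>\<delta> R. 0 < \<delta> \<and> (\<forall>g. \<forall>A1\<in>\<H>. dH A A1 \<le> \<delta> \<longrightarrow>
          dH (set_action act g A) (set_action act g A1) \<le> R g) \<and>
        (\<forall>F. folner \<mu> F \<longrightarrow> (\<forall>n. integrable (unif (F n)) R) \<and> (\<forall>\<^sub>F n in sequentially. (LINT g|unif (F n). R g) < e))"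
      using \<eta>(1) le avg by (intro exI[of _ "\<eta> / 2"] exI[of _ ?R]) auto
  qed
qed

end

section \<open>The equivalences\<close>

theorem corollary6p8:
  fixes \<mu> :: "'g::{topological_group_add, t2_space} measure"
    and X :: "'x set" and d :: "'x \<Rightarrow> 'x \<Rightarrow> real"
    and act :: "'g \<Rightarrow> 'x \<Rightarrow> 'x"
  assumes "locally_compact_space (euclidean :: 'g topology)"
    and "sigma_compact_group TYPE('g)"
    and "left_haar_measure \<mu>"
    and "amenable \<mu>"
    and "compact_metric X d"
    and "continuous_action X d act"
  shows
    "((mean_equicontinuous \<mu> X d act \<longleftrightarrow>
         mean_equicontinuous \<mu> (prob_measures X d) (wasserstein X d) (measure_action X d act)) \<and>
      (mean_equicontinuous \<mu> (prob_measures X d) (wasserstein X d) (measure_action X d act) \<longleftrightarrow>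
         weakly_mean_equicontinuous \<mu> (prob_measures X d) (wasserstein X d) (measure_action X d act)))
     \<and>
     (diam_mean_equicontinuous \<mu> X d act \<longleftrightarrow>
         diam_mean_equicontinuous \<mu> (prob_measures X d) (wasserstein X d) (measure_action X d act))
     \<and>
     ((diam_mean_equicontinuous \<mu> (hyperspace X d) (hausdorff_metric X d) (set_action act) \<longleftrightarrow>
         mean_equicontinuous \<mu> (hyperspace X d) (hausdorff_metric X d) (set_action act)) \<and>
      (mean_equicontinuous \<mu> (hyperspace X d) (hausdorff_metric X d) (set_action act) \<longleftrightarrow>
         weakly_mean_equicontinuous \<mu> (hyperspace X d) (hausdorff_metric X d) (set_action act)))
     \<and>
     (diam_mean_equicontinuous \<mu> (hyperspace X d) (hausdorff_metric X d) (set_action act) \<longrightarrow>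
         diam_mean_equicontinuous \<mu> X d act)
     \<and>
     (almost_diam_mean_equicontinuous \<mu> X d act \<longrightarrow>
         almost_diam_mean_equicontinuous \<mu> (prob_measures X d) (wasserstein X d) (measure_action X d act) \<and>
         almost_diam_mean_equicontinuous \<mu> (hyperspace X d) (hausdorff_metric X d) (set_action act))"
proof -
  interpret Metric_space X d using assms(5) by (simp add: compact_metric_def)
  have compact: "compact_space mtopology" using assms(5) by (simp add: compact_metric_def)
  have cont: "continuous_map (prod_topology euclidean mtopology) mtopology (\<lambda>(g, x). act g x)"
    using assms(6) by (simp add: continuous_action_def)
  show ?thesis
  proof (cases "X = {}")
    case True
    have "\<nu> \<notin> prob_measures X d" for \<nu>
    proof
      assume "\<nu> \<in> prob_measures X d"
      then have "sets \<nu> = sets (mborel X d)" "prob_space \<nu>" by (auto simp: prob_measures_def)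
      moreover have "{U. openin mtopology U} \<subseteq> Pow X" using openin_subset[of mtopology] by auto
      then have "space (mborel X d) = X" unfolding mborel_def by (rule space_measure_of)
      ultimately show False using prob_space.not_empty sets_eq_imp_space_eq True by metis
    qed
    then have "prob_measures X d = {}" by auto
    moreover have "\<And>A. closedin mtopology A \<Longrightarrow> A \<subseteq> X" using closedin_subset[of mtopology] by auto
    then have "hyperspace X d = {}" using True unfolding hyperspace_def by blast
    ultimately show ?thesis using True
      by (simp add: mean_equicontinuous_def weakly_mean_equicontinuous_def diam_mean_equicontinuous_def
          almost_diam_mean_equicontinuous_def)
  next
    case False
    obtain K C where KC: "0 < K" "\<And>x y. x \<in> X \<Longrightarrow> y \<in> X \<Longrightarrow> d x y \<le> K" "countable C" "C \<subseteq> X"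
      "\<And>x e. x \<in> X \<Longrightarrow> 0 < e \<Longrightarrow> \<exists>c\<in>C. d x c < e"
      using compact_imp_bounded_separable[OF compact] by metis
    have "continuous_map mtopology mtopology (act g)" for g
    proof -
      have "continuous_map mtopology (prod_topology euclidean mtopology) (\<lambda>x. (g, x))"
        by (intro continuous_map_pairedI) (auto simp: continuous_map_const)
      from continuous_map_compose[OF this cont] show ?thesis by (simp add: comp_def)
    qed
    moreover have "act g x \<in> X" if "x \<in> X" for g x
      using continuous_map_funspace[OF cont] that by (auto simp: Pi_iff)
    ultimately interpret compact_action X d K C \<mu> act
      using KC compact False assms(3) uniformly_close_near[OF compact cont]
      by unfold_locales (auto simp: left_haar_measure_def)
    show ?thesis
      using mean_of_measures_imp_mean mean_imp_mean_of_measures weakly_mean_of_measures_imp_mean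
        PM.mean_imp_weakly_mean_equicontinuous diam_mean_of_measures_imp_diam_mean
        diam_mean_imp_diam_mean_of_measures HY.diam_mean_imp_mean_equicontinuous
        HY.mean_imp_weakly_mean_equicontinuous weakly_mean_of_sets_imp_diam_mean_of_sets
        weakly_mean_of_sets_imp_diam_mean almost_diam_mean_measures almost_diam_mean_sets
      by blast
  qed
qed

end
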